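(* Existence and unique existence of a $g$-measure are invariants of the topological conjugacy of residually defined $g$-functions. That is: let $X\subset\Sigma^{\mathbb Z}$ and $\widetilde X\subset\widetilde\Sigma^{\mathbb Z}$ be property $(D)$ subshifts, $g$ a residually defined $g$-function of $X$, $\widetilde g$ a residually defined $g$-function of $\widetilde X$, and suppose $\widetilde g$ is the image of $g$ under a topological conjugacy $\varphi:X\to\widetilde X$. Then there exists a $g$-measure for $g$ if and only if there exists a $g$-measure for $\widetilde g$; and there exists exactly one $g$-measure for $g$ if and only if there exists exactly one $g$-measure for $\widetilde g$.
   Context: Subshifts. $\Sigma,\widetilde\Sigma$ are finite alphabets, $S$ is the shift, $(Sx)_i=x_{i+1}$. A subshift is a closed $S$-invariant set $X\subset\Sigma^{\mathbb Z}$; a finite word is admissible if it appears in some point of $X$. For an interval $J\subset\mathbb Z$, $x_J=(x_j)_{j\in J}$ and $X_J=\{x_J:x\in X\}$ with the product topology; blocks are identified with words up to translation of indices. A topological conjugacy is a shift-commuting homeomorphism. A set is residual if it contains a dense $G_\delta$. For $x^-\in X_{(-\infty,i]}$, $\Gamma_n^+(x^-)$ is the set of words $b$ of length $n$ with $(x^-,b)\in X_{(-\infty,i+n]}$. For an admissible word $a$, $\Gamma_n^+(a)$ is the set of words $b$ of length $n$ with $ab$ admissible, $\Gamma^-(a)$ is the set of finite words $c$ with $ca$ admissible, $\Gamma_\infty^-(a)$ is the set of left-infinite sequences $x^-$ such that $(x^-,a)$ is, up to translation, in $X_{(-\infty,0]}$, and $\omega_n^+(a)$ is the set of words $b$ of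 length $n$ such that $(x^-,a,b)$ is, up to translation, in $X_{(-\infty,0]}$ for all $x^-\in\Gamma_\infty^-(a)$. Property $(D)$: for every admissible word $b\sigma$ ($\sigma\in\Sigma$) there is $a\in\Gamma^-(b)$ with $\sigma\in\omega_1^+(ab)$. Residually defined $g$-function of $X$: a continuous function $g:D^-(g)\times\Sigma\to[0,1]$, $D^-(g)$ residual in $X_{(-\infty,0]}$, such that (i) $\sum_{\sigma\in\Gamma_1^+(x^-)}g(x^-,\sigma)=1$ for $x^-\in D^-(g)$, and $g(x^-,\sigma)=0$ if $\sigma\notin\Gamma_1^+(x^-)$; (ii) there is no point of $X_{(-\infty,0]}\setminus D^-(g)$ to which $x^-\mapsto(g(x^-,\sigma))_{\sigma\in\Sigma}$ can be extended by continuity; (iii) $X_{(-\infty,1]}=\overline{\{(x^-,\alpha):x^-\in D^-(g),\alpha\in\Gamma_1^+(x^-),g(x^-,\alpha)>0\}}$. By translation, $g(x^-,\alpha)$ is also used for $x^-\in S^{-i}D^-(g)\subset X_{(-\infty,i]}$. $g$-measure for $g$: an $S$-invariant Borel probability measure $\mu$ on $X$ such that $\mu(\{x\in X:x_{(-\infty,0]}\in D^-(g)\})=1$ and $$\mu(\{x\in X:x_{(-\infty,0]}\in D^-(g),\,x_{[-k,1]}=(a,\alpha)\})=\int_{\{x\in X:\,x_{(-\infty,0]}\in D^-(g),\,x_{[-k,0]}=a\}}g(x_{(-\infty,0]},\alpha)\,d\mu$$ for all $k\in\mathbb N$, $a\in X_{[-k,0]}$, $\alpha\in\Gamma_1^+(a)$.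 The set $E(g)$: the set of $x\in X$ such that for all $i\in\mathbb Z$: $x_{(-\infty,i]}\in S^{-i}D^-(g)$, $g(x_{(-\infty,i]},x_{i+1})>0$, and for all $k\in\mathbb N$ and all $a\in\Gamma_k^+(x_{(-\infty,i]})$, $(x_{(-\infty,i]},a)\in S^{-i-k}D^-(g)$. Measures on fibers. For $x\in E(g)$, $i\in\mathbb Z$: $F_i(x)=\{y\in X:y_{(-\infty,i]}=x_{(-\infty,i]}\}$, $F_i(x,a)=\{y\in F_i(x):y_{(i,i+n]}=a\}$, and $\mu_i^{(g)}(x_{(-\infty,i]})$ is the Borel probability measure on $F_i(x)$ with $$\mu_i^{(g)}(x_{(-\infty,i]})(F_i(x,a))=\prod_{1\le k\le N}g\big((x_{(-\infty,i]},a_1\cdots a_{k-1}),a_k\big)$$ for $a=a_1\cdots a_N\in\Gamma_N^+(x_{(-\infty,i]})$, $N\in\mathbb N$. There is a $\sigma$-finite measure $\lambda_x^{(g)}$ on $\bigcup_{k\in\mathbb N}F_{-k}(x)$, unique up to multiplication by a positive constant, such that for all $i\in\mathbb Z$: $0<\lambda_x^{(g)}(F_i(x))<\infty$ and $\lambda_x^{(g)}|_{F_i(x)}/\lambda_x^{(g)}(F_i(x))=\mu_i^{(g)}(x_{(-\infty,i]})$. Image. $\widetilde g$ is the image of $g$ under the topological conjugacy $\varphi:X\to\widetilde X$ if $\varphi(E(g))=E(\widetilde g)$ and, for all $x\in E(g)$, the image under $\varphi^{-1}$ of $\lambda^{(\widetilde g)}_{\varphi(x)}$ is a positive scalar multiple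 of $\lambda_x^{(g)}$. *)

theory Defs
  imports "HOL-Probability.Probability"
begin

text \<open>
  The alphabet is a type of sort \<open>{finite, discrete_topology}\<close>, so that \<open>int \<Rightarrow> 'a\<close> carries the
  product topology. A block \<open>x\<^sub>J\<close> over an infinite interval \<open>J\<close> is the function \<open>restrict x J\<close>, which
  is \<open>undefined\<close> off \<open>J\<close>; the product topology on \<open>X\<^sub>J\<close> is then the subspace topology of
  \<open>int \<Rightarrow> 'a\<close>. Finite words are lists, and \<open>x\<close> over \<open>[i,j]\<close> is the list \<open>map x [i..j]\<close>.
\<close>

text \<open>\<open>shiftby k\<close> is the power \<open>S\<^sup>k\<close>, also acting on blocks: it takes blocks over \<open>(-\<infinity>,i]\<close> to
  blocks over \<open>(-\<infinity>,i-k]\<close>.\<close>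
definition shiftby :: "int \<Rightarrow> (int \<Rightarrow> 'a) \<Rightarrow> (int \<Rightarrow> 'a)" where
  "shiftby k x = (\<lambda>i. x (i + k))"

definition shift :: "(int \<Rightarrow> 'a) \<Rightarrow> (int \<Rightarrow> 'a)" where
  "shift = shiftby 1"

definition subshift :: "(int \<Rightarrow> 'a::{finite,discrete_topology}) set \<Rightarrow> bool" where
  "subshift X \<longleftrightarrow> closed X \<and> shift ` X = X"

definition proj :: "(int \<Rightarrow> 'a) set \<Rightarrow> int set \<Rightarrow> (int \<Rightarrow> 'a) set" where
  "proj X J = (\<lambda>x. restrict x J) ` X"

definition admissible :: "(int \<Rightarrow> 'a) set \<Rightarrow> 'a list \<Rightarrow> bool" where
  "admissible X w \<longleftrightarrow> (\<exists>x\<in>X. \<exists>i. map x [i+1..i + int (length w)] = w)"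

text \<open>The concatenation \<open>(x,b)\<close> of a block \<open>x\<close> over \<open>(-\<infinity>,i]\<close> with a word \<open>b\<close>, a block over
  \<open>(-\<infinity>,i + length b]\<close>.\<close>
definition cat :: "int \<Rightarrow> (int \<Rightarrow> 'a) \<Rightarrow> 'a list \<Rightarrow> (int \<Rightarrow> 'a)" where
  "cat i x b = (\<lambda>j. if j \<le> i then x j
                    else if j \<le> i + int (length b) then b ! nat (j - i - 1)
                    else undefined)"

text \<open>\<open>\<Gamma>\<^sub>n\<^sup>+(x)\<close> for a block \<open>x\<close> over \<open>(-\<infinity>,i]\<close>.\<close>
definition followers :: "(int \<Rightarrow> 'a) set \<Rightarrow> int \<Rightarrow> nat \<Rightarrow> (int \<Rightarrow> 'a) \<Rightarrow> 'a list set" where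
  "followers X i n x = {b. length b = n \<and> cat i x b \<in> proj X {..i + int n}}"

text \<open>\<open>\<Gamma>\<^sub>n\<^sup>+(a)\<close> for a word \<open>a\<close>.\<close>
definition word_followers :: "(int \<Rightarrow> 'a) set \<Rightarrow> nat \<Rightarrow> 'a list \<Rightarrow> 'a list set" where
  "word_followers X n a = {b. length b = n \<and> admissible X (a @ b)}"

text \<open>\<open>\<Gamma>\<^sup>-(a)\<close>.\<close>
definition word_predecessors :: "(int \<Rightarrow> 'a) set \<Rightarrow> 'a list \<Rightarrow> 'a list set" where
  "word_predecessors X a = {c. admissible X (c @ a)}"

text \<open>\<open>\<Gamma>\<^sub>\<infinity>\<^sup>-(a)\<close>; left-infinite sequences are indexed by \<open>(-\<infinity>,0]\<close>.\<close>
definition pasts :: "(int \<Rightarrow> 'a) set \<Rightarrow> 'a list \<Rightarrow> (int \<Rightarrow> 'a) set" where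
  "pasts X a = {x \<in> extensional {..0}. shiftby (int (length a)) (cat 0 x a) \<in> proj X {..0}}"

text \<open>\<open>\<omega>\<^sub>n\<^sup>+(a)\<close>.\<close>
definition omega_plus :: "(int \<Rightarrow> 'a) set \<Rightarrow> nat \<Rightarrow> 'a list \<Rightarrow> 'a list set" where
  "omega_plus X n a = {b. length b = n \<and>
     (\<forall>x\<in>pasts X a. shiftby (int (length (a @ b))) (cat 0 x (a @ b)) \<in> proj X {..0})}"

definition property_D :: "(int \<Rightarrow> 'a) set \<Rightarrow> bool" where
  "property_D X \<longleftrightarrow>
     (\<forall>b \<sigma>. admissible X (b @ [\<sigma>]) \<longrightarrow> (\<exists>a\<in>word_predecessors X b. [\<sigma>] \<in> omega_plus X 1 (a @ b)))"

definition residual_in :: "'b topology \<Rightarrow> 'b set \<Rightarrow> bool" where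
  "residual_in T R \<longleftrightarrow> R \<subseteq> topspace T \<and>
     (\<exists>G. gdelta_in T G \<and> T closure_of G = topspace T \<and> G \<subseteq> R)"

text \<open>A residually defined \<open>g\<close>-function is a pair of its domain \<open>D\<close> and a total function \<open>g\<close> of which
  only the values on \<open>D\<close> matter.\<close>
definition residual_g_function ::
  "(int \<Rightarrow> 'a::{finite,discrete_topology}) set \<Rightarrow> (int \<Rightarrow> 'a) set \<Rightarrow> ((int \<Rightarrow> 'a) \<Rightarrow> 'a \<Rightarrow> real) \<Rightarrow> bool"
  where
  "residual_g_function X D g \<longleftrightarrow>
     residual_in (top_of_set (proj X {..0})) D \<and>
     continuous_on (D \<times> UNIV) (\<lambda>(x, \<sigma>). g x \<sigma>) \<and>
     (\<forall>x\<in>D. \<forall>\<sigma>. g x \<sigma> \<in> {0..1}) \<and>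
     (\<forall>x\<in>D. (\<Sum>\<sigma> | [\<sigma>] \<in> followers X 0 1 x. g x \<sigma>) = 1) \<and>
     (\<forall>x\<in>D. \<forall>\<sigma>. [\<sigma>] \<notin> followers X 0 1 x \<longrightarrow> g x \<sigma> = 0) \<and>
     \<not> (\<exists>p \<in> proj X {..0} - D. \<exists>h. continuous_on (insert p D) h \<and> (\<forall>x\<in>D. h x = (\<lambda>\<sigma>. g x \<sigma>))) \<and>
     proj X {..1} =
       closure {cat 0 x [\<alpha>] | x \<alpha>. x \<in> D \<and> [\<alpha>] \<in> followers X 0 1 x \<and> g x \<alpha> > 0}"

text \<open>The translates \<open>S\<^sup>-\<^sup>i D\<close> and \<open>g\<close> on blocks over \<open>(-\<infinity>,i]\<close>.\<close>
definition dom_at :: "(int \<Rightarrow> 'a) set \<Rightarrow> int \<Rightarrow> (int \<Rightarrow> 'a) set" where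
  "dom_at D i = shiftby (- i) ` D"

definition g_at :: "((int \<Rightarrow> 'a) \<Rightarrow> 'a \<Rightarrow> real) \<Rightarrow> int \<Rightarrow> (int \<Rightarrow> 'a) \<Rightarrow> 'a \<Rightarrow> real" where
  "g_at g i x \<alpha> = g (shiftby i x) \<alpha>"

definition g_measure ::
  "(int \<Rightarrow> 'a::{finite,discrete_topology}) set \<Rightarrow> (int \<Rightarrow> 'a) set \<Rightarrow> ((int \<Rightarrow> 'a) \<Rightarrow> 'a \<Rightarrow> real)
     \<Rightarrow> (int \<Rightarrow> 'a) measure \<Rightarrow> bool"
  where
  "g_measure X D g \<mu> \<longleftrightarrow>
     sets \<mu> = sets (restrict_space borel X) \<and> prob_space \<mu> \<and> distr \<mu> \<mu> shift = \<mu> \<and>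
     measure \<mu> {x\<in>X. restrict x {..0} \<in> D} = 1 \<and>
     (\<forall>k::nat. \<forall>a \<in> (\<lambda>x. map x [- int k..0]) ` X. \<forall>\<alpha>. [\<alpha>] \<in> word_followers X 1 a \<longrightarrow>
        measure \<mu> {x\<in>X. restrict x {..0} \<in> D \<and> map x [- int k..1] = a @ [\<alpha>]} =
        (LINT x:{x\<in>X. restrict x {..0} \<in> D \<and> map x [- int k..0] = a}|\<mu>. g (restrict x {..0}) \<alpha>))"

text \<open>\<open>E(g)\<close>.\<close>
definition E_set ::
  "(int \<Rightarrow> 'a) set \<Rightarrow> (int \<Rightarrow> 'a) set \<Rightarrow> ((int \<Rightarrow> 'a) \<Rightarrow> 'a \<Rightarrow> real) \<Rightarrow> (int \<Rightarrow> 'a) set"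
  where
  "E_set X D g = {x\<in>X. \<forall>i.
     restrict x {..i} \<in> dom_at D i \<and>
     g_at g i (restrict x {..i}) (x (i + 1)) > 0 \<and>
     (\<forall>k. \<forall>a\<in>followers X i k (restrict x {..i}).
        cat i (restrict x {..i}) a \<in> dom_at D (i + int k))}"

text \<open>\<open>F\<^sub>i(x)\<close> depends only on \<open>x\<close> over \<open>(-\<infinity>,i]\<close>, so \<open>x\<close> may also be a block over \<open>(-\<infinity>,i]\<close>.\<close>
definition fiber :: "(int \<Rightarrow> 'a) set \<Rightarrow> int \<Rightarrow> (int \<Rightarrow> 'a) \<Rightarrow> (int \<Rightarrow> 'a) set" where
  "fiber X i x = {y\<in>X. restrict y {..i} = restrict x {..i}}"

definition fiber_cyl :: "(int \<Rightarrow> 'a) set \<Rightarrow> int \<Rightarrow> (int \<Rightarrow> 'a) \<Rightarrow> 'a list \<Rightarrow> (int \<Rightarrow> 'a) set" where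
  "fiber_cyl X i x a = {y \<in> fiber X i x. map y [i+1..i + int (length a)] = a}"

text \<open>The measure \<open>\<mu>\<^sub>i\<^sup>(\<^sup>g\<^sup>)(x)\<close> on \<open>F\<^sub>i(x)\<close>, for a block \<open>x\<close> over \<open>(-\<infinity>,i]\<close>. The letter \<open>a\<^sub>k\<close> of the
  product over \<open>1 \<le> k \<le> N\<close> is \<open>a ! (k - 1)\<close>.\<close>
definition fiber_measure ::
  "(int \<Rightarrow> 'a::{finite,discrete_topology}) set \<Rightarrow> ((int \<Rightarrow> 'a) \<Rightarrow> 'a \<Rightarrow> real) \<Rightarrow> int \<Rightarrow> (int \<Rightarrow> 'a)
     \<Rightarrow> (int \<Rightarrow> 'a) measure"
  where
  "fiber_measure X g i x = (THE \<nu>.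
     sets \<nu> = sets (restrict_space borel (fiber X i x)) \<and> prob_space \<nu> \<and>
     (\<forall>N. \<forall>a\<in>followers X i N x.
        measure \<nu> (fiber_cyl X i x a) =
          (\<Prod>k=1..N. g_at g (i + int (k - 1)) (cat i x (take (k - 1) a)) (a ! (k - 1)))))"

definition fiber_union :: "(int \<Rightarrow> 'a) set \<Rightarrow> (int \<Rightarrow> 'a) \<Rightarrow> (int \<Rightarrow> 'a) set" where
  "fiber_union X x = (\<Union>k::nat. fiber X (- int k) x)"

definition is_lambda ::
  "(int \<Rightarrow> 'a::{finite,discrete_topology}) set \<Rightarrow> ((int \<Rightarrow> 'a) \<Rightarrow> 'a \<Rightarrow> real) \<Rightarrow> (int \<Rightarrow> 'a)
     \<Rightarrow> (int \<Rightarrow> 'a) measure \<Rightarrow> bool"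
  where
  "is_lambda X g x L \<longleftrightarrow>
     sets L = sets (restrict_space borel (fiber_union X x)) \<and> sigma_finite_measure L \<and>
     (\<forall>i. 0 < emeasure L (fiber X i x) \<and> emeasure L (fiber X i x) < \<infinity> \<and>
        scale_measure (1 / emeasure L (fiber X i x)) (restrict_space L (fiber X i x)) =
          fiber_measure X g i (restrict x {..i}))"

text \<open>\<open>\<lambda>\<^sub>x\<^sup>(\<^sup>g\<^sup>)\<close>, determined by \<open>is_lambda\<close> up to a positive constant for \<open>x \<in> E(g)\<close>; one representative is
  chosen.\<close>
definition lambda_measure ::
  "(int \<Rightarrow> 'a::{finite,discrete_topology}) set \<Rightarrow> ((int \<Rightarrow> 'a) \<Rightarrow> 'a \<Rightarrow> real) \<Rightarrow> (int \<Rightarrow> 'a)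
     \<Rightarrow> (int \<Rightarrow> 'a) measure"
  where
  "lambda_measure X g x = (SOME L. is_lambda X g x L)"

definition topological_conjugacy ::
  "(int \<Rightarrow> 'a::{finite,discrete_topology}) set \<Rightarrow> (int \<Rightarrow> 'b::{finite,discrete_topology}) set
     \<Rightarrow> ((int \<Rightarrow> 'a) \<Rightarrow> (int \<Rightarrow> 'b)) \<Rightarrow> bool"
  where
  "topological_conjugacy X Y \<phi> \<longleftrightarrow>
     (\<exists>\<psi>. homeomorphism X Y \<phi> \<psi>) \<and> (\<forall>x\<in>X. \<phi> (shift x) = shift (\<phi> x))"

text \<open>\<open>(D', g')\<close> is the image of \<open>(D, g)\<close> under \<open>\<phi>\<close>.\<close>
definition g_image ::
  "(int \<Rightarrow> 'a::{finite,discrete_topology}) set \<Rightarrow> (int \<Rightarrow> 'a) set \<Rightarrow> ((int \<Rightarrow> 'a) \<Rightarrow> 'a \<Rightarrow> real)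
     \<Rightarrow> (int \<Rightarrow> 'b::{finite,discrete_topology}) set \<Rightarrow> (int \<Rightarrow> 'b) set \<Rightarrow> ((int \<Rightarrow> 'b) \<Rightarrow> 'b \<Rightarrow> real)
     \<Rightarrow> ((int \<Rightarrow> 'a) \<Rightarrow> (int \<Rightarrow> 'b)) \<Rightarrow> bool"
  where
  "g_image X D g Y D' g' \<phi> \<longleftrightarrow>
     \<phi> ` E_set X D g = E_set Y D' g' \<and>
     (\<forall>x \<in> E_set X D g. \<exists>c::real. c > 0 \<and>
        distr (lambda_measure Y g' (\<phi> x)) (restrict_space borel (fiber_union X x)) (inv_into X \<phi>) =
        scale_measure (ennreal c) (lambda_measure X g x))"

end

(* A \<open>g\<close>-measure \<open>\<mu>\<close> is not assumed to be carried by \<open>E(g)\<close>, so the hypothesis on the image of \<open>g\<close>, which only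
   concerns \<open>E(g)\<close>, says nothing about \<open>\<mu>\<close>-typical points directly. By property (D) and Baire's theorem,
   however, \<open>E(g)\<close> is dense in \<open>X\<close>, and by maximality of the domain the function \<open>g\<close> is the largest
   continuous extension of its restriction to the pasts of points of \<open>E(g)\<close>.

   Let \<open>\<phi>\<close> and its inverse have window \<open>[-m,m]\<close>. For \<open>x\<close> in \<open>E(g)\<close> and \<open>y = \<phi>(x)\<close> the
   proportionality of the measures \<open>\<lambda>\<close> writes \<open>g'(y\<^bsub>(-\<infinity>,0]\<^esub>, \<beta>)\<close> as a quotient of two finite sums of
   products of values of \<open>g\<close> along words of length \<open>2m+1\<close> following \<open>x\<^bsub>(-\<infinity>,-m]\<^esub>\<close>. For \<open>\<mu>\<close>-almost every \<open>x\<close>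
   these sums have limits along \<open>E(g)\<close>: a word that leaves the domain of \<open>g\<close> does so after a factor zero, and
   the later factors are bounded. The denominator is positive almost everywhere, being the conditional
   probability of what \<open>\<phi>(x)\<close> does on \<open>(-2m,0]\<close>. Hence \<open>y\<^bsub>(-\<infinity>,0]\<^esub>\<close> lies in the domain of \<open>g'\<close>, and \<open>g'\<close>
   is the conditional probability of the next letter under \<open>\<phi>\<^sub>*\<mu>\<close>. So \<open>\<phi>\<^sub>*\<close> maps \<open>g\<close>-measures to
   \<open>g'\<close>-measures, and its inverse does the converse. *)

theory Submission
  imports Defs
begin

section \<open>Cylinders and the Borel sets of the sequence space\<close>

text \<open>The hypothesis on the image speaks through \<open>lambda_measure\<close> and
  \<open>fiber_measure\<close>, chosen by \<open>SOME\<close> and \<open>THE\<close>. It carries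
  information only once the fiber measures are known to exist and be unique on \<open>E(g)\<close>,
  and \<open>\<lambda>\<close> to exist there. A second obstacle: \<open>D\<close> is only known to
  be residual, and a residual set need not be Borel. Maximality helps here too, since
  \<open>D\<close> consists of the pasts at which the oscillation of \<open>g\<close> along
  \<open>D\<close> vanishes, a G_delta in a closed set. Density of \<open>E(g)\<close> concerns
  pasts, and perturbing the past of a point could forbid its future. Property (D) repairs this:
  after a prolongation to the left, every past sharing a long enough block admits the prescribed
  future word. The block of \<phi>(x) on (-2m,0] enters the quotient because x on (-\<infinity>,-m]
  fixes \<phi>(x) only on (-\<infinity>,-2m]. This block is not a function of the conditioning past,
  so events are split by its finitely many values before conditioning.\<close>

definition agree :: "int set \<Rightarrow> (int \<Rightarrow> 'a) \<Rightarrow> (int \<Rightarrow> 'a) \<Rightarrow> bool" where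
  "agree J x y \<longleftrightarrow> (\<forall>j\<in>J. x j = y j)"

lemma agree_refl [simp]: "agree J x x"
  by (simp add: agree_def)

lemma agree_sym: "agree J x y \<Longrightarrow> agree J y x"
  by (simp add: agree_def)

lemma agree_trans: "agree J x y \<Longrightarrow> agree J y z \<Longrightarrow> agree J x z"
  by (simp add: agree_def)

lemma agree_mono: "agree J x y \<Longrightarrow> I \<subseteq> J \<Longrightarrow> agree I x y"
  by (auto simp: agree_def)

lemma restrict_eq_iff_agree: "restrict x J = restrict y J \<longleftrightarrow> agree J x y"
  by (auto simp: agree_def restrict_def fun_eq_iff)

lemma agree_restrict [simp]: "I \<subseteq> J \<Longrightarrow> agree I (restrict x J) y \<longleftrightarrow> agree I x y"
  "I \<subseteq> J \<Longrightarrow> agree I y (restrict x J) \<longleftrightarrow> agree I y x"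
  by (auto simp: agree_def subset_iff)

lemma map_eq_iff_agree: "map x [a..b] = map y [a..b] \<longleftrightarrow> agree {a..b} x y"
  by (auto simp: agree_def)

section \<open>Topology of the sequence space through agreement on finite windows\<close>

lemma continuous_on_eval: "continuous_on S (\<lambda>x::int \<Rightarrow> 'a::topological_space. x j)"
  by (rule continuous_on_subset[OF continuous_on_product_coordinates subset_UNIV])

lemma open_eval: "open {y :: int \<Rightarrow> 'a::discrete_topology. P (y j)}"
proof -
  have "open ({a. P a} :: 'a set)"
    by (rule discrete_topology_class.open_discrete)
  from open_vimage[OF this continuous_on_eval[of UNIV j]]
  have "open ((\<lambda>y::int \<Rightarrow> 'a. y j) -` {a. P a})" .
  then show ?thesis by (simp add: vimage_def)
qed

lemma open_agree:
  fixes x :: "int \<Rightarrow> 'a::discrete_topology"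
  assumes "finite J" shows "open {y. agree J x y}"
proof -
  have "{y. agree J x y} = (\<Inter>j\<in>J. {y. x j = y j})" by (auto simp: agree_def)
  then show ?thesis using assms by (auto intro!: open_INT open_eval)
qed

lemma closed_agree:
  fixes x :: "int \<Rightarrow> 'a::discrete_topology"
  shows "closed {y. agree J x y}"
proof -
  have "- {y. agree J x y} = (\<Union>j\<in>J. {y. x j \<noteq> y j})" by (auto simp: agree_def)
  then show ?thesis unfolding closed_def by (auto intro!: open_UN open_eval)
qed

text \<open>A basic open set restricts finitely many coordinates, and these lie in one symmetric
  window.\<close>

lemma open_contains_agree:
  fixes U :: "(int \<Rightarrow> 'a::discrete_topology) set"
  assumes "open U" "x \<in> U"
  obtains n :: nat where "\<And>y. agree {- int n..int n} x y \<Longrightarrow> y \<in> U"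
proof -
  from assms obtain V where V: "finite {i. V i \<noteq> UNIV}" "x \<in> Pi\<^sub>E UNIV V" "Pi\<^sub>E UNIV V \<subseteq> U"
    unfolding open_fun_def openin_product_topology_alt by force
  define F where "F = {i. V i \<noteq> UNIV}"
  obtain n :: nat where n: "\<forall>i\<in>F. nat \<bar>i\<bar> \<le> n"
    using finite_nat_set_iff_bounded_le[of "(\<lambda>i. nat \<bar>i\<bar>) ` F"] V(1) unfolding F_def by auto
  have "y \<in> U" if "agree {- int n..int n} x y" for y
  proof -
    have "y i \<in> V i" for i
    proof (cases "i \<in> F")
      case True
      then have "i \<in> {- int n..int n}" using n by force
      then show ?thesis using that V(2) by (metis PiE_mem UNIV_I agree_def)
    qed (auto simp: F_def)
    then show ?thesis using V(3) by (auto simp: PiE_iff)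
  qed
  then show ?thesis using that by blast
qed

lemma tendsto_seq_iff:
  fixes x :: "int \<Rightarrow> 'a::discrete_topology"
  shows "(f \<longlongrightarrow> x) F \<longleftrightarrow> (\<forall>j. \<forall>\<^sub>F t in F. f t j = x j)"
proof safe
  fix j assume "(f \<longlongrightarrow> x) F"
  then show "\<forall>\<^sub>F t in F. f t j = x j"
    using topological_tendstoD[of f x F "{y. y j = x j}"] open_eval[of "\<lambda>a. a = x j" j] by simp
next
  assume *: "\<forall>j. \<forall>\<^sub>F t in F. f t j = x j"
  show "(f \<longlongrightarrow> x) F"
  proof (rule topological_tendstoI)
    fix U assume "open U" "x \<in> U"
    then obtain n :: nat where n: "\<And>y. agree {- int n..int n} x y \<Longrightarrow> y \<in> U"
      by (rule open_contains_agree) blast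
    have "\<forall>\<^sub>F t in F. \<forall>j\<in>{- int n..int n}. f t j = x j"
      using * by (intro eventually_ball_finite) auto
    then show "\<forall>\<^sub>F t in F. f t \<in> U"
      by eventually_elim (rule n, auto simp: agree_def)
  qed
qed

lemma compact_UNIV_seq: "compact (UNIV :: (int \<Rightarrow> 'a::{finite,discrete_topology}) set)"
proof -
  have "compact_space (product_topology (\<lambda>_::int. euclidean :: 'a topology) UNIV)"
    unfolding compact_space_product_topology
    by (simp add: compact_space_def finite_imp_compact)
  then show ?thesis
    unfolding euclidean_product_topology compact_space_def by simp
qed

lemma compact_closed_seq:
  fixes X :: "(int \<Rightarrow> 'a::{finite,discrete_topology}) set"
  shows "closed X \<Longrightarrow> compact X"
  using compact_Int_closed[OF compact_UNIV_seq] by force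

lemma closure_seq_iff:
  fixes x :: "int \<Rightarrow> 'a::discrete_topology"
  shows "x \<in> closure S \<longleftrightarrow> (\<forall>n::nat. \<exists>y\<in>S. agree {- int n..int n} x y)"
proof safe
  fix n :: nat assume "x \<in> closure S"
  then have "{y. agree {- int n..int n} x y} \<inter> closure S \<noteq> {}"
    using agree_refl by blast
  then have "{y. agree {- int n..int n} x y} \<inter> S \<noteq> {}"
    using open_Int_closure_eq_empty[OF open_agree[of "{- int n..int n}" x], of S] by auto
  then show "\<exists>y\<in>S. agree {- int n..int n} x y" by blast
next
  assume *: "\<forall>n::nat. \<exists>y\<in>S. agree {- int n..int n} x y"
  show "x \<in> closure S"
  proof (rule ccontr)
    assume "x \<notin> closure S"
    then obtain n :: nat where n: "\<And>y. agree {- int n..int n} x y \<Longrightarrow> y \<in> - closure S"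
      using open_contains_agree[of "- closure S" x] by auto
    then show False using * closure_subset by blast
  qed
qed

lemma closed_seqI:
  fixes x :: "int \<Rightarrow> 'a::discrete_topology"
  assumes "closed X" "\<And>n::nat. \<exists>y\<in>X. agree {- int n..int n} x y"
  shows "x \<in> X"
  using closure_seq_iff[of x X] closure_closed[OF assms(1)] assms(2) by simp

text \<open>Compactness turns agreement with \<open>x\<close> on longer and longer left windows into
  agreement on the whole half line; agreement with \<open>w\<close> on \<open>J\<close> is a closed
  condition and survives.\<close>

lemma closed_agree_limit:
  fixes X :: "(int \<Rightarrow> 'a::{finite,discrete_topology}) set"
  assumes "closed X" and "\<And>n::nat. \<exists>z\<in>X. agree {- int n..i} x z \<and> agree J w z"
  shows "\<exists>z\<in>X. agree {..i} x z \<and> agree J w z"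
proof -
  let ?K = "\<lambda>n::nat. {z. agree {- int n..i} x z} \<inter> {z. agree J w z}"
  have "X \<inter> (\<Inter>n\<in>UNIV. ?K n) \<noteq> {}"
  proof (rule compact_imp_fip_image[OF compact_closed_seq[OF assms(1)]])
    fix I' :: "nat set" assume "finite I'"
    then obtain N where N: "\<forall>n\<in>I'. n \<le> N" using finite_nat_set_iff_bounded_le by blast
    from assms(2)[of N] obtain z where z: "z \<in> X" "agree {- int N..i} x z" "agree J w z" by blast
    have "z \<in> ?K n" if "n \<in> I'" for n
      using z N that by (auto intro!: agree_mono[OF z(2)])
    then show "X \<inter> (\<Inter>n\<in>I'. ?K n) \<noteq> {}" using z(1) by blast
  qed (intro closed_Int closed_agree)
  then obtain z where z: "z \<in> X" "\<And>n. agree {- int n..i} x z" "agree J w z" by blast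
  have "agree {..i} x z"
    unfolding agree_def
  proof
    fix j assume "j \<in> {..i}"
    then have "j \<in> {- int (nat \<bar>j\<bar>)..i}" by auto
    then show "x j = z j" using z(2)[of "nat \<bar>j\<bar>"] by (auto simp: agree_def)
  qed
  then show ?thesis using z by blast
qed

lemma continuous_on_shiftby: "continuous_on S (shiftby k :: _ \<Rightarrow> int \<Rightarrow> 'a::topological_space)"
  unfolding shiftby_def
  by (intro continuous_on_coordinatewise_then_product continuous_on_eval)

lemma continuous_on_restrict_seq:
  "continuous_on S (\<lambda>x::int \<Rightarrow> 'a::topological_space. restrict x J)"
proof (intro continuous_on_coordinatewise_then_product)
  fix j show "continuous_on S (\<lambda>x::int \<Rightarrow> 'a. restrict x J j)"
    by (cases "j \<in> J") (auto simp: continuous_on_eval)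
qed

lemma continuous_on_cat:
  "continuous_on S (\<lambda>x::int \<Rightarrow> 'a::topological_space. cat i x a)"
proof (intro continuous_on_coordinatewise_then_product)
  fix j show "continuous_on S (\<lambda>x::int \<Rightarrow> 'a. cat i x a j)"
    unfolding cat_def by (cases "j \<le> i") (auto simp: continuous_on_eval)
qed

section \<open>Cylinders as a generator of the Borel sets\<close>

lemma finite_cylinders: "finite {{y :: int \<Rightarrow> 'a::finite. agree {- int n..int n} x y} | x. True}"
proof -
  have "{{y :: int \<Rightarrow> 'a::finite. agree {- int n..int n} x y} | x. True}
     \<subseteq> (\<lambda>w. {y. w = map y [- int n..int n]}) ` {w. set w \<subseteq> UNIV \<and> length w = length [- int n..int n]}"
  proof safe
    fix x :: "int \<Rightarrow> 'a"
    show "{y. agree {- int n..int n} x y} \<in> (\<lambda>w. {y. w = map y [- int n..int n]}) ` {w. set w \<subseteq> UNIV \<and> length w = length [- int n..int n]}"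
      by (rule image_eqI[of _ _ "map x [- int n..int n]"]) (auto simp: map_eq_iff_agree simp del: map_eq_conv)
  qed
  then show ?thesis
    by (rule finite_subset) (intro finite_imageI finite_lists_length_eq finite)
qed

text \<open>The lower bound \<open>k\<close> is for fibers: once the window contains
  \<open>i\<close>, a cylinder meets a fiber over (-\<infinity>,i] in a fiber cylinder or not at
  all. The empty set makes the family stable under intersection.\<close>

definition cylinders :: "nat \<Rightarrow> (int \<Rightarrow> 'a) set set" where
  "cylinders k = insert {} {{y. agree {- int n..int n} x y} | n x. k \<le> n}"

lemma cylinders_Int_stable: "Int_stable (cylinders k)"
proof (rule Int_stableI)
  fix A B :: "(int \<Rightarrow> 'a) set" assume "A \<in> cylinders k" "B \<in> cylinders k"
  moreover have "{y. agree {- int n..int n} x y} \<inter> {y. agree {- int m..int m} z y} \<in> cylinders k"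
    if "k \<le> n" "k \<le> m" for n m and x z :: "int \<Rightarrow> 'a"
  proof (cases "{y. agree {- int n..int n} x y} \<inter> {y. agree {- int m..int m} z y} = {}")
    case False
    then obtain y where y: "agree {- int n..int n} x y" "agree {- int m..int m} z y" by blast
    have "{y. agree {- int n..int n} x y} \<inter> {y. agree {- int m..int m} z y}
      = {v. agree {- int (max n m)..int (max n m)} y v}"
      using y by (cases "n \<le> m") (auto simp: agree_def max_def)
    then show ?thesis using that by (auto simp: cylinders_def)
  qed (auto simp: cylinders_def)
  ultimately show "A \<inter> B \<in> cylinders k"
    unfolding cylinders_def[of k] by (smt (verit) Int_empty_left Int_empty_right insert_iff mem_Collect_eq)
qed

lemma borel_eq_cylinders:
  "sets (borel :: (int \<Rightarrow> 'a::{finite,discrete_topology}) measure) = sigma_sets UNIV (cylinders k)"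
proof -
  have *: "{U :: (int \<Rightarrow> 'a) set. open U} \<subseteq> sigma_sets UNIV (cylinders k)"
  proof safe
    fix U :: "(int \<Rightarrow> 'a) set" assume U: "open U"
    define C where "C n = {A \<in> {{y :: int \<Rightarrow> 'a. agree {- int n..int n} x y} | x. True}. A \<subseteq> U}" for n :: nat
    have fin: "finite (C n)" for n
      unfolding C_def by (rule finite_subset[OF _ finite_cylinders[of n]]) blast
    have "U = \<Union>(\<Union>n\<in>{k..}. C n)"
    proof safe
      fix x assume "x \<in> U"
      from open_contains_agree[OF U this] obtain n :: nat where
        n: "\<And>y. agree {- int n..int n} x y \<Longrightarrow> y \<in> U" by blast
      have "{y. agree {- int (max k n)..int (max k n)} x y} \<in> C (max k n)"
        unfolding C_def by (auto intro!: n elim!: agree_mono)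
      moreover have "x \<in> {y. agree {- int (max k n)..int (max k n)} x y}" by simp
      ultimately show "x \<in> \<Union>(\<Union>n\<in>{k..}. C n)"
        by (meson UN_I UnionI atLeast_iff max.cobounded1)
    qed (auto simp: C_def)
    moreover have "\<Union>(\<Union>n\<in>{k..}. C n) \<in> sigma_sets UNIV (cylinders k)"
    proof (rule sigma_sets_UNION)
      show "countable (\<Union>n\<in>{k..}. C n)"
        by (rule countable_UN) (auto intro: countable_finite fin)
      fix A assume "A \<in> (\<Union>n\<in>{k..}. C n)"
      then show "A \<in> sigma_sets UNIV (cylinders k)"
        by (auto simp: C_def cylinders_def)
    qed
    ultimately show "U \<in> sigma_sets UNIV (cylinders k)" by simp
  qed
  have "cylinders k \<subseteq> {U :: (int \<Rightarrow> 'a) set. open U}"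
    by (auto simp: cylinders_def open_agree)
  then have "sigma_sets UNIV (cylinders k) \<subseteq> sigma_sets UNIV {U :: (int \<Rightarrow> 'a) set. open U}"
    by (rule sigma_sets_mono')
  moreover have "sigma_sets UNIV {U :: (int \<Rightarrow> 'a) set. open U} \<subseteq> sigma_sets UNIV (cylinders k)"
    using * by (rule sigma_sets_mono)
  ultimately show ?thesis
    by (auto simp: borel_def)
qed

lemma measure_eq_if_cylinders:
  fixes M N :: "(int \<Rightarrow> 'a::{finite,discrete_topology}) measure"
  assumes "sets M = sets borel" "sets N = sets borel" "finite_measure M"
    and eq: "\<And>n x. k \<le> n \<Longrightarrow> emeasure M {y. agree {- int n..int n} x y} = emeasure N {y. agree {- int n..int n} x y}"
  shows "M = N"
proof -
  interpret finite_measure M by fact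
  \<comment> \<open>Finitely many cylinders of window \<open>[-k,k]\<close> cover the space, each of
    finite measure; the uniqueness theorem asks for such a cover.\<close>
  define C where "C = {{y :: int \<Rightarrow> 'a. agree {- int k..int k} x y} | x. True}"
  have C: "countable C" "C \<subseteq> cylinders k"
    using finite_cylinders[of k, where 'a='a] by (auto simp: C_def cylinders_def countable_finite)
  show ?thesis
  proof (rule measure_eqI_generator_eq_countable[where E = "cylinders k" and \<Omega> = UNIV and A = C])
    show "\<Union>C = UNIV" unfolding C_def using agree_refl by blast
    show "\<And>a. a \<in> C \<Longrightarrow> emeasure M a \<noteq> \<infinity>" by simp
  qed (use assms C cylinders_Int_stable[of k] borel_eq_cylinders[of k, where 'a='a] in \<open>auto simp: cylinders_def\<close>)
qed

section \<open>Blocks and pasts\<close>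

lemma agree_restrictD:
  assumes "agree J (restrict x K) (restrict y K)" "I \<subseteq> J" "I \<subseteq> K" shows "agree I x y"
  unfolding agree_def
proof
  fix j assume "j \<in> I"
  then have "j \<in> J" "j \<in> K" using assms by blast+
  then show "x j = y j" using assms(1)[unfolded agree_def, rule_format, of j] by simp
qed

lemma shiftby_0 [simp]: "shiftby 0 x = x"
  by (simp add: shiftby_def)

lemma shiftby_shiftby [simp]: "shiftby a (shiftby b x) = shiftby (a + b) x"
  by (simp add: shiftby_def fun_eq_iff algebra_simps)

lemma shiftby_apply: "shiftby k x j = x (j + k)"
  by (simp add: shiftby_def)

lemma agree_shiftby: "agree J (shiftby k x) (shiftby k y) \<longleftrightarrow> agree ((\<lambda>j. j + k) ` J) x y"
  by (auto simp: agree_def shiftby_def)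

lemma agree_shiftby_atMost: "agree {..i} (shiftby k x) (shiftby k y) \<longleftrightarrow> agree {..i + k} x y"
  unfolding agree_def
proof safe
  fix j assume *: "\<forall>j\<in>{..i}. shiftby k x j = shiftby k y j" and "j \<le> i + k"
  then show "x j = y j" using bspec[OF *, of "j - k"] by (simp add: shiftby_def)
qed (simp add: shiftby_def)

lemma subshift_shiftby:
  assumes "subshift X" shows "shiftby k x \<in> X \<longleftrightarrow> x \<in> X"
proof -
  have up: "shiftby (int n) x \<in> X" if "x \<in> X" for x n
    using that
  proof (induction n)
    case (Suc n)
    then have "shift (shiftby (int n) x) \<in> X" using assms by (auto simp: subshift_def)
    then show ?case by (simp add: shift_def)
  qed simp
  have down: "shiftby (- int n) x \<in> X" if "x \<in> X" for x n
    using that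
  proof (induction n)
    case (Suc n)
    then obtain y where y: "y \<in> X" "shift y = shiftby (- int n) x"
      using assms unfolding subshift_def by (metis imageE)
    have "shiftby (- 1) (shift y) = shiftby (- 1) (shiftby (- int n) x)" using y by simp
    then have "y = shiftby (- int (Suc n)) x" by (simp add: shift_def algebra_simps)
    then show ?case using y by simp
  qed simp
  have all: "shiftby k x \<in> X" if "x \<in> X" for k x
    using up[OF that, of "nat k"] down[OF that, of "nat (- k)"] by (cases "k \<ge> 0") auto
  show ?thesis using all[of x k] all[of "shiftby k x" "- k"] by auto
qed

text \<open>Moving the block over (-\<infinity>,i] to end at 0 replaces the translates
  \<open>dom_at D i\<close> and \<open>g_at g i\<close> by \<open>D\<close> and \<open>g\<close>
  themselves.\<close>

definition past :: "int \<Rightarrow> (int \<Rightarrow> 'a) \<Rightarrow> (int \<Rightarrow> 'a)" where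
  "past i x = restrict (shiftby i x) {..0}"

lemma past_eq_iff: "past i x = past i y \<longleftrightarrow> agree {..i} x y"
  by (simp add: past_def restrict_eq_iff_agree agree_shiftby_atMost)

lemma past_shiftby [simp]: "past i (shiftby k x) = past (i + k) x"
  by (simp add: past_def)

lemma past_restrict: "past i x = shiftby i (restrict x {..i})"
  by (auto simp: past_def shiftby_def fun_eq_iff)

lemma past_0: "past 0 x = restrict x {..0}"
  by (simp add: past_def)

lemma dom_at_iff: "z \<in> dom_at D i \<longleftrightarrow> shiftby i z \<in> D"
proof
  assume "shiftby i z \<in> D"
  then have "shiftby (- i) (shiftby i z) \<in> dom_at D i" unfolding dom_at_def by (rule imageI)
  then show "z \<in> dom_at D i" by simp
qed (auto simp: dom_at_def)

lemma restrict_dom_at_iff: "restrict x {..i} \<in> dom_at D i \<longleftrightarrow> past i x \<in> D"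
  by (simp add: dom_at_iff past_restrict)

lemma cat_agree: "agree {..i} x y \<Longrightarrow> cat i x b = cat i y b"
  by (auto simp: agree_def cat_def)

lemma cat_restrict [simp]: "cat i (restrict x {..i}) b = cat i x b"
  by (rule cat_agree) simp

lemma agree_cat [simp]: "k \<le> i \<Longrightarrow> agree {..k} (cat i x b) y \<longleftrightarrow> agree {..k} x y"
   "k \<le> i \<Longrightarrow> agree {..k} y (cat i x b) \<longleftrightarrow> agree {..k} y x"
  by (auto simp: agree_def cat_def)

lemma restrict_cat: "restrict (cat i x b) {..i + int (length b)} = cat i x b"
  by (auto simp: cat_def restrict_def)

lemma cat_append: "cat i x (a @ b) = cat (i + int (length a)) (cat i x a) b"
proof
  fix j
  show "cat i x (a @ b) j = cat (i + int (length a)) (cat i x a) b j"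
    by (auto simp: cat_def nth_append nat_diff_distrib algebra_simps intro!: arg_cong[of _ _ "nth b"])
qed

lemma cat_nth: "k < length b \<Longrightarrow> cat i x b (i + 1 + int k) = b ! k"
  by (simp add: cat_def)

lemma map_cat: "map (cat i x b) [i + 1..i + int (length b)] = b"
  by (rule nth_equalityI) (auto simp: cat_nth)

lemma agree_cat_iff:
  "agree {..i + int (length b)} (cat i x b) y \<longleftrightarrow> agree {..i} x y \<and> map y [i + 1..i + int (length b)] = b"
  (is "?L \<longleftrightarrow> ?R")
proof
  assume L: ?L
  then have "map (cat i x b) [i + 1..i + int (length b)] = map y [i + 1..i + int (length b)]"
    by (auto simp: agree_def)
  moreover have "agree {..i} (cat i x b) y" using L by (rule agree_mono) auto
  ultimately show ?R by (auto simp: map_cat)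
next
  assume R: ?R
  show ?L
    unfolding agree_def
  proof
    fix j assume j: "j \<in> {..i + int (length b)}"
    show "cat i x b j = y j"
    proof (cases "j \<le> i")
      case False
      have "map y [i + 1..i + int (length b)] ! nat (j - i - 1) = b ! nat (j - i - 1)" using R by simp
      then show ?thesis using False j by (auto simp: cat_def)
    qed (use R in \<open>auto simp: cat_def agree_def\<close>)
  qed
qed

lemma cat_eq_restrict_iff:
  "cat i x b = restrict y {..i + int (length b)} \<longleftrightarrow> agree {..i} x y \<and> map y [i + 1..i + int (length b)] = b"
  using restrict_eq_iff_agree[of "cat i x b" "{..i + int (length b)}" y] agree_cat_iff[of i b x y]
  by (simp add: restrict_cat)

lemma followers_iff:
  "b \<in> followers X i n x \<longleftrightarrow> length b = n \<and> (\<exists>y\<in>X. agree {..i} x y \<and> map y [i + 1..i + int n] = b)"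
  by (auto simp: followers_def proj_def image_iff cat_eq_restrict_iff)

lemma fiber_iff: "y \<in> fiber X i x \<longleftrightarrow> y \<in> X \<and> agree {..i} x y"
  by (auto simp: fiber_def restrict_eq_iff_agree agree_sym)

lemma fiber_restrict [simp]: "fiber X i (restrict x {..i}) = fiber X i x"
  by (auto simp: fiber_iff)

lemma fiber_cyl_iff:
  "y \<in> fiber_cyl X i x a \<longleftrightarrow> y \<in> X \<and> agree {..i} x y \<and> map y [i + 1..i + int (length a)] = a"
  by (auto simp: fiber_cyl_def fiber_iff)

lemma fiber_cyl_restrict [simp]: "fiber_cyl X i (restrict x {..i}) a = fiber_cyl X i x a"
  by (auto simp: fiber_cyl_iff)

lemma followers_restrict [simp]: "followers X i n (restrict x {..i}) = followers X i n x"
  by (auto simp: followers_iff)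

text \<open>Since \<open>g\<close> is junk off \<open>D\<close>, it is extended by zero.\<close>
definition g0 :: "(int \<Rightarrow> 'a) set \<Rightarrow> ((int \<Rightarrow> 'a) \<Rightarrow> 'a \<Rightarrow> real) \<Rightarrow> int \<Rightarrow> (int \<Rightarrow> 'a) \<Rightarrow> 'a \<Rightarrow> real" where
  "g0 D g i x \<alpha> = (if past i x \<in> D then g (past i x) \<alpha> else 0)"

lemma g0_agree: "agree {..i} x y \<Longrightarrow> g0 D g i x \<alpha> = g0 D g i y \<alpha>"
  by (simp add: g0_def flip: past_eq_iff)

text \<open>Every follower word is read off a point of \<open>X\<close> with the same past, so the
  condition on words becomes one on points, free of \<open>cat\<close>.\<close>

lemma E_set_iff:
  "x \<in> E_set X D g \<longleftrightarrow> x \<in> X \<and> (\<forall>i. past i x \<in> D \<and> g (past i x) (x (i + 1)) > 0 \<and>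
     (\<forall>z\<in>X. agree {..i} x z \<longrightarrow> (\<forall>k. past (i + int k) z \<in> D)))"
proof -
  have "(\<forall>k. \<forall>a\<in>followers X i k x. cat i x a \<in> dom_at D (i + int k)) \<longleftrightarrow>
     (\<forall>z\<in>X. agree {..i} x z \<longrightarrow> (\<forall>k. past (i + int k) z \<in> D))" for i
  proof safe
    fix z k assume *: "\<forall>k. \<forall>a\<in>followers X i k x. cat i x a \<in> dom_at D (i + int k)"
      and z: "z \<in> X" "agree {..i} x z"
    let ?a = "map z [i + 1..i + int k]"
    have "?a \<in> followers X i k x" using z by (auto simp: followers_iff)
    with * have "cat i x ?a \<in> dom_at D (i + int k)" by blast
    moreover have "cat i x ?a = restrict z {..i + int (length ?a)}"
      unfolding cat_eq_restrict_iff using z by simp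
    ultimately show "past (i + int k) z \<in> D" by (simp add: restrict_dom_at_iff)
  next
    fix k a assume *: "\<forall>z\<in>X. agree {..i} x z \<longrightarrow> (\<forall>k. past (i + int k) z \<in> D)"
      and a: "a \<in> followers X i k x"
    then obtain z where z: "z \<in> X" "agree {..i} x z" "map z [i + 1..i + int k] = a" "length a = k"
      by (auto simp: followers_iff)
    then have "cat i x a = restrict z {..i + int (length a)}"
      unfolding cat_eq_restrict_iff by simp
    then show "cat i x a \<in> dom_at D (i + int k)" using z * by (simp add: restrict_dom_at_iff)
  qed
  then show ?thesis
    unfolding E_set_def by (simp add: restrict_dom_at_iff g_at_def flip: past_restrict)
qed

section \<open>First consequences of the axioms of a residually defined g-function\<close>

locale g_system =
  fixes X :: "(int \<Rightarrow> 'a::{finite,discrete_topology}) set"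
    and D :: "(int \<Rightarrow> 'a) set" and g :: "(int \<Rightarrow> 'a) \<Rightarrow> 'a \<Rightarrow> real"
  assumes subshift: "subshift X" and property_D: "property_D X"
    and residual_g: "residual_g_function X D g"
begin

lemma closed_X: "closed X"
  using subshift by (simp add: subshift_def)

lemma shiftby_X [simp]: "shiftby k x \<in> X \<longleftrightarrow> x \<in> X"
  by (rule subshift_shiftby[OF subshift])

lemma D_subset: "D \<subseteq> proj X {..0}"
  using residual_g by (auto simp: residual_g_function_def residual_in_def)

lemma D_past:
  assumes "d \<in> D" obtains x where "x \<in> X" "past 0 x = d"
  using assms D_subset by (auto simp: proj_def past_0)

lemma g_range: "d \<in> D \<Longrightarrow> 0 \<le> g d \<alpha>" "d \<in> D \<Longrightarrow> g d \<alpha> \<le> 1"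
  using residual_g by (auto simp: residual_g_function_def)

lemma g_sum: assumes "d \<in> D" shows "(\<Sum>\<alpha>\<in>UNIV. g d \<alpha>) = 1"
proof -
  have "(\<Sum>\<alpha>\<in>UNIV. g d \<alpha>) = (\<Sum>\<alpha> | [\<alpha>] \<in> followers X 0 1 d. g d \<alpha>)"
    using residual_g assms by (intro sum.mono_neutral_right) (auto simp: residual_g_function_def)
  then show ?thesis using residual_g assms by (auto simp: residual_g_function_def)
qed

lemma g_pos_ex:
  assumes "past i x \<in> D" "g (past i x) \<alpha> \<noteq> 0"
  obtains z where "z \<in> X" "agree {..i} x z" "z (i + 1) = \<alpha>"
proof -
  have "[\<alpha>] \<in> followers X 0 1 (past i x)"
    using residual_g assms by (auto simp: residual_g_function_def)
  then obtain y where y: "y \<in> X" "agree {..0} (past i x) y" "y 1 = \<alpha>"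
    by (auto simp: followers_iff)
  from y(2) have "agree {..0} (shiftby i x) y" by (simp add: past_def)
  then have "agree {..0} (shiftby i x) (shiftby i (shiftby (- i) y))" by simp
  then have "agree {..i} x (shiftby (- i) y)" unfolding agree_shiftby_atMost by simp
  then show ?thesis using that[of "shiftby (- i) y"] y by (simp add: shiftby_apply)
qed

lemma g0_range: "0 \<le> g0 D g i x \<alpha>" "g0 D g i x \<alpha> \<le> 1"
  using g_range by (auto simp: g0_def)

lemma g0_pos_ex:
  assumes "g0 D g i x \<alpha> \<noteq> 0"
  obtains z where "z \<in> X" "agree {..i} x z" "z (i + 1) = \<alpha>" "past i x \<in> D"
proof -
  from assms have "past i x \<in> D" "g (past i x) \<alpha> \<noteq> 0" by (auto simp: g0_def split: if_splits)
  then show ?thesis using that g_pos_ex by metis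
qed

lemma g_continuous_on: "continuous_on D (\<lambda>d. g d \<alpha>)"
proof -
  have "continuous_on (D \<times> UNIV) (\<lambda>(x, \<sigma>). g x \<sigma>)"
    using residual_g by (simp add: residual_g_function_def)
  then have "continuous_on D ((\<lambda>(x, \<sigma>). g x \<sigma>) \<circ> (\<lambda>d. (d, \<alpha>)))"
    by (intro continuous_on_compose continuous_intros) (auto elim: continuous_on_subset)
  then show ?thesis by (simp add: o_def)
qed

text \<open>The extension by zero may jump where \<open>D\<close> is left, so the approximating
  pasts have to lie in \<open>D\<close> as well as the limit; convergence is asked only of the
  coordinates up to \<open>i\<close>.\<close>

lemma g0_tendsto:
  assumes "\<And>j. j \<le> i \<Longrightarrow> \<forall>\<^sub>F t in F. z t j = x j" "past i x \<in> D"
    and "\<forall>\<^sub>F t in F. past i (z t) \<in> D"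
  shows "((\<lambda>t. g0 D g i (z t) \<alpha>) \<longlongrightarrow> g0 D g i x \<alpha>) F"
proof -
  have "((\<lambda>t. past i (z t)) \<longlongrightarrow> past i x) F"
    unfolding tendsto_seq_iff
  proof
    fix j
    show "\<forall>\<^sub>F t in F. past i (z t) j = past i x j"
      using assms(1)[of "j + i"] by (cases "j \<le> 0") (auto simp: past_def shiftby_def elim: eventually_mono)
  qed
  then have "((\<lambda>t. g (past i (z t)) \<alpha>) \<longlongrightarrow> g (past i x) \<alpha>) F"
    by (intro continuous_on_tendsto_compose[OF g_continuous_on] assms)
  moreover have "\<forall>\<^sub>F t in F. g (past i (z t)) \<alpha> = g0 D g i (z t) \<alpha>"
    using assms(3) by eventually_elim (simp add: g0_def)
  ultimately show ?thesis
    using assms(2) by (simp add: g0_def tendsto_cong)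
qed

lemma E_D: "x \<in> E_set X D g \<Longrightarrow> past i x \<in> D"
  and E_pos: "x \<in> E_set X D g \<Longrightarrow> g (past i x) (x (i + 1)) > 0"
  and E_X: "x \<in> E_set X D g \<Longrightarrow> x \<in> X"
  and E_future: "x \<in> E_set X D g \<Longrightarrow> z \<in> X \<Longrightarrow> agree {..i} x z \<Longrightarrow> past (i + int k) z \<in> D"
  by (auto simp: E_set_iff)

end

section \<open>Property (D) as freedom to change the far past\<close>

text \<open>With \<open>a\<close> from property (D), the point \<open>y\<close> carries
  \<open>ab\<close> on \<open>[m,i]\<close>. Membership of the letter in
  \<open>\<omega>\<^sub>1\<^sup>+(ab)\<close> says that it may follow any past ending in
  \<open>ab\<close>, so \<open>z\<close> is free to the left of \<open>m\<close>.\<close>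

lemma property_D_step:
  assumes "subshift X" "property_D X" "x \<in> X" "l \<le> i + 1"
  obtains m y where "m \<le> l" "y \<in> X" "agree {l..i} x y"
    "\<And>z. z \<in> X \<Longrightarrow> agree {m..i} y z \<Longrightarrow> \<exists>z'\<in>X. agree {..i} z z' \<and> z' (i + 1) = x (i + 1)"
proof -
  note shiftX = subshift_shiftby[OF assms(1)]
  let ?b = "map x [l..i]" and ?s = "x (i + 1)"
  have len: "int (length ?b) = i + 1 - l" using assms(4) by simp
  have "map x [l - 1 + 1..l - 1 + int (length (?b @ [?s]))] = ?b @ [?s]"
    using assms(4) by (simp add: upto_rec2 add.commute)
  then have "admissible X (?b @ [?s])" unfolding admissible_def using assms(3) by blast
  with assms(2) obtain a where a: "admissible X (a @ ?b)" "[?s] \<in> omega_plus X 1 (a @ ?b)"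
    unfolding property_D_def word_predecessors_def by blast
  define w where "w = a @ ?b"
  define m where "m = i - int (length w) + 1"
  have m: "m \<le> l" using len by (simp add: m_def w_def)
  from a(1) obtain v k where v: "v \<in> X" "map v [k + 1..k + int (length w)] = w"
    unfolding admissible_def w_def by blast
  \<comment> \<open>The shift moves the occurrence of \<open>w\<close> in \<open>v\<close> to the
    coordinates \<open>m\<close> to \<open>i\<close>.\<close>
  define y where "y = shiftby (k + int (length w) - i) v"
  have y: "y \<in> X" using v shiftX by (simp add: y_def)
  have yw: "y (m + int n) = w ! n" if "n < length w" for n
  proof -
    have "map v [k + 1..k + int (length w)] ! n = w ! n" using v(2) by simp
    then show ?thesis using that by (simp add: y_def shiftby_apply m_def algebra_simps)
  qed
  have "agree {l..i} x y"
    unfolding agree_def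
  proof
    fix j assume j: "j \<in> {l..i}"
    define n where "n = nat (j - m)"
    have n: "n < length w" "j = m + int n" using j m by (auto simp: n_def m_def)
    have "w ! n = ?b ! nat (j - l)"
    proof -
      have "int (length w) = int (length a) + (i + 1 - l)" using len by (simp add: w_def)
      then have "n = length a + nat (j - l)" using j n(2) unfolding m_def by auto
      then show ?thesis using j by (simp add: w_def nth_append)
    qed
    also have "\<dots> = x j" using j by simp
    finally show "x j = y j" using yw[OF n(1)] n(2) by simp
  qed
  moreover have "\<exists>z'\<in>X. agree {..i} z z' \<and> z' (i + 1) = ?s" if z: "z \<in> X" "agree {m..i} y z" for z
  proof -
    \<comment> \<open>The part of \<open>z\<close> to the left of \<open>m\<close>, re-indexed to
      end at 0 like the elements of \<open>pasts\<close>.\<close>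
    define p where "p = restrict (shiftby (m - 1) z) {..0}"
    have zw: "z (m + int n) = w ! n" if "n < length w" for n
      using z(2) yw[OF that] that by (auto simp: agree_def m_def)
    have zeq: "shiftby (int (length w)) (cat 0 p w) = restrict (shiftby i z) {..0}"
    proof
      fix j :: int
      have "w ! nat (j + int (length w) - 1) = z (j + i)" if "j \<le> 0" "j + int (length w) > 0"
        using zw[of "nat (j + int (length w) - 1)"] that by (simp add: m_def algebra_simps)
      then show "shiftby (int (length w)) (cat 0 p w) j = restrict (shiftby i z) {..0} j"
        by (auto simp: cat_def p_def shiftby_def m_def algebra_simps)
    qed
    then have "p \<in> pasts X w"
      using z(1) shiftX by (auto simp: pasts_def proj_def p_def)
    then have "shiftby (int (length (w @ [?s]))) (cat 0 p (w @ [?s])) \<in> proj X {..0}"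
      using a(2) unfolding omega_plus_def w_def[symmetric] by blast
    then obtain q where q: "q \<in> X" "shiftby (int (length w) + 1) (cat 0 p (w @ [?s])) = restrict q {..0}"
      by (auto simp: proj_def algebra_simps)
    have q0: "q 0 = ?s"
      using fun_cong[OF q(2), of 0] by (simp add: shiftby_apply cat_def nth_append)
    have qz: "q (j - (i + 1)) = z j" if "j \<le> i" for j
    proof -
      have "q (j - (i + 1)) = cat 0 p (w @ [?s]) (j - i + int (length w))"
        using fun_cong[OF q(2), of "j - (i + 1)"] that by (simp add: shiftby_apply algebra_simps)
      also have "\<dots> = cat 0 p w (j - i + int (length w))"
        using that by (simp add: cat_append) (simp add: cat_def)
      also have "\<dots> = z j"
        using fun_cong[OF zeq, of "j - i"] that by (simp add: shiftby_apply)
      finally show ?thesis .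
    qed
    \<comment> \<open>In \<open>q\<close> the new letter sits at 0; moving it to
      \<open>i + 1\<close> puts the rest back on \<open>z\<close>.\<close>
    have "shiftby (- (i + 1)) q j = q (j - (i + 1))" for j by (simp add: shiftby_def algebra_simps)
    then show ?thesis
      using q(1) q0 qz shiftX by (intro bexI[of _ "shiftby (- (i + 1)) q"]) (auto simp: agree_def)
  qed
  ultimately show ?thesis using that m y by blast
qed

text \<open>Letters are secured from the last to the first. A step for the final letter lengthens
  the window to the left, to \<open>m\<close>; the induction hypothesis is then applied to the
  resulting \<open>y\<close> instead of \<open>x\<close>, so that the points it produces carry the
  whole window that the final letter needs.\<close>

lemma property_D_extend:
  assumes "subshift X" "property_D X" "x \<in> X" "l \<le> i + 1"
  shows "\<exists>m y. m \<le> l \<and> y \<in> X \<and> agree {l..i} x y \<and>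
    (\<forall>z\<in>X. agree {m..i} y z \<longrightarrow> (\<exists>z'\<in>X. agree {..i} z z' \<and> agree {i + 1..i + int k} x z'))"
  using assms(3,4)
proof (induction k arbitrary: x l)
  case 0
  then show ?case by (intro exI[of _ l] exI[of _ x]) (auto simp: agree_def)
next
  case (Suc k)
  have "l \<le> i + int k + 1" using Suc.prems(2) by simp
  from property_D_step[OF assms(1,2) Suc.prems(1) this]
  obtain m y where m: "m \<le> l" "y \<in> X" "agree {l..i + int k} x y"
    "\<And>z. z \<in> X \<Longrightarrow> agree {m..i + int k} y z \<Longrightarrow> \<exists>z'\<in>X. agree {..i + int k} z z' \<and> z' (i + int k + 1) = x (i + int k + 1)"
    by blast
  from Suc.IH[OF m(2), of m] m(1) Suc.prems(2)
  obtain m' y' where m': "m' \<le> m" "y' \<in> X" "agree {m..i} y y'"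
    "\<And>z. z \<in> X \<Longrightarrow> agree {m'..i} y' z \<Longrightarrow> \<exists>z'\<in>X. agree {..i} z z' \<and> agree {i + 1..i + int k} y z'"
    by auto
  have ext: "\<exists>z'\<in>X. agree {..i} z z' \<and> agree {i + 1..i + int (Suc k)} x z'"
    if z: "z \<in> X" "agree {m'..i} y' z" for z
  proof -
    obtain z' where z': "z' \<in> X" "agree {..i} z z'" "agree {i + 1..i + int k} y z'"
      using m'(4) z by blast
    have "agree {m..i + int k} y z'"
      unfolding agree_def
    proof
      fix j assume j: "j \<in> {m..i + int k}"
      show "y j = z' j"
      proof (cases "j \<le> i")
        case True
        then have "y j = y' j" "y' j = z j" "z j = z' j"
          using j m' z z' by (auto simp: agree_def)
        then show ?thesis by simp
      qed (use j z' in \<open>auto simp: agree_def\<close>)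
    qed
    from m(4)[OF z'(1) this] obtain z'' where z'': "z'' \<in> X" "agree {..i + int k} z' z''"
      "z'' (i + int k + 1) = x (i + int k + 1)" by blast
    have "agree {..i} z z''"
      using z'(2) z''(2) by (auto simp: agree_def)
    moreover have "agree {i + 1..i + int (Suc k)} x z''"
      unfolding agree_def
    proof
      fix j assume j: "j \<in> {i + 1..i + int (Suc k)}"
      show "x j = z'' j"
      proof (cases "j = i + int k + 1")
        case False
        then have "x j = y j" "y j = z' j" "z' j = z'' j"
          using j m(3) z'(3) z''(2) Suc.prems(2) by (auto simp: agree_def)
        then show ?thesis by simp
      qed (use z'' in simp)
    qed
    ultimately show ?thesis using z''(1) by blast
  qed
  have "agree {l..i} x y'"
    using m(3) m'(3) m(1) by (auto simp: agree_def)
  then show ?case using m m' ext by (intro exI[of _ m'] exI[of _ y']) auto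
qed

section \<open>Density of \<open>E(g)\<close> and maximality of the domain\<close>

context g_system
begin

text \<open>The past of \<open>x\<close> is first replaced by that of the \<open>y\<close> from
  \<open>property_D_extend\<close>. A point with \<open>P\<close> that is close to \<open>y\<close>
  up to \<open>i\<close> can still be continued by the letters of \<open>x\<close>, and this change
  to the right of \<open>i\<close> does not affect \<open>P\<close>.\<close>

lemma dense_from_past:
  assumes inv: "\<And>x y. agree {..i} x y \<Longrightarrow> P x \<Longrightarrow> P y"
    and dense: "\<And>z n. z \<in> X \<Longrightarrow> \<exists>z'\<in>X. agree {- int n..i} z z' \<and> P z'"
    and x: "x \<in> X"
  shows "\<exists>y\<in>X. agree {- int n..int n} x y \<and> P y"
proof -
  \<comment> \<open>Large enough for \<open>[-N,N]\<close> to contain both \<open>[-n,n]\<close> and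
    \<open>i\<close>.\<close>
  define N where "N = n + nat \<bar>i\<bar>"
  have N: "- int N \<le> i + 1" "i + int (nat (int N - i)) = int N" "n \<le> N" by (auto simp: N_def)
  from property_D_extend[OF subshift property_D x N(1), of "nat (int N - i)"] N(2)
  obtain m y where y: "m \<le> - int N" "y \<in> X" "agree {- int N..i} x y"
    "\<And>z. z \<in> X \<Longrightarrow> agree {m..i} y z \<Longrightarrow> \<exists>z'\<in>X. agree {..i} z z' \<and> agree {i + 1..int N} x z'"
    by auto
  obtain z where z: "z \<in> X" "agree {- int (nat (- m))..i} y z" "P z"
    using dense[OF y(2)] by blast
  then have yz: "agree {m..i} y z" using y(1) by simp
  obtain z' where z': "z' \<in> X" "agree {..i} z z'" "agree {i + 1..int N} x z'"
    using y(4)[OF z(1) yz] by blast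
  have "agree {- int n..int n} x z'"
    unfolding agree_def
  proof
    fix j assume j: "j \<in> {- int n..int n}"
    show "x j = z' j"
    proof (cases "j \<le> i")
      case True
      then have "x j = y j" "y j = z j" "z j = z' j"
        using j y(1,3) yz z'(2) N(3) by (auto simp: agree_def)
      then show ?thesis by simp
    qed (use j z'(3) N(3) in \<open>auto simp: agree_def\<close>)
  qed
  then show ?thesis using z' inv[OF z'(2) z(3)] by blast
qed

section \<open>Baire's theorem in X\<close>

definition open_dense :: "(int \<Rightarrow> 'a) set \<Rightarrow> bool" where
  "open_dense B \<longleftrightarrow> B \<subseteq> X \<and>
     (\<forall>x\<in>B. \<exists>n::nat. \<forall>y\<in>X. agree {- int n..int n} x y \<longrightarrow> y \<in> B) \<and>
     (\<forall>x\<in>X. \<forall>n::nat. \<exists>y\<in>B. agree {- int n..int n} x y)"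

lemma open_dense_shift:
  assumes "open_dense B" shows "open_dense {x. shiftby i x \<in> B}"
proof -
  have ag: "agree {- int n..int n} (shiftby i x) (shiftby i y)"
    if "agree {- int (n + nat \<bar>i\<bar>)..int (n + nat \<bar>i\<bar>)} x y" for n x y i
    unfolding agree_def shiftby_apply
  proof
    fix j assume "j \<in> {- int n..int n}"
    then have "j + i \<in> {- int (n + nat \<bar>i\<bar>)..int (n + nat \<bar>i\<bar>)}" by auto
    then show "x (j + i) = y (j + i)" using that by (simp add: agree_def)
  qed
  show ?thesis
    unfolding open_dense_def
  proof (intro conjI ballI allI subsetI)
    fix x assume "x \<in> {x. shiftby i x \<in> B}"
    then have x: "shiftby i x \<in> B" by simp
    then show "x \<in> X" using assms by (auto simp: open_dense_def)
    from x obtain n :: nat where n: "\<forall>y\<in>X. agree {- int n..int n} (shiftby i x) y \<longrightarrow> y \<in> B"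
      using assms unfolding open_dense_def by blast
    show "\<exists>n::nat. \<forall>y\<in>X. agree {- int n..int n} x y \<longrightarrow> y \<in> {x. shiftby i x \<in> B}"
    proof (intro exI ballI impI)
      fix y assume "y \<in> X" and y: "agree {- int (n + nat \<bar>i\<bar>)..int (n + nat \<bar>i\<bar>)} x y"
      then have "shiftby i y \<in> X" by simp
      then show "y \<in> {x. shiftby i x \<in> B}" using n ag[OF y] by blast
    qed
  next
    fix x n assume "x \<in> X"
    then have "shiftby i x \<in> X" by simp
    then obtain y where y: "y \<in> B" "agree {- int (n + nat \<bar>- i\<bar>)..int (n + nat \<bar>- i\<bar>)} (shiftby i x) y"
      using assms unfolding open_dense_def by blast
    have "agree {- int n..int n} (shiftby (- i) (shiftby i x)) (shiftby (- i) y)"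
      by (rule ag[OF y(2)])
    then show "\<exists>y\<in>{x. shiftby i x \<in> B}. agree {- int n..int n} x y"
      using y(1) by (intro bexI[of _ "shiftby (- i) y"]) auto
  qed
qed

lemma Baire_X:
  assumes "countable \<S>" "\<And>B. B \<in> \<S> \<Longrightarrow> open_dense B" "x \<in> X"
  shows "\<exists>y\<in>X. (\<forall>B\<in>\<S>. y \<in> B) \<and> agree {- int n..int n} x y"
proof -
  let ?T = "top_of_set X"
  have "compact_space ?T"
    using compact_closed_seq[OF closed_X] by (simp add: compact_space_subtopology)
  moreover have "Hausdorff_space ?T"
  proof (rule Hausdorff_space_subtopology, unfold Hausdorff_space_def, safe)
    fix x y :: "int \<Rightarrow> 'a" assume "x \<noteq> y"
    then obtain j where j: "x j \<noteq> y j" by auto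
    then show "\<exists>U V. openin euclidean U \<and> openin euclidean V \<and> x \<in> U \<and> y \<in> V \<and> disjnt U V"
      using open_eval[of "\<lambda>a. a = x j" j] open_eval[of "\<lambda>a. a = y j" j]
      by (intro exI[of _ "{v. v j = x j}"] exI[of _ "{v. v j = y j}"]) (auto simp: disjnt_iff)
  qed
  ultimately have T: "locally_compact_space ?T \<and> regular_space ?T"
    by (simp add: compact_imp_locally_compact_space compact_Hausdorff_imp_regular_space)
  have "?T closure_of \<Inter>(insert X \<S>) = topspace ?T"
  proof (rule Baire_category)
    fix B assume "B \<in> insert X \<S>"
    have "open_dense X" unfolding open_dense_def using agree_refl by blast
    with \<open>B \<in> insert X \<S>\<close> have B: "open_dense B"
      using assms(2) by auto
    then have "B \<subseteq> X" by (simp add: open_dense_def)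
    have "openin ?T B"
      unfolding openin_subopen[of ?T B]
    proof
      fix x assume "x \<in> B"
      then obtain n :: nat where n: "\<forall>y\<in>X. agree {- int n..int n} x y \<longrightarrow> y \<in> B"
        using B unfolding open_dense_def by blast
      have "openin ?T (X \<inter> {y. agree {- int n..int n} x y})"
        by (intro openin_open_Int open_agree) simp
      then show "\<exists>T. openin ?T T \<and> x \<in> T \<and> T \<subseteq> B"
        using n \<open>x \<in> B\<close> \<open>B \<subseteq> X\<close> by (intro exI[of _ "X \<inter> {y. agree {- int n..int n} x y}"]) auto
    qed
    moreover have "?T closure_of B = X"
      unfolding closure_of_subtopology euclidean_closure_of
      using B \<open>B \<subseteq> X\<close> by (auto simp: closure_seq_iff open_dense_def Int_absorb1)
    ultimately show "openin ?T B \<and> ?T closure_of B = topspace ?T" by simp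
  qed (use T assms in auto)
  then have "x \<in> closure (X \<inter> \<Inter>(insert X \<S>))"
    using assms(3) unfolding closure_of_subtopology euclidean_closure_of by auto
  then obtain y where "y \<in> X \<inter> \<Inter>(insert X \<S>)" "agree {- int n..int n} x y"
    unfolding closure_seq_iff by blast
  then show ?thesis by blast
qed

text \<open>The dense G_delta inside \<open>D\<close> is replaced by open sets of the full sequence
  space. Conditions on one-sided pasts thus become conditions on points of \<open>X\<close>, where
  Baire's theorem is applied.\<close>

lemma residual_sets:
  obtains \<G> where "countable \<G>" "\<And>U. U \<in> \<G> \<Longrightarrow> open U"
    "\<And>U x n. U \<in> \<G> \<Longrightarrow> x \<in> X \<Longrightarrow> \<exists>y\<in>X. agree {- int n..0} x y \<and> past 0 y \<in> U"
    "\<And>x. x \<in> X \<Longrightarrow> (\<And>U. U \<in> \<G> \<Longrightarrow> past 0 x \<in> U) \<Longrightarrow> past 0 x \<in> D"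
proof -
  let ?P = "proj X {..0}" and ?T = "top_of_set (proj X {..0})"
  from residual_g obtain G where G: "gdelta_in ?T G" "?T closure_of G = ?P" "G \<subseteq> D"
    unfolding residual_g_function_def residual_in_def by auto
  from G(1) obtain \<U> where \<U>: "countable \<U>" "\<And>U. U \<in> \<U> \<Longrightarrow> openin ?T U" "\<Inter>\<U> = G"
    unfolding gdelta_in_alt intersection_of_def by auto
  have "G \<subseteq> ?P" using gdelta_in_subset[OF G(1)] by simp
  have "\<forall>U\<in>\<U>. \<exists>V. open V \<and> U = ?P \<inter> V"
    using \<U>(2) by (auto simp: openin_open)
  then obtain V where V: "\<And>U. U \<in> \<U> \<Longrightarrow> open (V U) \<and> U = ?P \<inter> V U" by metis
  show ?thesis
  proof (rule that[of "V ` \<U>"])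
    fix U x n assume U: "U \<in> V ` \<U>" and x: "x \<in> X"
    have "past 0 x \<in> ?P" using x by (auto simp: past_0 proj_def)
    then have "past 0 x \<in> closure G"
      using G(2) \<open>G \<subseteq> ?P\<close> unfolding closure_of_subtopology euclidean_closure_of
      by (auto simp: Int_absorb1)
    then obtain d where d: "d \<in> G" "agree {- int n..int n} (past 0 x) d"
      by (auto simp: closure_seq_iff)
    then obtain y where y: "y \<in> X" "d = past 0 y"
      using \<open>G \<subseteq> ?P\<close> by (auto simp: proj_def past_0)
    have "agree {- int n..0} x y"
      using d(2) y(2) unfolding past_0 by (intro agree_restrictD[of "{- int n..int n}" x "{..0}" y]) auto
    moreover have "past 0 y \<in> U"
      using U d(1) y(2) \<U>(3) V by auto
    ultimately show "\<exists>y\<in>X. agree {- int n..0} x y \<and> past 0 y \<in> U" using y by blast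
  next
    fix x assume "x \<in> X" "\<And>U. U \<in> V ` \<U> \<Longrightarrow> past 0 x \<in> U"
    then have "past 0 x \<in> \<Inter>\<U>"
      using V by (fastforce simp: past_0 proj_def)
    then show "past 0 x \<in> D" using \<U>(3) G(3) by blast
  qed (use \<U> V in auto)
qed

lemma positive_dense:
  assumes "x \<in> X"
  shows "\<exists>y\<in>X. agree {- int n..1} x y \<and> past 0 y \<in> D \<and> g (past 0 y) (y 1) > 0"
proof -
  have "restrict x {..1} \<in> closure {cat 0 x [\<alpha>] | x \<alpha>. x \<in> D \<and> [\<alpha>] \<in> followers X 0 1 x \<and> g x \<alpha> > 0}"
    using residual_g assms by (auto simp: residual_g_function_def proj_def)
  \<comment> \<open>With \<open>Suc n\<close> the window contains coordinate 1 even for n =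
    0.\<close>
  then obtain d \<alpha> where d: "d \<in> D" "[\<alpha>] \<in> followers X 0 1 d" "g d \<alpha> > 0"
    "agree {- int (Suc n)..int (Suc n)} (restrict x {..1}) (cat 0 d [\<alpha>])"
    unfolding closure_seq_iff by (smt (verit) mem_Collect_eq)
  from d(2) obtain y where y: "y \<in> X" "agree {..0} d y" "y 1 = \<alpha>" by (auto simp: followers_iff)
  have "cat 0 d [\<alpha>] = restrict y {..1}"
    using cat_eq_restrict_iff[of 0 d "[\<alpha>]" y] y by simp
  with d(4) have "agree {- int n..1} x y" by (intro agree_restrictD[of "{- int (Suc n)..int (Suc n)}" x "{..1}" y]) auto
  moreover have "past 0 y = d"
  proof -
    obtain v where "v \<in> X" "past 0 v = d" using D_past[OF d(1)] by blast
    moreover from this y(2) have "agree {..0} v y" by (auto simp: past_0)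
    then have "past 0 v = past 0 y" by (simp add: past_eq_iff)
    ultimately show ?thesis by simp
  qed
  ultimately show ?thesis using y d by blast
qed

text \<open>\<open>E(g)\<close> asks that every continuation of a past stay in the domain. That
  \<open>a\<close> can follow the past of \<open>x\<close> is a closed condition, in general not an
  open one. Demanding it on a whole neighbourhood makes the set open and keeps it dense: a past
  without such a neighbourhood has pasts arbitrarily near that \<open>a\<close> cannot
  follow.\<close>

lemma open_dense_future:
  assumes U: "open U" and dense: "\<And>x n. x \<in> X \<Longrightarrow> \<exists>y\<in>X. agree {- int n..0} x y \<and> past 0 y \<in> U"
  defines "fol \<equiv> \<lambda>x a. \<exists>z\<in>X. agree {..0} x z \<and> map z [1..int (length a)] = a"
  shows "open_dense {x\<in>X. \<not> fol x a \<or>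
     ((\<exists>n::nat. \<forall>y\<in>X. agree {- int n..0} x y \<longrightarrow> fol y a) \<and> past (int (length a)) (cat 0 x a) \<in> U)}"
    (is "open_dense ?B")
proof -
  let ?k = "int (length a)"
  have fol_inv: "fol x b \<longleftrightarrow> fol y b" if "agree {..0} x y" for x y b
    unfolding fol_def using that agree_trans agree_sym by metis
  have "\<exists>n::nat. \<forall>y\<in>X. agree {- int n..int n} x y \<longrightarrow> y \<in> ?B" if x: "x \<in> ?B" for x
  proof (cases "fol x a")
    case False
    \<comment> \<open>If \<open>a\<close> could follow pasts agreeing with \<open>x\<close> on every
      window, compactness would let it follow the past of \<open>x\<close> itself.\<close>
    have "\<exists>n::nat. \<forall>z\<in>X. \<not> (agree {- int n..0} x z \<and> agree {1..?k} (cat 0 x a) z)"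
    proof (rule ccontr)
      assume "\<not> ?thesis"
      then have "\<And>n. \<exists>z\<in>X. agree {- int n..0} x z \<and> agree {1..?k} (cat 0 x a) z" by blast
      from closed_agree_limit[OF closed_X this]
      obtain z where z: "z \<in> X" "agree {..0} x z" "agree {1..?k} (cat 0 x a) z" by blast
      then have "map z [1..?k] = a"
        using map_cat[of 0 x a] by (metis map_eq_iff_agree add_0)
      then show False using False z unfolding fol_def by blast
    qed
    then obtain n :: nat where n: "\<And>z. z \<in> X \<Longrightarrow> \<not> (agree {- int n..0} x z \<and> agree {1..?k} (cat 0 x a) z)"
      by blast
    have "\<not> fol y a" if "y \<in> X" "agree {- int n..int n} x y" for y
    proof
      assume "fol y a"
      then obtain z where z: "z \<in> X" "agree {..0} y z" "map z [1..?k] = a" unfolding fol_def by blast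
      then have "agree {1..?k} (cat 0 x a) z"
        using map_cat[of 0 x a] by (metis map_eq_iff_agree add_0)
      moreover have "agree {- int n..0} x z"
        using that(2) z(2) by (auto simp: agree_def)
      ultimately show False using n z by blast
    qed
    then show ?thesis by blast
  next
    case True
    with x obtain n :: nat where n: "\<And>y. y \<in> X \<Longrightarrow> agree {- int n..0} x y \<Longrightarrow> fol y a"
      and xU: "past ?k (cat 0 x a) \<in> U" by blast
    have "open ((\<lambda>x. past ?k (cat 0 x a)) -` U)"
      unfolding past_def
      by (intro open_vimage U continuous_on_compose2[OF continuous_on_restrict_seq]
          continuous_on_compose2[OF continuous_on_shiftby] continuous_on_cat) auto
    then obtain m :: nat where m: "\<And>y. agree {- int m..int m} x y \<Longrightarrow> past ?k (cat 0 y a) \<in> U"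
      using open_contains_agree[of _ x] xU by (metis vimage_eq)
    have "y \<in> ?B" if y: "y \<in> X" "agree {- int (m + n)..int (m + n)} x y" for y
    proof -
      have "agree {- int m..int m} x y" by (rule agree_mono[OF y(2)]) auto
      moreover have "fol v a" if "v \<in> X" "agree {- int n..0} y v" for v
        by (rule n[OF that(1)], rule agree_trans[OF agree_mono[OF y(2)] that(2)]) auto
      ultimately show ?thesis using m y(1) by blast
    qed
    then show ?thesis by blast
  qed
  moreover have "\<exists>y\<in>?B. agree {- int n..int n} x y" if x: "x \<in> X" for x n
  proof -
    let ?P = "\<lambda>x. \<not> fol x a \<or>
     ((\<exists>n::nat. \<forall>y\<in>X. agree {- int n..0} x y \<longrightarrow> fol y a) \<and> past ?k (cat 0 x a) \<in> U)"
    have "\<exists>y\<in>X. agree {- int n..int n} x y \<and> ?P y"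
    proof (rule dense_from_past[where i = 0, OF _ _ x])
      fix x y assume xy: "agree {..0} x y" "?P x"
      have "agree {- int n..0} x v \<longleftrightarrow> agree {- int n..0} y v" for v n
        using xy(1) by (auto simp: agree_def)
      then show "?P y" using xy(2) fol_inv[OF xy(1)] cat_agree[OF xy(1)] by simp
    next
      fix z n assume z: "z \<in> X"
      show "\<exists>z'\<in>X. agree {- int n..0} z z' \<and> ?P z'"
      proof (cases "\<forall>y\<in>X. agree {- int n..0} z y \<longrightarrow> fol y a")
        case False
        then show ?thesis by blast
      next
        case True
        then have "fol z a" using z by simp
        then obtain w where w: "w \<in> X" "agree {..0} z w" "map w [1..?k] = a" unfolding fol_def by blast
        \<comment> \<open>\<open>w\<close> is moved so that \<open>a\<close> ends at 0; the window
          then covers the coordinates of \<open>w\<close> from \<open>-n\<close> to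
          \<open>length a\<close>.\<close>
        from dense[of "shiftby ?k w" "n + nat ?k"] w(1)
        obtain v where v: "v \<in> X" "agree {- int (n + nat ?k)..0} (shiftby ?k w) v" "past 0 v \<in> U" by auto
        define v' where "v' = shiftby (- ?k) v"
        have wv: "w j = v' j" if "- int n \<le> j" "j \<le> ?k" for j
        proof -
          have "shiftby ?k w (j - ?k) = v (j - ?k)" using v(2) that by (auto simp: agree_def)
          then show ?thesis by (simp add: v'_def shiftby_apply)
        qed
        have "map v' [1..?k] = map w [1..?k]" by (auto simp: wv)
        with w(3) have "map v' [1..?k] = a" by simp
        then have "agree {..?k} (cat 0 v' a) v'"
          using agree_cat_iff[of 0 a v' v'] by simp
        then have "past ?k (cat 0 v' a) = past ?k v'" by (simp add: past_eq_iff)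
        then have "past ?k (cat 0 v' a) \<in> U" using v(3) by (simp add: v'_def)
        moreover have zv: "agree {- int n..0} z v'"
          using w(2) wv by (auto simp: agree_def)
        moreover have "\<forall>y\<in>X. agree {- int n..0} v' y \<longrightarrow> fol y a"
          using True zv agree_trans by metis
        ultimately show ?thesis using v(1) by (intro bexI[of _ v']) (auto simp: v'_def)
      qed
    qed
    then show ?thesis by blast
  qed
  ultimately show ?thesis unfolding open_dense_def by blast
qed

text \<open>\<open>g\<close> is continuous on \<open>D\<close> only, so positivity at a letter is
  the trace on \<open>D\<close> of an open set \<open>W \<alpha>\<close>. Condition (iii) gives
  density, with \<open>i = 1\<close> in \<open>dense_from_past\<close> because the letter at 1 takes
  part.\<close>

lemma open_dense_positive:
  obtains C where "open_dense C" "\<And>x. x \<in> C \<Longrightarrow> past 0 x \<in> D \<Longrightarrow> g (past 0 x) (x 1) > 0"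
proof -
  have "\<exists>W. open W \<and> W \<inter> D = {d\<in>D. g d \<alpha> > 0}" for \<alpha>
  proof -
    have "openin (top_of_set D) (D \<inter> (\<lambda>d. g d \<alpha>) -` {0<..})"
      by (rule continuous_openin_preimage_gen[OF g_continuous_on]) simp
    then show ?thesis by (auto simp: openin_open)
  qed
  then obtain W where W: "\<And>\<alpha>. open (W \<alpha>)" "\<And>\<alpha>. W \<alpha> \<inter> D = {d\<in>D. g d \<alpha> > 0}" by metis
  define C where "C = {x\<in>X. past 0 x \<in> W (x 1)}"
  have "\<exists>n::nat. \<forall>y\<in>X. agree {- int n..int n} x y \<longrightarrow> y \<in> C" if x: "x \<in> C" for x
  proof -
    have "open ((\<lambda>y. past 0 y) -` W (x 1))"
      unfolding past_def
      by (intro open_vimage W(1) continuous_on_compose2[OF continuous_on_restrict_seq]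
          continuous_on_shiftby) auto
    then obtain m :: nat where m: "\<And>y. agree {- int m..int m} x y \<Longrightarrow> past 0 y \<in> W (x 1)"
      using open_contains_agree[of _ x] x unfolding C_def by (metis (mono_tags, lifting) mem_Collect_eq vimage_eq)
    have "y \<in> C" if "y \<in> X" "agree {- int (Suc m)..int (Suc m)} x y" for y
    proof -
      have "agree {- int m..int m} x y" "x 1 = y 1" using that by (auto simp: agree_def)
      then show ?thesis using m that(1) by (simp add: C_def)
    qed
    then show ?thesis by blast
  qed
  moreover have "\<exists>y\<in>C. agree {- int n..int n} x y" if x: "x \<in> X" for x n
  proof -
    have "\<exists>y\<in>X. agree {- int n..int n} x y \<and> past 0 y \<in> W (y 1)"
    proof (rule dense_from_past[where i = 1, OF _ _ x])
      fix x y :: "int \<Rightarrow> 'a" assume "agree {..1} x y" "past 0 x \<in> W (x 1)"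
      moreover have "past 0 x = past 0 y" "x 1 = y 1"
        using \<open>agree {..1} x y\<close> by (auto simp: past_eq_iff agree_def)
      ultimately show "past 0 y \<in> W (y 1)" by simp
    next
      fix z n assume "z \<in> X"
      from positive_dense[OF this, of n] show "\<exists>z'\<in>X. agree {- int n..1} z z' \<and> past 0 z' \<in> W (z' 1)"
        using W(2) by blast
    qed
    then show ?thesis by (auto simp: C_def)
  qed
  ultimately have "open_dense C" unfolding open_dense_def C_def by blast
  then show ?thesis
  proof (rule that)
    fix x assume "x \<in> C" "past 0 x \<in> D"
    then show "g (past 0 x) (x 1) > 0" using W(2)[of "x 1"] unfolding C_def by blast
  qed
qed

text \<open>Membership in \<open>E(g)\<close> is implied by countably many open dense conditions:
  positivity at each time, and a condition on continuations for each time, word and open set from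
  \<open>residual_sets\<close>.\<close>

lemma E_dense:
  assumes "x \<in> X" shows "\<exists>y\<in>E_set X D g. agree {- int n..int n} x y"
proof -
  obtain \<G> where \<G>: "countable \<G>" "\<And>U. U \<in> \<G> \<Longrightarrow> open U"
    "\<And>U x n. U \<in> \<G> \<Longrightarrow> x \<in> X \<Longrightarrow> \<exists>y\<in>X. agree {- int n..0} x y \<and> past 0 y \<in> U"
    "\<And>x. x \<in> X \<Longrightarrow> (\<And>U. U \<in> \<G> \<Longrightarrow> past 0 x \<in> U) \<Longrightarrow> past 0 x \<in> D"
    using residual_sets by metis
  obtain C where C: "open_dense C" "\<And>x. x \<in> C \<Longrightarrow> past 0 x \<in> D \<Longrightarrow> g (past 0 x) (x 1) > 0"
    using open_dense_positive by blast
  define fol where "fol = (\<lambda>x a. \<exists>z\<in>X. agree {..0} x z \<and> map z [1..int (length a)] = a)"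
  define B where "B U a = {x\<in>X. \<not> fol x a \<or>
     ((\<exists>n::nat. \<forall>y\<in>X. agree {- int n..0} x y \<longrightarrow> fol y a) \<and> past (int (length a)) (cat 0 x a) \<in> U)}" for U a
  have B: "open_dense (B U a)" if "U \<in> \<G>" for U a
    unfolding B_def fol_def by (rule open_dense_future[OF \<G>(2,3)]) (use that in auto)
  define \<S> where "\<S> = (\<Union>i. insert {x. shiftby i x \<in> C} (\<Union>U\<in>\<G>. \<Union>a. {{x. shiftby i x \<in> B U a}}))"
  have "countable \<S>" unfolding \<S>_def using \<G>(1) by (intro countable_UN countable_insert) auto
  moreover have "open_dense S" if "S \<in> \<S>" for S
    using that B C(1) open_dense_shift by (auto simp: \<S>_def)
  ultimately obtain y where y: "y \<in> X" "\<And>S. S \<in> \<S> \<Longrightarrow> y \<in> S" "agree {- int n..int n} x y"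
    using Baire_X[OF _ _ assms] by metis
  have yC: "shiftby i y \<in> C" and yB: "U \<in> \<G> \<Longrightarrow> shiftby i y \<in> B U a" for i U a
    using y(2) by (auto simp: \<S>_def)
  \<comment> \<open>The word that \<open>z\<close> reads after time \<open>i\<close> can follow the
    past of \<open>y\<close>, so the conditions for this word place the longer past in all the open
    sets.\<close>
  have future: "past (i + int k) z \<in> D" if z: "z \<in> X" "agree {..i} y z" for i k z
  proof -
    define w where "w = shiftby i z"
    have w: "w \<in> X" "agree {..0} (shiftby i y) w" using z by (auto simp: w_def agree_shiftby_atMost)
    let ?a = "map w [1..int k]"
    have fol: "fol (shiftby i y) ?a" unfolding fol_def using w by auto
    have eq: "past (int k) (cat 0 (shiftby i y) ?a) = past (int k) w"
      using agree_cat_iff[of 0 ?a "shiftby i y" w] w by (simp add: past_eq_iff)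
    have "past 0 (shiftby (int k) w) \<in> D"
    proof (rule \<G>(4))
      fix U assume "U \<in> \<G>"
      from yB[OF this, of i ?a] fol show "past 0 (shiftby (int k) w) \<in> U"
        unfolding B_def by (auto simp: eq)
    qed (simp add: w)
    then show ?thesis by (simp add: w_def add.commute)
  qed
  have "past i y \<in> D" for i using future[OF y(1), of i 0] by simp
  then have "y \<in> E_set X D g"
    unfolding E_set_iff using y(1) future C(2)[OF yC] by (auto simp: shiftby_apply add.commute)
  then show ?thesis using y(3) by blast
qed


section \<open>\<open>D\<close> as a maximal domain of continuity\<close>

lemma D_dense:
  assumes "open U" "p \<in> U" "p \<in> proj X {..0}" shows "\<exists>d\<in>D. d \<in> U"
proof -
  let ?T = "top_of_set (proj X {..0})"
  from residual_g obtain G where G: "?T closure_of G = proj X {..0}" "G \<subseteq> D"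
    unfolding residual_g_function_def residual_in_def by auto
  then have "p \<in> closure D"
    using assms(3) closure_mono[of "proj X {..0} \<inter> G" D]
    unfolding closure_of_subtopology euclidean_closure_of by blast
  then show ?thesis
    using assms(1,2) open_Int_closure_eq_empty[of U D] by blast
qed

text \<open>Setting \<open>h p = L\<close> extends \<open>g\<close> for all letters at once, which
  maximality (ii) forbids for \<open>p\<close> outside \<open>D\<close>.\<close>

lemma g_extension_in_D:
  assumes p: "p \<in> proj X {..0}"
    and lim: "\<And>\<alpha> \<epsilon>. \<epsilon> > 0 \<Longrightarrow> \<exists>U. open U \<and> p \<in> U \<and> (\<forall>d\<in>U \<inter> D. \<bar>g d \<alpha> - L \<alpha>\<bar> < \<epsilon>)"
  shows "p \<in> D"
proof (rule ccontr)
  assume pD: "p \<notin> D"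
  define h where "h d \<alpha> = (if d = p then L \<alpha> else g d \<alpha>)" for d \<alpha>
  have "continuous_on (insert p D) (\<lambda>d. h d \<alpha>)" for \<alpha>
    unfolding continuous_on_def
  proof
    fix d assume d: "d \<in> insert p D"
    show "((\<lambda>d. h d \<alpha>) \<longlongrightarrow> h d \<alpha>) (at d within insert p D)"
    proof (cases "d = p")
      case True
      show "((\<lambda>d. h d \<alpha>) \<longlongrightarrow> h d \<alpha>) (at d within insert p D)"
      proof (rule tendstoI)
        fix \<epsilon> :: real assume "\<epsilon> > 0"
        from lim[OF this] obtain U where "open U" "p \<in> U" "\<forall>d\<in>U \<inter> D. \<bar>g d \<alpha> - L \<alpha>\<bar> < \<epsilon>" by blast
        then show "\<forall>\<^sub>F x in at d within insert p D. dist (h x \<alpha>) (h d \<alpha>) < \<epsilon>"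
          unfolding eventually_at_topological True
          by (intro exI[of _ U]) (auto simp: h_def dist_real_def)
      qed
    next
      case False
      \<comment> \<open>A coordinate separating \<open>d\<close> from \<open>p\<close> gives a
        neighbourhood of \<open>d\<close> on which \<open>h\<close> is still
        \<open>g\<close>.\<close>
      then obtain j where j: "d j \<noteq> p j" by auto
      let ?S = "{v. v j = d j}"
      have S: "open ?S" "d \<in> ?S" using open_eval[of "\<lambda>a. a = d j" j] by auto
      have "((\<lambda>d. g d \<alpha>) \<longlongrightarrow> g d \<alpha>) (at d within D)"
        using g_continuous_on[of \<alpha>] d False by (auto simp: continuous_on_def)
      then have "((\<lambda>d. g d \<alpha>) \<longlongrightarrow> g d \<alpha>) (at d within ?S \<inter> D)"
        by (rule tendsto_within_subset) auto
      moreover have "\<forall>\<^sub>F x in at d within ?S \<inter> D. g x \<alpha> = h x \<alpha>"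
        unfolding eventually_at_topological using S pD by (intro exI[of _ UNIV]) (auto simp: h_def)
      ultimately have "((\<lambda>d. h d \<alpha>) \<longlongrightarrow> h d \<alpha>) (at d within ?S \<inter> D)"
        using False by (simp add: h_def tendsto_cong)
      moreover have "at d within ?S \<inter> D = at d within insert p D"
        using S j by (intro at_within_nhd[OF S(2,1)]) auto
      ultimately show "((\<lambda>d. h d \<alpha>) \<longlongrightarrow> h d \<alpha>) (at d within insert p D)" by simp
    qed
  qed
  then have "continuous_on (insert p D) h"
    by (intro continuous_on_coordinatewise_then_product)
  moreover have "\<forall>x\<in>D. h x = g x" using pD by (auto simp: h_def)
  ultimately show False
    using residual_g p pD unfolding residual_g_function_def by blast
qed

definition osc_set :: "nat \<Rightarrow> (int \<Rightarrow> 'a) set" where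
  "osc_set n = \<Union>{U. open U \<and> (\<forall>d\<in>U \<inter> D. \<forall>d'\<in>U \<inter> D. \<forall>\<alpha>. \<bar>g d \<alpha> - g d' \<alpha>\<bar> \<le> 1 / real (Suc n))}"

text \<open>This is what makes \<open>D\<close> a Borel set. Continuity bounds the oscillation at
  points of \<open>D\<close>. Conversely, small oscillation near \<open>p\<close> makes the values
  of \<open>g\<close> at points of \<open>D\<close> tending to \<open>p\<close> Cauchy, and
  maximality puts \<open>p\<close> into \<open>D\<close>.\<close>

lemma D_eq_osc: "D = proj X {..0} \<inter> (\<Inter>n. osc_set n)"
proof safe
  fix p assume "p \<in> D" then show "p \<in> proj X {..0}" using D_subset by blast
next
  fix p n assume p: "p \<in> D"
  have "\<exists>U. open U \<and> p \<in> U \<and> (\<forall>d\<in>U \<inter> D. \<bar>g d \<alpha> - g p \<alpha>\<bar> < 1 / (2 * real (Suc n)))" for \<alpha>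
  proof -
    have "((\<lambda>d. g d \<alpha>) \<longlongrightarrow> g p \<alpha>) (at p within D)"
      using g_continuous_on[of \<alpha>] p by (auto simp: continuous_on_def)
    from tendstoD[OF this, of "1 / (2 * real (Suc n))"]
    obtain U where U: "open U" "p \<in> U"
      "\<And>d. d \<in> U \<Longrightarrow> d \<noteq> p \<Longrightarrow> d \<in> D \<Longrightarrow> \<bar>g d \<alpha> - g p \<alpha>\<bar> < 1 / (2 * real (Suc n))"
      unfolding eventually_at_topological by (auto simp: dist_real_def)
    have "\<bar>g d \<alpha> - g p \<alpha>\<bar> < 1 / (2 * real (Suc n))" if "d \<in> U \<inter> D" for d
      using U(3)[of d] that by (cases "d = p") auto
    then show ?thesis using U by blast
  qed
  then obtain U where U: "\<And>\<alpha>. open (U \<alpha>)" "\<And>\<alpha>. p \<in> U \<alpha>"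
    "\<And>\<alpha> d. d \<in> U \<alpha> \<Longrightarrow> d \<in> D \<Longrightarrow> \<bar>g d \<alpha> - g p \<alpha>\<bar> < 1 / (2 * real (Suc n))" by (metis IntI)
  have "\<bar>g d \<alpha> - g d' \<alpha>\<bar> \<le> 1 / real (Suc n)" if "d \<in> (\<Inter>\<alpha>. U \<alpha>)" "d \<in> D" "d' \<in> (\<Inter>\<alpha>. U \<alpha>)" "d' \<in> D" for d d' \<alpha>
  proof -
    have "\<bar>g d \<alpha> - g p \<alpha>\<bar> < 1 / (2 * real (Suc n))" "\<bar>g d' \<alpha> - g p \<alpha>\<bar> < 1 / (2 * real (Suc n))"
      using U(3) that by auto
    moreover have "1 / (2 * real (Suc n)) + 1 / (2 * real (Suc n)) = 1 / real (Suc n)"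
      by (simp add: field_simps)
    moreover have "\<bar>a - c\<bar> \<le> e'" if "\<bar>a - b\<bar> < e" "\<bar>c - b\<bar> < e" "e + e = e'" for a b c e e' :: real
      using that by linarith
    ultimately show ?thesis by blast
  qed
  moreover have "open (\<Inter>\<alpha>. U \<alpha>)" by (intro open_INT ballI U finite)
  ultimately show "p \<in> osc_set n"
    unfolding osc_set_def
  proof (intro UnionI CollectI conjI ballI allI)
    show "p \<in> (\<Inter>\<alpha>. U \<alpha>)" using U(2) by simp
  qed auto
next
  fix p assume p: "p \<in> proj X {..0}" and posc: "p \<in> (\<Inter>n. osc_set n)"
  have "\<forall>n. \<exists>U. open U \<and> p \<in> U \<and> (\<forall>d\<in>U \<inter> D. \<forall>d'\<in>U \<inter> D. \<forall>\<alpha>. \<bar>g d \<alpha> - g d' \<alpha>\<bar> \<le> 1 / real (Suc n))"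
  proof
    fix n
    have "p \<in> osc_set n" using posc by simp
    then obtain U where "U \<in> {U. open U \<and> (\<forall>d\<in>U \<inter> D. \<forall>d'\<in>U \<inter> D. \<forall>\<alpha>. \<bar>g d \<alpha> - g d' \<alpha>\<bar> \<le> 1 / real (Suc n))}" "p \<in> U"
      unfolding osc_set_def by (rule UnionE)
    then show "\<exists>U. open U \<and> p \<in> U \<and> (\<forall>d\<in>U \<inter> D. \<forall>d'\<in>U \<inter> D. \<forall>\<alpha>. \<bar>g d \<alpha> - g d' \<alpha>\<bar> \<le> 1 / real (Suc n))"
      unfolding mem_Collect_eq by (intro exI conjI) (elim conjE, assumption)+
  qed
  then obtain U where U: "\<And>n. open (U n)" "\<And>n. p \<in> U n"
    "\<And>n d d' \<alpha>. d \<in> U n \<Longrightarrow> d \<in> D \<Longrightarrow> d' \<in> U n \<Longrightarrow> d' \<in> D \<Longrightarrow> \<bar>g d \<alpha> - g d' \<alpha>\<bar> \<le> 1 / real (Suc n)"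
    by (metis IntI)
  \<comment> \<open>A point in the first \<open>n + 1\<close> neighbourhoods at once; two such
    points with index beyond \<open>N\<close> share the neighbourhood \<open>U N\<close>, hence
    their values differ by at most \<open>1 / (N + 1)\<close>.\<close>
  have "\<exists>d\<in>D. d \<in> (\<Inter>k\<in>{..n}. U k)" for n
    by (rule D_dense[OF _ _ p]) (use U in auto)
  then obtain d where d: "\<And>n. d n \<in> D" "\<And>n k. k \<le> n \<Longrightarrow> d n \<in> U k" by (metis INT_iff atMost_iff)
  have "convergent (\<lambda>n. g (d n) \<alpha>)" for \<alpha>
  proof -
    have "Cauchy (\<lambda>n. g (d n) \<alpha>)"
    proof (rule CauchyI)
      fix \<epsilon> :: real assume "\<epsilon> > 0"
      then obtain N where N: "1 / real (Suc N) < \<epsilon>" using nat_approx_posE by blast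
      have "norm (g (d m) \<alpha> - g (d n) \<alpha>) < \<epsilon>" if "m \<ge> N" "n \<ge> N" for m n
        using U(3)[of "d m" N "d n" \<alpha>] d that N by fastforce
      then show "\<exists>M. \<forall>m\<ge>M. \<forall>n\<ge>M. norm (g (d m) \<alpha> - g (d n) \<alpha>) < \<epsilon>" by blast
    qed
    then show ?thesis by (rule Cauchy_convergent)
  qed
  then obtain L where L: "\<And>\<alpha>. (\<lambda>n. g (d n) \<alpha>) \<longlonglongrightarrow> L \<alpha>" unfolding convergent_def by metis
  show "p \<in> D"
  proof (rule g_extension_in_D[OF p])
    fix \<alpha> and \<epsilon> :: real assume "\<epsilon> > 0"
    then obtain N where N: "1 / real (Suc N) < \<epsilon>" using nat_approx_posE by blast
    have "\<bar>g e \<alpha> - L \<alpha>\<bar> < \<epsilon>" if "e \<in> U N \<inter> D" for e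
    proof -
      have "(\<lambda>n. \<bar>g e \<alpha> - g (d n) \<alpha>\<bar>) \<longlonglongrightarrow> \<bar>g e \<alpha> - L \<alpha>\<bar>"
        by (intro tendsto_intros L)
      moreover have "\<bar>g e \<alpha> - g (d n) \<alpha>\<bar> \<le> 1 / real (Suc N)" if "n \<ge> N" for n
        using U(3)[of e N "d n" \<alpha>] d(2)[of N n] d(1)[of n] that \<open>e \<in> U N \<inter> D\<close> by blast
      ultimately have "\<bar>g e \<alpha> - L \<alpha>\<bar> \<le> 1 / real (Suc N)"
        by (intro LIMSEQ_le_const2) blast+
      then show ?thesis using N by simp
    qed
    then show "\<exists>U. open U \<and> p \<in> U \<and> (\<forall>d\<in>U \<inter> D. \<bar>g d \<alpha> - L \<alpha>\<bar> < \<epsilon>)"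
      using U by blast
  qed
qed

lemma closed_proj: "closed (proj X {..0})"
proof -
  have "p \<in> proj X {..0}" if "p \<in> closure (proj X {..0})" for p
  proof -
    have *: "\<exists>z\<in>X. agree {- int n..int n} p (restrict z {..0})" for n
      using that by (auto simp: closure_seq_iff proj_def)
    have "\<exists>z\<in>X. agree {- int n..0} p z \<and> agree {} p z" for n
      using *[of n] by (auto simp: agree_def)
    from closed_agree_limit[OF closed_X this]
    obtain z where z: "z \<in> X" "agree {..0} p z" by blast
    have "p j = undefined" if "j > 0" for j
      using *[of "nat j"] that by (auto simp: agree_def)
    then have "p = restrict z {..0}"
      using z by (auto simp: agree_def fun_eq_iff restrict_def)
    then show ?thesis using z by (auto simp: proj_def)
  qed
  then show ?thesis using closure_subset closure_eq by blast
qed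

lemma D_borel [measurable]: "D \<in> sets borel"
proof -
  have "open (osc_set n)" for n unfolding osc_set_def by (rule open_Union) auto
  moreover have "proj X {..0} \<in> sets borel" using closed_proj by (rule borel_closed)
  ultimately show ?thesis by (subst D_eq_osc) auto
qed

text \<open>\<open>E(g)\<close> is dense, so \<open>g\<close> is determined by its restriction to the pasts of points of \<open>E(g)\<close>,
  and by maximality \<open>D\<close> contains every point to which this restriction extends continuously.\<close>
lemma E_limit_in_D:
  assumes x: "x \<in> X"
    and lim: "\<And>\<alpha> \<epsilon>. \<epsilon> > 0 \<Longrightarrow>
      \<exists>n::nat. \<forall>z\<in>E_set X D g. agree {- int n..0} x z \<longrightarrow> \<bar>g (past 0 z) \<alpha> - L \<alpha>\<bar> < \<epsilon>"
  shows "past 0 x \<in> D \<and> g (past 0 x) \<alpha> = L \<alpha>"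
proof -
  have near: "\<exists>U. open U \<and> past 0 x \<in> U \<and> (\<forall>d\<in>U \<inter> D. \<bar>g d \<alpha> - L \<alpha>\<bar> < \<epsilon>)" if "\<epsilon> > 0" for \<alpha> \<epsilon>
  proof -
    from lim[of "\<epsilon> / 2"] that obtain n :: nat where
      n: "\<And>z. z \<in> E_set X D g \<Longrightarrow> agree {- int n..0} x z \<Longrightarrow> \<bar>g (past 0 z) \<alpha> - L \<alpha>\<bar> < \<epsilon> / 2"
      by (metis half_gt_zero)
    have "\<bar>g d \<alpha> - L \<alpha>\<bar> < \<epsilon>" if d: "d \<in> D" "agree {- int n..0} (past 0 x) d" for d
    proof -
      have "((\<lambda>d. g d \<alpha>) \<longlongrightarrow> g d \<alpha>) (at d within D)"
        using g_continuous_on[of \<alpha>] d by (auto simp: continuous_on_def)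
      from tendstoD[OF this, of "\<epsilon> / 2"] \<open>\<epsilon> > 0\<close>
      obtain U where U: "open U" "d \<in> U"
        "\<And>e. e \<in> U \<Longrightarrow> e \<noteq> d \<Longrightarrow> e \<in> D \<Longrightarrow> \<bar>g e \<alpha> - g d \<alpha>\<bar> < \<epsilon> / 2"
        unfolding eventually_at_topological by (auto simp: dist_real_def)
      obtain m :: nat where m: "\<And>e. agree {- int m..int m} d e \<Longrightarrow> e \<in> U"
        using open_contains_agree[OF U(1,2)] by blast
      obtain y where y: "y \<in> X" "past 0 y = d" using D_past[OF d(1)] by blast
      \<comment> \<open>Close to \<open>y\<close> for two reasons: window \<open>m\<close> for the
        continuity of \<open>g\<close> at \<open>d\<close>, window \<open>n\<close> for the
        hypothesis on \<open>E(g)\<close>.\<close>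
      obtain z where z: "z \<in> E_set X D g" "agree {- int (m + n)..int (m + n)} y z"
        using E_dense[OF y(1)] by blast
      have dz: "d j = past 0 z j" if "j \<in> {- int (m + n)..int (m + n)}" for j
        using z(2) that y(2) by (auto simp: past_0 agree_def)
      have "agree {- int m..int m} d (past 0 z)"
        unfolding agree_def using dz by auto
      then have "past 0 z \<in> U" by (rule m)
      then have "\<bar>g (past 0 z) \<alpha> - g d \<alpha>\<bar> < \<epsilon> / 2"
        using U(3)[of "past 0 z"] E_D[OF z(1), of 0] \<open>\<epsilon> > 0\<close> by (cases "past 0 z = d") auto
      moreover have "agree {- int n..0} x z"
        unfolding agree_def
      proof
        fix j assume j: "j \<in> {- int n..0}"
        then have "d j = past 0 z j" by (intro dz) auto
        then show "x j = z j" using d(2) j by (auto simp: agree_def past_0)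
      qed
      then have "\<bar>g (past 0 z) \<alpha> - L \<alpha>\<bar> < \<epsilon> / 2" using n z(1) by blast
      ultimately show ?thesis by linarith
    qed
    then show ?thesis
      by (intro exI[of _ "{d. agree {- int n..0} (past 0 x) d}"]) (auto intro!: open_agree)
  qed
  have "past 0 x \<in> D"
    by (rule g_extension_in_D[OF _ near]) (use x in \<open>auto simp: proj_def past_0\<close>)
  moreover from this have "\<bar>g (past 0 x) \<alpha> - L \<alpha>\<bar> < \<epsilon>" if "\<epsilon> > 0" for \<epsilon>
    using near[OF that, of \<alpha>] by blast
  then have "g (past 0 x) \<alpha> = L \<alpha>"
    by (metis abs_ge_zero eq_iff_diff_eq_0 abs_eq_0 less_irrefl order_less_le)
  ultimately show ?thesis by simp
qed

end

section \<open>Measures on fibers\<close>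

lemma map_upt_eq_iff: "map f [0..<n] = a \<longleftrightarrow> length a = n \<and> (\<forall>k<n. f k = a ! k)"
proof
  assume *: "length a = n \<and> (\<forall>k<n. f k = a ! k)"
  show "map f [0..<n] = a"
    by (rule nth_equalityI) (use * in simp_all)
qed auto

section \<open>A process with prescribed transition probabilities\<close>

text \<open>The Ionescu-Tulcea theorem, with a kernel that at step \<open>n\<close> reads the first
  \<open>n\<close> letters as a list.\<close>

lemma sequence_law_exists:
  fixes q :: "'a::finite list \<Rightarrow> 'a pmf"
  obtains T :: "(nat \<Rightarrow> 'a) measure" where
    "sets T = sets (PiM UNIV (\<lambda>_. count_space UNIV))" "prob_space T"
    "\<And>a. emeasure T {\<omega>. map \<omega> [0..<length a] = a} = (\<Prod>k<length a. ennreal (pmf (q (take k a)) (a ! k)))"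
proof -
  define M :: "nat \<Rightarrow> 'a measure" where "M = (\<lambda>_. count_space UNIV)"
  define P where "P n \<omega> = measure_pmf (q (map \<omega> [0..<n]))" for n and \<omega> :: "nat \<Rightarrow> 'a"
  have word: "(\<lambda>\<omega>. map \<omega> [0..<n]) \<in> measurable (PiM {0..<n} M) (count_space UNIV)" for n
  proof -
    have "(\<lambda>\<omega>. map \<omega> [0..<n]) -` {a} \<inter> space (PiM {0..<n} M) \<in> sets (PiM {0..<n} M)" for a
    proof (cases "length a = n")
      case True
      then have "(\<lambda>\<omega>. map \<omega> [0..<n]) -` {a} \<inter> space (PiM {0..<n} M)
        = {\<omega> \<in> space (PiM {0..<n} M). \<forall>k\<in>{0..<n}. \<omega> k = a ! k}"
        by (auto simp: map_upt_eq_iff)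
      also have "\<dots> \<in> sets (PiM {0..<n} M)"
      proof (rule sets.sets_Collect_finite_All)
        fix k assume k: "k \<in> {0..<n}"
        have "(\<lambda>\<omega>. \<omega> k) \<in> measurable (PiM {0..<n} M) (M k)"
          using k by (rule measurable_component_singleton)
        then have "(\<lambda>\<omega>. \<omega> k) -` {a ! k} \<inter> space (PiM {0..<n} M) \<in> sets (PiM {0..<n} M)"
          by (rule measurable_sets) (simp add: M_def)
        moreover have "(\<lambda>\<omega>. \<omega> k) -` {a ! k} \<inter> space (PiM {0..<n} M) = {\<omega> \<in> space (PiM {0..<n} M). \<omega> k = a ! k}"
          by auto
        ultimately show "{\<omega> \<in> space (PiM {0..<n} M). \<omega> k = a ! k} \<in> sets (PiM {0..<n} M)" by simp
      qed auto
      finally show ?thesis .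
    next
      case False
      then have "(\<lambda>\<omega>. map \<omega> [0..<n]) -` {a} \<inter> space (PiM {0..<n} M) = {}" by auto
      then show ?thesis by simp
    qed
    then show ?thesis by (simp add: measurable_count_space_eq2_countable)
  qed
  interpret IT: Ionescu_Tulcea P M
  proof
    fix n
    have "(\<lambda>w. measure_pmf (q w)) \<in> measurable (count_space UNIV) (subprob_algebra (M n))"
      by (simp add: measurable_count_space_eq1 M_def measure_pmf_in_subprob_algebra)
    from measurable_compose[OF word this] show "P n \<in> measurable (PiM {0..<n} M) (subprob_algebra (M n))"
      by (simp add: P_def[abs_def])
  qed (auto simp: P_def measure_pmf.prob_space_axioms)
  \<comment> \<open>The product over the empty index set has one point, constantly
    \<open>undefined\<close>; the process starts there.\<close>
  let ?u = "\<lambda>_::nat. undefined :: 'a"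
  define S where "S n a = {\<omega> \<in> space (PiM {0..<n} M). map \<omega> [0..<n] = a}" for n a
  have S_eq: "S n a = (\<lambda>\<omega>. map \<omega> [0..<n]) -` {a} \<inter> space (PiM {0..<n} M)" for n a
    by (auto simp: S_def)
  have S_sets: "S n a \<in> sets (PiM {0..<n} M)" for n a
    unfolding S_eq by (rule measurable_sets[OF word]) simp
  have u: "?u \<in> space (PiM {0..<0} M)" by (simp add: space_PiM)
  have C: "emeasure (IT.C 0 n ?u) (S n a) = (\<Prod>k<length a. ennreal (pmf (q (take k a)) (a ! k)))"
    if "length a = n" for n a
    using that
  proof (induction n arbitrary: a)
    case 0
    then show ?case by (simp add: S_def space_PiM emeasure_return sets_PiM_empty)
  next
    case (Suc n)
    then obtain b \<alpha> where a: "a = b @ [\<alpha>]" "length b = n" by (metis append_butlast_last_id length_butlast diff_Suc_1 length_0_conv nat.simps(3))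
    have sp: "space (IT.C 0 n ?u) = space (PiM {0..<n} M)" using IT.space_C[OF u, of n] by simp
    have st: "sets (IT.C 0 n ?u) = sets (PiM {0..<n} M)" using IT.sets_C[OF u, of n] by simp
    \<comment> \<open>The kernel reaches the cylinder of \<open>b @ [\<alpha>]\<close> only from the
      cylinder of \<open>b\<close>, and then by the letter \<alpha> alone.\<close>
    have step: "emeasure (IT.eP n \<omega>) (S (Suc n) a) = ennreal (pmf (q b) \<alpha>) * indicator (S n b) \<omega>"
      if \<omega>: "\<omega> \<in> space (PiM {0..<n} M)" for \<omega>
    proof -
      have "emeasure (IT.eP n \<omega>) (S (Suc n) a) = P n \<omega> ((\<lambda>x. fun_upd \<omega> n x) -` S (Suc n) a \<inter> space (M n))"
        by (rule IT.emeasure_eP[OF \<omega> S_sets])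
      also have "(\<lambda>x. fun_upd \<omega> n x) -` S (Suc n) a \<inter> space (M n) = (if \<omega> \<in> S n b then {\<alpha>} else {})"
        using \<omega> a(2) by (auto simp: S_def M_def a(1) space_PiM PiE_iff extensional_def)
      also have "P n \<omega> \<dots> = ennreal (pmf (q b) \<alpha>) * indicator (S n b) \<omega>"
        by (auto simp: P_def S_def emeasure_pmf_single)
      finally show ?thesis .
    qed
    have "emeasure (IT.C 0 (Suc n) ?u) (S (Suc n) a) = (\<integral>\<^sup>+\<omega>. emeasure (IT.eP n \<omega>) (S (Suc n) a) \<partial>IT.C 0 n ?u)"
    proof -
      have "emeasure (IT.C 0 n ?u \<bind> IT.eP n) (S (Suc n) a) = (\<integral>\<^sup>+\<omega>. emeasure (IT.eP n \<omega>) (S (Suc n) a) \<partial>IT.C 0 n ?u)"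
      proof (rule emeasure_bind[where N = "PiM {0..<Suc n} M"])
        show "space (IT.C 0 n ?u) \<noteq> {}"
          using prob_space.not_empty[OF IT.prob_space_C[OF u]] by simp
        show "IT.eP n \<in> measurable (IT.C 0 n ?u) (subprob_algebra (PiM {0..<Suc n} M))"
          using IT.measurable_eP[of n] measurable_cong_sets[OF st refl] by blast
      qed (rule S_sets)
      then show ?thesis by simp
    qed
    also have "\<dots> = (\<integral>\<^sup>+\<omega>. ennreal (pmf (q b) \<alpha>) * indicator (S n b) \<omega> \<partial>IT.C 0 n ?u)"
      by (intro nn_integral_cong step) (simp add: sp)
    also have "\<dots> = ennreal (pmf (q b) \<alpha>) * emeasure (IT.C 0 n ?u) (S n b)"
      by (rule nn_integral_cmult_indicator) (simp add: st S_sets)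
    also have "\<dots> = (\<Prod>k<length a. ennreal (pmf (q (take k a)) (a ! k)))"
      using Suc.IH[OF a(2)] by (simp add: a nth_append mult.commute)
    finally show ?case .
  qed
  define T where "T = IT.PF.lim"
  have law: "emeasure T {\<omega>. map \<omega> [0..<length a] = a} = (\<Prod>k<length a. ennreal (pmf (q (take k a)) (a ! k)))" for a
  proof -
    let ?n = "length a"
    have "{\<omega>. map \<omega> [0..<?n] = a} = IT.PF.emb UNIV {0..<?n} (S ?n a)"
    proof -
      have "map (restrict \<omega> {0..<?n}) [0..<?n] = map \<omega> [0..<?n]" for \<omega> :: "nat \<Rightarrow> 'a"
        by (intro map_cong) auto
      moreover have "restrict \<omega> {0..<?n} \<in> space (PiM {0..<?n} M)" for \<omega> :: "nat \<Rightarrow> 'a"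
        by (auto simp: space_PiM M_def)
      ultimately show ?thesis
        by (auto simp only: prod_emb_iff S_def mem_Collect_eq) (auto simp: M_def)
    qed
    then have "emeasure T {\<omega>. map \<omega> [0..<?n] = a} = emeasure (IT.CI {0..<?n}) (S ?n a)"
      unfolding T_def using IT.lim[OF _ S_sets[of ?n a]] by simp
    also have "\<dots> = emeasure (IT.C 0 ?n ?u) (IT.PF.emb {0..<?n} {0..<?n} (S ?n a))"
      by (rule IT.emeasure_CI[OF subset_refl S_sets])
    also have "IT.PF.emb {0..<?n} {0..<?n} (S ?n a) = S ?n a"
      by (rule prod_emb_id) (auto simp: S_def space_PiM)
    finally show ?thesis using C[of a ?n] by simp
  qed
  have "space T = UNIV" unfolding T_def IT.PF.space_lim by (simp add: space_PiM M_def)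
  then have "emeasure T (space T) = 1" using law[of "[]"] by simp
  then have "prob_space T" by (rule prob_spaceI)
  moreover have "sets T = sets (PiM UNIV (\<lambda>_. count_space UNIV))"
    unfolding T_def IT.PF.sets_lim by (simp add: M_def)
  ultimately show ?thesis using that law by blast
qed

lemma measurable_seqI:
  fixes f :: "'c \<Rightarrow> int \<Rightarrow> 'a::{finite,discrete_topology}"
  assumes "\<And>j. (\<lambda>\<omega>. f \<omega> j) \<in> measurable M (count_space UNIV)"
  shows "f \<in> borel_measurable M"
proof (rule measurable_sigma_sets[OF borel_eq_cylinders[of 0]])
  fix A :: "(int \<Rightarrow> 'a) set" assume "A \<in> cylinders 0"
  then consider "A = {}" | n v where "A = {y. agree {- int n..int n} v y}"
    by (auto simp: cylinders_def)
  then show "f -` A \<inter> space M \<in> sets M"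
  proof cases
    case 2
    have "f -` A \<inter> space M = {\<omega>\<in>space M. \<forall>j\<in>{- int n..int n}. f \<omega> j = v j}"
      by (auto simp: 2 agree_def)
    also have "\<dots> \<in> sets M"
    proof (rule sets.sets_Collect_finite_All')
      fix j
      have "(\<lambda>\<omega>. f \<omega> j) -` {v j} \<inter> space M \<in> sets M"
        by (rule measurable_sets[OF assms]) simp
      moreover have "(\<lambda>\<omega>. f \<omega> j) -` {v j} \<inter> space M = {\<omega>\<in>space M. f \<omega> j = v j}" by auto
      ultimately show "{\<omega>\<in>space M. f \<omega> j = v j} \<in> sets M" by simp
    qed auto
    finally show ?thesis .
  qed simp
qed auto

text \<open>The product defining \<open>\<mu>\<^sub>i\<^sup>(\<^sup>g\<^sup>)\<close>, with the convention of \<^const>\<open>g0\<close>.\<close>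
definition word_prob :: "(int \<Rightarrow> 'a) set \<Rightarrow> ((int \<Rightarrow> 'a) \<Rightarrow> 'a \<Rightarrow> real) \<Rightarrow> int \<Rightarrow> (int \<Rightarrow> 'a) \<Rightarrow> 'a list \<Rightarrow> real" where
  "word_prob D g i x a = (\<Prod>k<length a. g0 D g (i + int k) (cat i x (take k a)) (a ! k))"

lemma word_prob_Nil [simp]: "word_prob D g i x [] = 1"
  by (simp add: word_prob_def)

lemma word_prob_snoc:
  "word_prob D g i x (a @ [\<alpha>]) = word_prob D g i x a * g0 D g (i + int (length a)) (cat i x a) \<alpha>"
  by (simp add: word_prob_def nth_append)

lemma word_prob_agree: "agree {..i} x y \<Longrightarrow> word_prob D g i x a = word_prob D g i y a"
  by (simp add: word_prob_def cat_agree)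

lemma word_prob_append:
  "word_prob D g i x (a @ b) = word_prob D g i x a * word_prob D g (i + int (length a)) (cat i x a) b"
proof (induction b rule: rev_induct)
  case (snoc \<beta> b)
  have "word_prob D g i x (a @ b @ [\<beta>]) = word_prob D g i x ((a @ b) @ [\<beta>])" by simp
  also have "\<dots> = word_prob D g i x (a @ b) * g0 D g (i + int (length (a @ b))) (cat i x (a @ b)) \<beta>"
    by (rule word_prob_snoc)
  finally show ?case by (simp add: snoc.IH word_prob_snoc cat_append algebra_simps)
qed simp

lemma fiber_cyl_empty_iff: "fiber_cyl X i x a = {} \<longleftrightarrow> a \<notin> followers X i (length a) x"
  by (auto simp: followers_iff fiber_cyl_iff)

context g_system
begin

lemma word_prob_range: "0 \<le> word_prob D g i x a" "word_prob D g i x a \<le> 1"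
  unfolding word_prob_def by (auto intro!: prod_nonneg prod_le_1 g0_range)

text \<open>The last factor decides: if it is nonzero, the past before it lies in \<open>D\<close>
  and thus comes from a point of \<open>X\<close>, and its letter can follow this past.\<close>

lemma word_prob_pos_ex:
  assumes "word_prob D g i x a \<noteq> 0" "x \<in> X"
  shows "fiber_cyl X i x a \<noteq> {}"
proof (cases a rule: rev_exhaust)
  case Nil
  then have "x \<in> fiber_cyl X i x a" using assms(2) by (simp add: fiber_cyl_iff)
  then show ?thesis by blast
next
  case (snoc b \<alpha>)
  then have "g0 D g (i + int (length b)) (cat i x b) \<alpha> \<noteq> 0" using assms(1) by (simp add: word_prob_snoc)
  then obtain z where z: "z \<in> X" "agree {..i + int (length b)} (cat i x b) z" "z (i + int (length b) + 1) = \<alpha>"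
    by (rule g0_pos_ex)
  have "map z [i + 1..i + int (length a)] = a"
    using z(2,3) unfolding agree_cat_iff by (simp add: snoc upto_rec2 algebra_simps)
  then have "z \<in> fiber_cyl X i x a" using z(1,2) unfolding agree_cat_iff by (simp add: fiber_cyl_iff)
  then show ?thesis by blast
qed

lemma word_prob_point:
  assumes "x \<in> E_set X D g"
  shows "word_prob D g i x (map x [i + 1..i + int n]) > 0"
proof (induction n)
  case (Suc n)
  let ?a = "map x [i + 1..i + int n]"
  have a: "map x [i + 1..i + int (Suc n)] = ?a @ [x (i + int n + 1)]"
    using upto_rec2[of "i + 1" "i + int (Suc n)"] by (simp add: algebra_simps)
  have "agree {..i + int (length ?a)} (cat i x ?a) x" unfolding agree_cat_iff by simp
  then have "g0 D g (i + int n) (cat i x ?a) (x (i + int n + 1)) = g0 D g (i + int n) x (x (i + int n + 1))"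
    by (intro g0_agree) simp
  also have "\<dots> > 0" using E_D[OF assms] E_pos[OF assms, of "i + int n"] by (simp add: g0_def)
  finally show ?case unfolding a word_prob_snoc using Suc.IH by simp
qed simp

lemma E_cat_D:
  assumes "x \<in> E_set X D g" "fiber_cyl X i x a \<noteq> {}"
  shows "past (i + int (length a)) (cat i x a) \<in> D"
proof -
  obtain z where z: "z \<in> X" "agree {..i} x z" "map z [i + 1..i + int (length a)] = a"
    using assms(2) by (auto simp: fiber_cyl_iff)
  then have "past (i + int (length a)) (cat i x a) = past (i + int (length a)) z"
    using agree_cat_iff[of i a x z] by (simp add: past_eq_iff)
  then show ?thesis using E_future[OF assms(1) z(1,2)] by simp
qed

text \<open>\<open>g_at\<close> has arbitrary values off \<open>D\<close>. For \<open>x\<close> in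
  \<open>E(g)\<close> every prefix of a follower ends in \<open>D\<close>, so all factors are values
  of \<open>g0\<close>.\<close>

lemma product_eq_word_prob:
  assumes x: "x \<in> E_set X D g" and a: "a \<in> followers X i N x"
  shows "(\<Prod>k=1..N. g_at g (i + int (k - 1)) (cat i x (take (k - 1) a)) (a ! (k - 1))) = word_prob D g i x a"
proof -
  have len: "length a = N" using a by (simp add: followers_iff)
  have ne: "fiber_cyl X i x (take k a) \<noteq> {}" if k: "k < N" for k
  proof -
    obtain z where z: "z \<in> X" "agree {..i} x z" "map z [i + 1..i + int N] = a"
      using a by (auto simp: followers_iff)
    have "take k a = map z (take k [i + 1..i + int N])" using z(3) by (simp flip: take_map)
    also have "take k [i + 1..i + int N] = [i + 1..i + int k]"
      using k by (intro nth_equalityI) auto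
    finally have "z \<in> fiber_cyl X i x (take k a)"
      using z k len by (simp add: fiber_cyl_iff)
    then show ?thesis by blast
  qed
  have eq: "g_at g (i + int k) (cat i x (take k a)) \<alpha> = g0 D g (i + int k) (cat i x (take k a)) \<alpha>" if k: "k < N" for k \<alpha>
  proof -
    have p: "past (i + int k) (cat i x (take k a)) = shiftby (i + int k) (cat i x (take k a))"
      using restrict_cat[of i x "take k a"] k len by (simp add: past_restrict)
    have "past (i + int k) (cat i x (take k a)) \<in> D"
      using E_cat_D[OF x ne[OF k]] k len by simp
    then show ?thesis by (simp add: g_at_def g0_def p)
  qed
  have "(\<Prod>k=1..N. g_at g (i + int (k - 1)) (cat i x (take (k - 1) a)) (a ! (k - 1)))
     = (\<Prod>k<N. g_at g (i + int k) (cat i x (take k a)) (a ! k))"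
    by (rule prod.reindex_bij_witness[of _ Suc "\<lambda>k. k - 1"]) auto
  then show ?thesis by (simp add: word_prob_def len eq)
qed

lemma fiber_closed: "closed (fiber X i x)"
proof -
  have "fiber X i x = X \<inter> {y. agree {..i} x y}" by (auto simp: fiber_iff)
  then show ?thesis by (simp only:) (intro closed_Int closed_X closed_agree)
qed

lemma fiber_borel [measurable]: "fiber X i x \<in> sets borel"
  using fiber_closed by (rule borel_closed)

lemma fiber_cyl_borel [measurable]: "fiber_cyl X i x a \<in> sets borel"
proof -
  have "fiber_cyl X i x a = fiber X i x \<inter> {y. agree {i + 1..i + int (length a)} (cat i x a) y}"
    using map_cat[of i x a] by (auto simp: fiber_cyl_def simp flip: map_eq_iff_agree)
  then show ?thesis by (simp only:) (intro borel_closed closed_Int fiber_closed closed_agree)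
qed

text \<open>The law that specifies \<open>fiber_measure\<close>, but demanded for all words: a word
  that cannot follow has an empty cylinder and, by \<open>word_prob_pos_ex\<close>, probability 0
  when \<open>x\<close> is in \<open>X\<close>.\<close>

definition fiber_law :: "int \<Rightarrow> (int \<Rightarrow> 'a) \<Rightarrow> (int \<Rightarrow> 'a) measure \<Rightarrow> bool" where
  "fiber_law i x \<nu> \<longleftrightarrow> sets \<nu> = sets (restrict_space borel (fiber X i x)) \<and> prob_space \<nu> \<and>
     (\<forall>a. emeasure \<nu> (fiber_cyl X i x a) = ennreal (word_prob D g i x a))"

lemma sets_fiberI:
  assumes "sets \<nu> = sets (restrict_space borel (fiber X i x))"
  shows "A \<in> sets \<nu> \<longleftrightarrow> A \<subseteq> fiber X i x \<and> A \<in> sets borel" "space \<nu> = fiber X i x"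
  using assms sets_eq_imp_space_eq[OF assms] by (auto simp: sets_restrict_space_iff space_restrict_space)

lemma fiber_law_iff:
  assumes x: "x \<in> E_set X D g"
  shows "fiber_law i x \<nu> \<longleftrightarrow> sets \<nu> = sets (restrict_space borel (fiber X i x)) \<and> prob_space \<nu> \<and>
     (\<forall>N. \<forall>a\<in>followers X i N x. measure \<nu> (fiber_cyl X i x a) =
          (\<Prod>k=1..N. g_at g (i + int (k - 1)) (cat i x (take (k - 1) a)) (a ! (k - 1))))"
    (is "?L \<longleftrightarrow> ?R")
proof
  assume ?L
  then show ?R
    using product_eq_word_prob[OF x] word_prob_range
    by (auto simp: fiber_law_def measure_def)
next
  assume R: ?R
  then interpret prob_space \<nu> by simp
  have "emeasure \<nu> (fiber_cyl X i x a) = ennreal (word_prob D g i x a)" for a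
  proof (cases "a \<in> followers X i (length a) x")
    case True
    then show ?thesis using R product_eq_word_prob[OF x True] by (auto simp: emeasure_eq_measure)
  next
    case False
    then have "fiber_cyl X i x a = {}" by (simp add: fiber_cyl_empty_iff)
    then show ?thesis using word_prob_pos_ex[OF _ E_X[OF x], of i a] by (metis emeasure_empty ennreal_0)
  qed
  then show ?L using R by (simp add: fiber_law_def)
qed

text \<open>Both laws are moved to the whole sequence space. There a cylinder whose window contains
  \<open>i\<close> meets the fiber in the empty set or in one \<open>fiber_cyl\<close>, where the
  values are prescribed.\<close>

lemma fiber_law_unique:
  assumes "fiber_law i x \<nu>" "fiber_law i x \<nu>'"
  shows "\<nu> = \<nu>'"
proof -
  note s = assms[unfolded fiber_law_def, THEN conjunct1]
  note sI = sets_fiberI[OF s(1)] sets_fiberI[OF s(2)]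
  have id0: "(\<lambda>x. x) \<in> borel_measurable (restrict_space borel (fiber X i x))"
    by (rule measurable_restrict_space1) (simp add: measurable_ident_sets)
  have id: "(\<lambda>x. x) \<in> borel_measurable \<nu>" "(\<lambda>x. x) \<in> borel_measurable \<nu>'"
    unfolding measurable_cong_sets[OF s(1) refl] measurable_cong_sets[OF s(2) refl] by (rule id0)+
  have em: "emeasure (distr \<nu> borel (\<lambda>x. x)) B = emeasure \<nu> (B \<inter> fiber X i x)"
    "emeasure (distr \<nu>' borel (\<lambda>x. x)) B = emeasure \<nu>' (B \<inter> fiber X i x)" if "B \<in> sets borel" for B
    unfolding emeasure_distr[OF id(1) that] emeasure_distr[OF id(2) that] sI by (simp_all add: vimage_def Int_def)
  have "distr \<nu> borel (\<lambda>x. x) = distr \<nu>' borel (\<lambda>x. x)"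
  proof (rule measure_eq_if_cylinders[where k = "nat \<bar>i\<bar>"])
    show "finite_measure (distr \<nu> borel (\<lambda>x. x))"
      using assms(1) id(1) unfolding fiber_law_def
      by (intro finite_measure.finite_measure_distr) (auto simp: prob_space_def)
    fix n and v :: "int \<Rightarrow> 'a" assume n: "nat \<bar>i\<bar> \<le> n"
    let ?a = "map v [i + 1..i + int (nat (int n - i))]" and ?B = "{y. agree {- int n..int n} v y}"
    have B: "?B \<in> sets borel" by (intro borel_open open_agree) simp
    have "?B \<inter> fiber X i x = (if agree {- int n..i} v x then fiber_cyl X i x ?a else {})"
    proof -
      have nn: "i + int (nat (int n - i)) = int n" "- int n \<le> i" "i \<le> int n" using n by auto
      have "agree {- int n..int n} v y \<longleftrightarrow> agree {- int n..i} v x \<and> agree {i + 1..int n} v y"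
        if "agree {..i} x y" for y
        using that nn(2,3) by (auto simp: agree_def)
      then show ?thesis
        using nn by (auto simp: fiber_cyl_iff fiber_iff map_eq_iff_agree agree_sym simp del: map_eq_conv)
    qed
    then have "emeasure \<nu> (?B \<inter> fiber X i x) = emeasure \<nu>' (?B \<inter> fiber X i x)"
      using assms by (simp add: fiber_law_def)
    then show "emeasure (distr \<nu> borel (\<lambda>x. x)) ?B = emeasure (distr \<nu>' borel (\<lambda>x. x)) ?B"
      by (simp only: em[OF B])
  qed simp_all
  then have eq: "emeasure \<nu> (B \<inter> fiber X i x) = emeasure \<nu>' (B \<inter> fiber X i x)" if "B \<in> sets borel" for B
    using em[OF that] by simp
  show ?thesis
  proof (rule measure_eqI)
    fix A assume "A \<in> sets \<nu>"
    then have "A \<in> sets borel" "A \<inter> fiber X i x = A" by (auto simp: sI)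
    then show "emeasure \<nu> A = emeasure \<nu>' A" using eq by metis
  qed (use s in simp)
qed

lemma fiber_law_exists:
  assumes x: "x \<in> E_set X D g"
  shows "\<exists>\<nu>. fiber_law i x \<nu>"
proof -
  \<comment> \<open>The point mass is a default for words after which the past is outside
    \<open>D\<close>.\<close>
  define q where "q a = (if past (i + int (length a)) (cat i x a) \<in> D
    then embed_pmf (\<lambda>\<alpha>. g0 D g (i + int (length a)) (cat i x a) \<alpha>) else return_pmf undefined)" for a
  have q: "pmf (q a) \<alpha> = g0 D g (i + int (length a)) (cat i x a) \<alpha>"
    if D: "past (i + int (length a)) (cat i x a) \<in> D" for a \<alpha>
  proof -
    have "(\<integral>\<^sup>+\<alpha>. ennreal (g0 D g (i + int (length a)) (cat i x a) \<alpha>) \<partial>count_space UNIV) = 1"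
      using D g_sum[OF D] g_range[OF D]
      by (simp add: nn_integral_count_space_finite g0_def)
    then show ?thesis using D g0_range by (simp add: q_def pmf_embed_pmf)
  qed
  have prod: "(\<Prod>k<length a. ennreal (pmf (q (take k a)) (a ! k))) = ennreal (word_prob D g i x a)" for a
  proof (induction a rule: rev_induct)
    case (snoc \<alpha> b)
    have "(\<Prod>k<length (b @ [\<alpha>]). ennreal (pmf (q (take k (b @ [\<alpha>]))) ((b @ [\<alpha>]) ! k)))
        = ennreal (word_prob D g i x b) * ennreal (pmf (q b) \<alpha>)"
      using snoc by (simp add: nth_append)
    also have "\<dots> = ennreal (word_prob D g i x (b @ [\<alpha>]))"
    \<comment> \<open>A prefix of positive probability continues the past of \<open>x\<close> inside
      \<open>X\<close>, hence ends in \<open>D\<close>, where \<open>q\<close> is given by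
      \<open>g\<close>; after a prefix of probability 0 both sides vanish.\<close>
    proof (cases "word_prob D g i x b = 0")
      case False
      from E_cat_D[OF x word_prob_pos_ex[OF this E_X[OF x]]] q
      show ?thesis by (simp add: word_prob_snoc ennreal_mult word_prob_range g0_range)
    qed (simp add: word_prob_snoc)
    finally show ?case .
  qed simp
  obtain T :: "(nat \<Rightarrow> 'a) measure" where
    T0: "sets T = sets (PiM UNIV (\<lambda>_. count_space UNIV))" "prob_space T"
    "\<And>a. emeasure T {\<omega>. map \<omega> [0..<length a] = a} = (\<Prod>k<length a. ennreal (pmf (q (take k a)) (a ! k)))"
    using sequence_law_exists[of q] by blast
  note T = T0(1,2) T0(3)[unfolded prod]
  interpret T: prob_space T by (rule T(2))
  have spT: "space T = UNIV" using sets_eq_imp_space_eq[OF T(1)] by (simp add: space_PiM)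
  have evT: "(\<lambda>\<omega>. \<omega> k) \<in> measurable T (count_space UNIV)" for k
    using measurable_component_singleton[of k UNIV "\<lambda>_. count_space UNIV :: 'a measure"]
    unfolding measurable_cong_sets[OF T(1) refl] by simp
  \<comment> \<open>The past of \<open>x\<close> followed by the random letters; letter number 0
    goes to coordinate \<open>i + 1\<close>.\<close>
  define \<Phi> where "\<Phi> \<omega> j = (if j \<le> i then x j else \<omega> (nat (j - i - 1)))" for \<omega> :: "nat \<Rightarrow> 'a" and j
  have \<Phi>[measurable]: "\<Phi> \<in> borel_measurable T"
  proof (rule measurable_seqI)
    fix j show "(\<lambda>\<omega>. \<Phi> \<omega> j) \<in> measurable T (count_space UNIV)"
      using evT by (cases "j \<le> i") (auto simp: \<Phi>_def)
  qed
  have \<Phi>w: "map (\<Phi> \<omega>) [i + 1..i + int n] = map \<omega> [0..<n]" for \<omega> n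
    by (intro nth_equalityI) (auto simp: \<Phi>_def)
  have cyl[measurable]: "{\<omega>. map \<omega> [0..<n] = a} \<in> sets T" for n a
  proof -
    have "{\<omega>. map \<omega> [0..<n] = a} = \<Phi> -` {y. map y [i + 1..i + int n] = a} \<inter> space T"
      by (auto simp: \<Phi>w spT)
    moreover have "{y. map y [i + 1..i + int n] = a} \<in> sets borel"
    proof (cases "\<exists>v. a = map v [i + 1..i + int n]")
      case True
      then obtain v where v: "a = map v [i + 1..i + int n]" by blast
      have "{y. map y [i + 1..i + int n] = a} = {y. agree {i + 1..i + int n} v y}"
        unfolding v map_eq_iff_agree by (auto intro: agree_sym)
      then show ?thesis by (simp add: borel_closed closed_agree)
    next
      case False
      then have "{y. map y [i + 1..i + int n] = a} = {}" by auto
      then show ?thesis by simp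
    qed
    ultimately show ?thesis using measurable_sets[OF \<Phi>] by metis
  qed
  \<comment> \<open>Almost surely all prefixes have positive probability, so every finite piece
    occurs in \<open>X\<close> after the past of \<open>x\<close>; closedness puts the whole
    sequence into \<open>X\<close>.\<close>
  have ae: "AE \<omega> in T. \<Phi> \<omega> \<in> fiber X i x"
  proof -
    have "AE \<omega> in T. \<forall>n. word_prob D g i x (map \<omega> [0..<n]) \<noteq> 0"
      unfolding AE_all_countable
    proof
      fix n
      let ?W = "{a. set a \<subseteq> UNIV \<and> length a = n \<and> word_prob D g i x a = 0}"
      have "finite {a :: 'a list. set a \<subseteq> UNIV \<and> length a = n}" by (rule finite_lists_length_eq) (rule finite)
      then have W: "finite ?W" by (rule rev_finite_subset) auto
      have "(\<Union>a\<in>?W. {\<omega>. map \<omega> [0..<n] = a}) \<in> null_sets T"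
        using W T(3) by (intro null_sets.finite_UN) (auto simp: null_sets_def)
      moreover have "{\<omega> \<in> space T. \<not> word_prob D g i x (map \<omega> [0..<n]) \<noteq> 0} \<subseteq> (\<Union>a\<in>?W. {\<omega>. map \<omega> [0..<n] = a})"
        by auto
      ultimately show "AE \<omega> in T. word_prob D g i x (map \<omega> [0..<n]) \<noteq> 0" by (rule AE_I')
    qed
    then show ?thesis
    proof (rule AE_mp, intro AE_I2 impI)
      fix \<omega> assume \<omega>: "\<forall>n. word_prob D g i x (map \<omega> [0..<n]) \<noteq> 0"
      have ag: "agree {..i} x (\<Phi> \<omega>)" by (auto simp: agree_def \<Phi>_def)
      have "\<Phi> \<omega> \<in> X"
      proof (rule closed_seqI[OF closed_X])
        fix n
        define k where "k = nat (int n - i)"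
        from word_prob_pos_ex[OF _ E_X[OF x]] \<omega>
        obtain z where z: "z \<in> X" "agree {..i} x z" "map z [i + 1..i + int k] = map \<omega> [0..<k]"
          by (fastforce simp: fiber_cyl_iff)
        then have "agree {i + 1..i + int k} (\<Phi> \<omega>) z" by (metis map_eq_iff_agree \<Phi>w)
        then have "agree {..i + int k} (\<Phi> \<omega>) z"
          using ag z(2) by (auto simp: agree_def)
        then have "agree {- int n..int n} (\<Phi> \<omega>) z" by (rule agree_mono) (auto simp: k_def)
        then show "\<exists>z\<in>X. agree {- int n..int n} (\<Phi> \<omega>) z" using z(1) by blast
      qed
      then show "\<Phi> \<omega> \<in> fiber X i x" using ag by (simp add: fiber_iff)
    qed
  qed
  define N where "N = distr T borel \<Phi>"
  interpret N: prob_space N unfolding N_def by (rule T.prob_space_distr[OF \<Phi>])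
  have aeN: "AE y in N. y \<in> fiber X i x"
    unfolding N_def using ae by (subst AE_distr_iff) auto
  define \<nu> where "\<nu> = restrict_space N (fiber X i x)"
  have FN: "fiber X i x \<inter> space N \<in> sets N" by (simp add: N_def)
  have em: "emeasure \<nu> A = emeasure N A" if "A \<subseteq> fiber X i x" for A
    unfolding \<nu>_def by (rule emeasure_restrict_space[OF FN that])
  have "sets \<nu> = sets (restrict_space borel (fiber X i x))"
    unfolding \<nu>_def by (rule sets_restrict_space_cong) (simp add: N_def)
  moreover have "prob_space \<nu>"
  proof (rule prob_spaceI)
    have "emeasure \<nu> (space \<nu>) = emeasure N (fiber X i x)"
      using em[of "fiber X i x"] by (simp add: \<nu>_def space_restrict_space N_def)
    also have "\<dots> = 1" by (rule N.emeasure_eq_1_AE) (use aeN in \<open>auto simp: N_def\<close>)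
    finally show "emeasure \<nu> (space \<nu>) = 1" .
  qed
  moreover have "emeasure \<nu> (fiber_cyl X i x a) = ennreal (word_prob D g i x a)" for a
  proof -
    have "emeasure \<nu> (fiber_cyl X i x a) = emeasure N (fiber_cyl X i x a)"
      by (rule em) (auto simp: fiber_cyl_def)
    also have "\<dots> = emeasure T (\<Phi> -` fiber_cyl X i x a \<inter> space T)"
      by (simp add: N_def emeasure_distr)
    also have "\<dots> = emeasure T {\<omega>. map \<omega> [0..<length a] = a}"
    proof (rule emeasure_eq_AE)
      show "AE \<omega> in T. \<omega> \<in> \<Phi> -` fiber_cyl X i x a \<inter> space T \<longleftrightarrow> \<omega> \<in> {\<omega>. map \<omega> [0..<length a] = a}"
        using ae by eventually_elim (auto simp: fiber_cyl_def \<Phi>w spT)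
    qed (auto intro: measurable_sets[OF \<Phi>])
    finally show ?thesis using T(3) by simp
  qed
  ultimately show ?thesis unfolding fiber_law_def by blast
qed

text \<open>Existence and uniqueness give the definite description its meaning.\<close>

lemma fiber_law_fiber_measure:
  assumes x: "x \<in> E_set X D g"
  shows "fiber_law i x (fiber_measure X g i (restrict x {..i}))"
proof -
  have "fiber_measure X g i (restrict x {..i}) = (THE \<nu>. fiber_law i x \<nu>)"
    unfolding fiber_measure_def fiber_law_iff[OF x] by simp
  moreover have "\<exists>!\<nu>. fiber_law i x \<nu>"
    using fiber_law_exists[OF x] fiber_law_unique by blast
  ultimately show ?thesis using theI'[of "fiber_law i x"] by simp
qed

end

section \<open>Consistency of the fiber measures and construction of the measure \<lambda>\<close>

lemma fiber_antimono: "i \<le> i' \<Longrightarrow> fiber X i' x \<subseteq> fiber X i x"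
  by (auto simp: fiber_iff elim!: agree_mono)

lemma fiber_cyl_eq_append:
  assumes "i \<le> i'"
  shows "fiber_cyl X i' x b = fiber_cyl X i x (map x [i + 1..i'] @ b)"
proof -
  let ?a = "map x [i + 1..i']"
  have len: "i + int (length ?a) = i'" using assms by simp
  have "agree {..i + int (length ?a)} (cat i x ?a) x"
    unfolding agree_cat_iff by (simp only: len agree_refl simp_thms)
  then have "agree {..i'} (cat i x ?a) x" by (simp only: len)
  then have "cat i x (?a @ b) = cat i' x b"
    unfolding cat_append len by (rule cat_agree)
  moreover have "i + int (length (?a @ b)) = i' + int (length b)" using len by simp
  ultimately have "agree {..i + int (length (?a @ b))} (cat i x (?a @ b)) y \<longleftrightarrow>
      agree {..i' + int (length b)} (cat i' x b) y" for y by metis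
  then show ?thesis unfolding agree_cat_iff by (auto simp only: fiber_cyl_iff set_eq_iff)
qed

lemma fiber_cyl_Nil: "fiber_cyl X i x [] = fiber X i x"
  by (simp add: fiber_cyl_def)

lemma ennreal_divide_mult_cancel:
  fixes l e c :: ennreal
  assumes "0 < l" "l < \<infinity>" "1 / l * e = c" shows "e = l * c"
proof -
  obtain r where r: "l = ennreal r" "r > 0" using assms(1,2) by (cases l) auto
  then have "1 / l = ennreal (1 / r)" using divide_ennreal[of 1 r] by simp
  then have "l * (1 / l) = 1" using r by (simp flip: ennreal_mult)
  then show ?thesis using assms(3) by (metis mult.assoc mult_1)
qed

lemma fiber_subset_union: "fiber X i x \<subseteq> fiber_union X x"
proof -
  have "fiber X i x \<subseteq> fiber X (- int (nat (- i))) x" by (rule fiber_antimono) simp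
  then show ?thesis unfolding fiber_union_def by blast
qed

context g_system
begin

lemma word_prob_split:
  assumes "i \<le> i'"
  shows "word_prob D g i x (map x [i + 1..i'] @ b) = word_prob D g i x (map x [i + 1..i']) * word_prob D g i' x b"
proof -
  let ?a = "map x [i + 1..i']"
  have len: "i + int (length ?a) = i'" using assms by simp
  have "agree {..i + int (length ?a)} (cat i x ?a) x"
    unfolding agree_cat_iff by (simp only: len agree_refl simp_thms)
  then have "agree {..i'} (cat i x ?a) x" by (simp only: len)
  then show ?thesis unfolding word_prob_append len using word_prob_agree by metis
qed

lemma word_prob_point': "x \<in> E_set X D g \<Longrightarrow> word_prob D g i x (map x [i + 1..i']) > 0"
  using word_prob_point[of x i "nat (i' - i)"] by (cases "i \<le> i'") auto

text \<open>Conditioning on the smaller fiber: the normalised restriction satisfies the law of that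
  fiber, so uniqueness identifies it. Positivity of \<open>g\<close> along \<open>x\<close> in
  \<open>E(g)\<close> permits the normalisation.\<close>

lemma fiber_measure_consistent:
  assumes x: "x \<in> E_set X D g" and i: "i \<le> i'" and A: "A \<subseteq> fiber X i' x" "A \<in> sets borel"
  shows "emeasure (fiber_measure X g i (restrict x {..i})) A =
    ennreal (word_prob D g i x (map x [i + 1..i'])) * emeasure (fiber_measure X g i' (restrict x {..i'})) A"
proof -
  let ?\<nu> = "fiber_measure X g i (restrict x {..i})" and ?F = "fiber X i' x"
  define c where "c = word_prob D g i x (map x [i + 1..i'])"
  have c: "c > 0" unfolding c_def by (rule word_prob_point'[OF x])
  note law = fiber_law_fiber_measure[OF x, of i, unfolded fiber_law_def]
  note sI = sets_fiberI[OF law[THEN conjunct1]]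
  define \<rho> where "\<rho> = scale_measure (ennreal (1 / c)) (restrict_space ?\<nu> ?F)"
  have F: "?F \<inter> space ?\<nu> \<in> sets ?\<nu>"
    using fiber_antimono[OF i] by (simp add: sI Int_absorb2)
  have em: "emeasure \<rho> B = ennreal (1 / c) * emeasure ?\<nu> B" if "B \<subseteq> ?F" for B
    using emeasure_restrict_space[OF F that] by (simp add: \<rho>_def)
  have cyl: "emeasure \<rho> (fiber_cyl X i' x b) = ennreal (word_prob D g i' x b)" for b
  proof -
    have "emeasure \<rho> (fiber_cyl X i' x b) = ennreal (1 / c) * emeasure ?\<nu> (fiber_cyl X i' x b)"
      by (rule em) (auto simp: fiber_cyl_def)
    also have "emeasure ?\<nu> (fiber_cyl X i' x b) = ennreal (c * word_prob D g i' x b)"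
      unfolding fiber_cyl_eq_append[OF i] c_def word_prob_split[OF i, symmetric] using law by blast
    also have "ennreal (1 / c) * \<dots> = ennreal (word_prob D g i' x b)"
      using c word_prob_range by (simp flip: ennreal_mult)
    finally show ?thesis .
  qed
  have "fiber_law i' x \<rho>"
    unfolding fiber_law_def
  proof (intro conjI allI cyl)
    have "sets \<rho> = sets (restrict_space (restrict_space borel (fiber X i x)) ?F)"
      unfolding \<rho>_def sets_scale_measure by (rule sets_restrict_space_cong) (use law in blast)
    then show "sets \<rho> = sets (restrict_space borel ?F)"
      using fiber_antimono[OF i, of X x] by (simp add: sets_restrict_restrict_space Int_absorb1)
    have "space \<rho> = ?F" using fiber_antimono[OF i, of X x] by (auto simp: \<rho>_def space_restrict_space space_scale_measure sI)
    then show "prob_space \<rho>"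
      using cyl[of "[]"] by (intro prob_spaceI) (simp add: fiber_cyl_Nil)
  qed
  then have "\<rho> = fiber_measure X g i' (restrict x {..i'})"
    using fiber_law_unique fiber_law_fiber_measure[OF x] by blast
  moreover have "ennreal c * emeasure \<rho> A = emeasure ?\<nu> A"
    using c unfolding em[OF A(1)] by (simp flip: mult.assoc ennreal_mult)
  ultimately show ?thesis by (simp add: c_def)
qed

text \<open>The fiber measures are rescaled so that the fiber at time 0 gets mass 1. By consistency
  they then agree on common fibers, and their increasing limit is countably additive because the
  supremum commutes with the sum.\<close>

lemma lambda_exists:
  assumes x: "x \<in> E_set X D g"
  shows "\<exists>L. is_lambda X g x L"
proof -
  let ?\<nu> = "\<lambda>i. fiber_measure X g i (restrict x {..i})" and ?F = "\<lambda>i. fiber X i x"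
  have law: "fiber_law i x (?\<nu> i)" for i by (rule fiber_law_fiber_measure[OF x])
  have sets\<nu>: "sets (?\<nu> i) = sets (restrict_space borel (?F i))" for i
    using law[of i] by (simp add: fiber_law_def)
  note sI = sets_fiberI[OF sets\<nu>]
  define p where "p i i' = word_prob D g i x (map x [i + 1..i'])" for i i'
  have p: "p i i' > 0" for i i' unfolding p_def by (rule word_prob_point'[OF x])
  have p_mult: "p i i'' = p i i' * p i' i''" if "i \<le> i'" "i' \<le> i''" for i i' i''
  proof -
    have "[i + 1..i''] = [i + 1..i'] @ [i' + 1..i'']" using that upto_split2[of "i + 1" i' i''] by (cases "i = i'") auto
    then show ?thesis unfolding p_def using word_prob_split[OF that(1)] by simp
  qed
  define w where "w k A = ennreal (1 / p (- int k) 0) * emeasure (?\<nu> (- int k)) (A \<inter> ?F (- int k))" for k A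
  have w_const: "w k' A = w k A" if "k \<le> k'" "A \<subseteq> ?F (- int k)" "A \<in> sets borel" for k k' A
  proof -
    have le: "- int k' \<le> - int k" using that by simp
    have A: "A \<inter> ?F (- int k') = A" "A \<inter> ?F (- int k) = A"
      using fiber_antimono[OF le, of X x] that(2) by auto
    have "1 / p (- int k') 0 * p (- int k') (- int k) = 1 / p (- int k) 0"
      using p_mult[OF le, of 0] p[of "- int k'" "- int k"] p[of "- int k" 0] by simp
    then have "ennreal (1 / p (- int k') 0) * ennreal (p (- int k') (- int k)) = ennreal (1 / p (- int k) 0)"
      using p by (metis ennreal_mult less_imp_le divide_nonneg_pos zero_le_one)
    then show ?thesis
      unfolding w_def A fiber_measure_consistent[OF x le that(2,3)] p_def[symmetric]
      by (simp flip: mult.assoc)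
  qed
  have w_mono: "w k A \<le> w k' A" if "k \<le> k'" "A \<in> sets borel" for k k' A
  proof -
    have B: "A \<inter> ?F (- int k) \<in> sets borel" using that by simp
    have "w k A = w k (A \<inter> ?F (- int k))" by (simp add: w_def Int_assoc)
    also have "\<dots> = w k' (A \<inter> ?F (- int k))" using w_const[OF that(1) _ B] by simp
    also have "\<dots> \<le> w k' A"
      unfolding w_def using that by (intro mult_left_mono emeasure_mono) (auto simp: sI)
    finally show ?thesis .
  qed
  define N where "N = measure_of UNIV (sets (borel :: (int \<Rightarrow> 'a) measure)) (\<lambda>A. SUP k. w k A)"
  have sets_N: "sets N = sets borel"
    unfolding N_def using sets.sigma_sets_eq[of "borel :: (int \<Rightarrow> 'a) measure"] by (simp add: sets_measure_of)
  have em_N: "emeasure N A = (SUP k. w k A)" if "A \<in> sets borel" for A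
    unfolding N_def
  proof (rule emeasure_measure_of_sigma[OF _ _ _ that])
    show "sigma_algebra UNIV (sets (borel :: (int \<Rightarrow> 'a) measure))"
      using sets.sigma_algebra_axioms[of "borel :: (int \<Rightarrow> 'a) measure"] by simp
    show "positive (sets borel) (\<lambda>A. SUP k. w k A)"
      by (simp add: positive_def w_def)
    show "countably_additive (sets borel) (\<lambda>A. SUP k. w k A)"
    proof (rule countably_additiveI)
      fix A :: "nat \<Rightarrow> (int \<Rightarrow> 'a) set"
      assume A: "range A \<subseteq> sets borel" "disjoint_family A" "\<Union> (range A) \<in> sets borel"
      have eq: "(\<Sum>n. w k (A n)) = w k (\<Union> (range A))" for k
      proof -
        have "(\<Sum>n. emeasure (?\<nu> (- int k)) (A n \<inter> ?F (- int k))) =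
            emeasure (?\<nu> (- int k)) (\<Union>n. A n \<inter> ?F (- int k))"
        proof (rule suminf_emeasure)
          show "range (\<lambda>n. A n \<inter> ?F (- int k)) \<subseteq> sets (?\<nu> (- int k))" using A(1) unfolding subset_iff sI by auto
          show "disjoint_family (\<lambda>n. A n \<inter> ?F (- int k))" using A(2) by (rule disjoint_family_on_bisimulation) auto
        qed
        moreover have "(\<Union>n. A n \<inter> ?F (- int k)) = \<Union> (range A) \<inter> ?F (- int k)" by blast
        ultimately show ?thesis unfolding w_def ennreal_suminf_cmult by simp
      qed
      have "(\<Sum>n. SUP k. w k (A n)) = (SUP k. \<Sum>n. w k (A n))"
      proof (rule ennreal_suminf_SUP_eq)
        fix n have "A n \<in> sets borel" using A(1) by blast
        then show "incseq (\<lambda>k. w k (A n))" unfolding incseq_def using w_mono by blast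
      qed
      also have "\<dots> = (SUP k. w k (\<Union> (range A)))" by (simp add: eq)
      finally show "(\<Sum>n. SUP k. w k (A n)) = (SUP k. w k (\<Union> (range A)))" .
    qed
  qed
  \<comment> \<open>The mass of the fiber at time \<open>i\<close>; \<open>nat (- i)\<close> selects
    a fiber of the exhausting sequence that contains it.\<close>
  define r where "r i = p (- int (nat (- i))) i / p (- int (nat (- i))) 0" for i
  have r: "r i > 0" for i unfolding r_def using p by simp
  have N_fiber: "emeasure N A = ennreal (r i) * emeasure (?\<nu> i) A" if A: "A \<subseteq> ?F i" "A \<in> sets borel" for A i
  proof -
    define k where "k = nat (- i)"
    have le: "- int k \<le> i" by (simp add: k_def)
    have Ak: "A \<subseteq> ?F (- int k)" using fiber_antimono[OF le, of X x] A by blast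
    have "(SUP k. w k A) = w k A"
    proof (rule antisym)
      show "(SUP k. w k A) \<le> w k A"
      proof (rule SUP_least)
        fix k' show "w k' A \<le> w k A"
          using w_const[OF _ Ak A(2), of k'] w_mono[of k' k A] A(2) by (cases "k \<le> k'") auto
      qed
    qed (rule SUP_upper, simp)
    also have "\<dots> = ennreal (1 / p (- int k) 0) * emeasure (?\<nu> (- int k)) A"
      unfolding w_def using Ak by (simp add: Int_absorb2)
    also have "\<dots> = ennreal (1 / p (- int k) 0) * (ennreal (p (- int k) i) * emeasure (?\<nu> i) A)"
      unfolding fiber_measure_consistent[OF x le A] p_def ..
    also have "\<dots> = ennreal (r i) * emeasure (?\<nu> i) A"
      using p[of "- int k" i] p[of "- int k" 0] by (simp add: r_def k_def flip: mult.assoc ennreal_mult)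
    finally show ?thesis using em_N[OF A(2)] by simp
  qed
  define U where "U = fiber_union X x"
  define L where "L = restrict_space N U"
  have FU: "?F i \<subseteq> U" for i
    unfolding U_def by (rule fiber_subset_union)
  have U: "U \<in> sets borel" unfolding U_def fiber_union_def by (intro sets.countable_UN') auto
  have spN: "space N = UNIV" using sets_eq_imp_space_eq[OF sets_N] by simp
  have UN: "U \<inter> space N \<in> sets N" using U by (simp add: spN sets_N)
  have spL: "space L = U" by (simp add: L_def space_restrict_space spN)
  have sets_L: "A \<in> sets L \<longleftrightarrow> A \<subseteq> U \<and> A \<in> sets borel" for A
    unfolding L_def sets_restrict_space_iff[OF UN] sets_N ..
  have em_L: "emeasure L A = ennreal (r i) * emeasure (?\<nu> i) A" if "A \<subseteq> ?F i" "A \<in> sets borel" for A i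
    unfolding L_def using emeasure_restrict_space[OF UN, of A] that FU[of i] N_fiber[OF that] by simp
  have \<nu>1: "emeasure (?\<nu> i) (?F i) = 1" for i
    using law[of i] prob_space.emeasure_space_1 by (auto simp: fiber_law_def simp flip: sI(2))
  have L_F: "emeasure L (?F i) = ennreal (r i)" for i
    using em_L[of "?F i" i] \<nu>1 by simp
  have "is_lambda X g x L"
    unfolding is_lambda_def
  proof (intro conjI allI)
    show "sets L = sets (restrict_space borel (fiber_union X x))"
      unfolding L_def U_def by (rule sets_restrict_space_cong[OF sets_N])
    show "sigma_finite_measure L"
    proof (rule sigma_finite_measure.intro, intro exI conjI ballI)
      let ?A = "range (\<lambda>k::nat. ?F (- int k))"
      show "countable ?A" by simp
      show "?A \<subseteq> sets L" using FU by (auto simp: sets_L)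
      show "\<Union> ?A = space L" by (simp add: spL U_def fiber_union_def)
      fix a assume "a \<in> ?A" then show "emeasure L a \<noteq> \<infinity>" by (auto simp: L_F)
    qed
    fix i
    show "0 < emeasure L (?F i)" "emeasure L (?F i) < \<infinity>" using r by (simp_all add: L_F)
    have FL: "?F i \<inter> space L \<in> sets L" using FU[of i] by (simp add: spL sets_L Int_absorb2)
    show "scale_measure (1 / emeasure L (?F i)) (restrict_space L (?F i)) = ?\<nu> i"
    proof (rule measure_eqI)
      have "A \<in> sets (restrict_space L (?F i)) \<longleftrightarrow> A \<in> sets (?\<nu> i)" for A
        unfolding sets_restrict_space_iff[OF FL] sI sets_L using FU[of i] by auto
      then show "sets (scale_measure (1 / emeasure L (?F i)) (restrict_space L (?F i))) = sets (?\<nu> i)" by auto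
      fix A assume "A \<in> sets (scale_measure (1 / emeasure L (?F i)) (restrict_space L (?F i)))"
      then have A: "A \<subseteq> ?F i" "A \<in> sets borel" by (auto simp: sets_restrict_space_iff[OF FL] sets_L)
      have "1 / emeasure L (?F i) = ennreal (1 / r i)"
        unfolding L_F using r[of i] divide_ennreal[of 1 "r i"] by simp
      then show "emeasure (scale_measure (1 / emeasure L (?F i)) (restrict_space L (?F i))) A = emeasure (?\<nu> i) A"
        using emeasure_restrict_space[OF FL A(1)] em_L[OF A] r[of i]
        by (simp flip: mult.assoc ennreal_mult)
    qed
  qed
  then show ?thesis by blast
qed

lemma lambda_measure: "x \<in> E_set X D g \<Longrightarrow> is_lambda X g x (lambda_measure X g x)"
  unfolding lambda_measure_def by (rule someI_ex) (rule lambda_exists)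

lemma is_lambda_sets:
  assumes "is_lambda X g x L"
  shows "A \<in> sets L \<longleftrightarrow> A \<subseteq> fiber_union X x \<and> A \<in> sets borel" "space L = fiber_union X x"
    "sets L = sets (restrict_space borel (fiber_union X x))"
proof -
  show *: "sets L = sets (restrict_space borel (fiber_union X x))" using assms by (simp add: is_lambda_def)
  have "fiber_union X x \<in> sets borel" unfolding fiber_union_def by (intro sets.countable_UN') auto
  then show "A \<in> sets L \<longleftrightarrow> A \<subseteq> fiber_union X x \<and> A \<in> sets borel" "space L = fiber_union X x"
    using sets_eq_imp_space_eq[OF *] by (auto simp: * sets_restrict_space_iff space_restrict_space)
qed

lemma is_lambda_cyl:
  assumes x: "x \<in> E_set X D g" and L: "is_lambda X g x L"
  shows "emeasure L (fiber_cyl X i x a) = emeasure L (fiber X i x) * ennreal (word_prob D g i x a)"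
proof -
  let ?F = "fiber X i x"
  have FL: "?F \<inter> space L \<in> sets L"
    using fiber_subset_union[of X i x] by (simp add: is_lambda_sets(1,2)[OF L] Int_absorb2)
  have "emeasure (fiber_measure X g i (restrict x {..i})) (fiber_cyl X i x a) = ennreal (word_prob D g i x a)"
    using fiber_law_fiber_measure[OF x, of i] by (simp add: fiber_law_def)
  moreover have "fiber_measure X g i (restrict x {..i}) = scale_measure (1 / emeasure L ?F) (restrict_space L ?F)"
    using L by (simp add: is_lambda_def)
  moreover have "fiber_cyl X i x a \<subseteq> ?F" by (auto simp: fiber_cyl_def)
  ultimately have "1 / emeasure L ?F * emeasure L (fiber_cyl X i x a) = ennreal (word_prob D g i x a)"
    using emeasure_restrict_space[OF FL] by simp
  moreover have "0 < emeasure L ?F" "emeasure L ?F < \<infinity>" using L by (auto simp: is_lambda_def)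
  ultimately show ?thesis by (rule ennreal_divide_mult_cancel[rotated 2])
qed

end

section \<open>Conditional probabilities under a \<open>g\<close>-measure\<close>

lemma shiftby_measurable [measurable]:
  "shiftby k \<in> measurable borel (borel :: (int \<Rightarrow> 'a::{finite,discrete_topology}) measure)"
  by (intro borel_measurable_continuous_onI continuous_on_shiftby)

lemma past_measurable [measurable]:
  "past i \<in> measurable borel (borel :: (int \<Rightarrow> 'a::{finite,discrete_topology}) measure)"
  unfolding past_def
  by (intro borel_measurable_continuous_onI continuous_on_compose2[OF continuous_on_restrict_seq]
      continuous_on_shiftby) auto

lemma cat_measurable [measurable]:
  "(\<lambda>x. cat i x a) \<in> measurable borel (borel :: (int \<Rightarrow> 'a::{finite,discrete_topology}) measure)"
  by (intro borel_measurable_continuous_onI continuous_on_cat)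

lemma map_eq_borel [measurable]:
  "{x::int \<Rightarrow> 'a::{finite,discrete_topology}. map x [a..b] = w} \<in> sets borel"
proof (cases "\<exists>v. w = map v [a..b]")
  case True
  then obtain v where v: "w = map v [a..b]" by blast
  have "{x. map x [a..b] = w} = {x. agree {a..b} v x}"
    unfolding v map_eq_iff_agree by (auto intro: agree_sym)
  then show ?thesis by (simp only:) (intro borel_closed closed_agree)
next
  case False
  then have "{x. map x [a..b] = w} = {}" by auto
  then show ?thesis by simp
qed

lemma eval_eq_borel [measurable]:
  "{x::int \<Rightarrow> 'a::{finite,discrete_topology}. x j = \<alpha>} \<in> sets borel"
  by (intro borel_open open_eval)

text \<open>Stands for measurability with respect to the coordinates up to \<open>i\<close>: an
  integral identity tested against all such functions says that two functions have the same
  conditional expectation given this past.\<close>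

definition past_fun :: "int \<Rightarrow> ((int \<Rightarrow> 'a::{finite,discrete_topology}) \<Rightarrow> ennreal) \<Rightarrow> bool" where
  "past_fun i u \<longleftrightarrow> u \<in> borel_measurable borel \<and> (\<forall>x y. agree {..i} x y \<longrightarrow> u x = u y)"

lemma past_funI:
  "u \<in> borel_measurable borel \<Longrightarrow> (\<And>x y. agree {..i} x y \<Longrightarrow> u x = u y) \<Longrightarrow> past_fun i u"
  by (simp add: past_fun_def)

lemma past_fun_mult: "past_fun i u \<Longrightarrow> past_fun i v \<Longrightarrow> past_fun i (\<lambda>x. u x * v x)"
  by (auto simp: past_fun_def)

context g_system
begin

lemma g0_measurable [measurable]: "(\<lambda>x. g0 D g i x \<alpha>) \<in> borel_measurable borel"
proof -
  have "(\<lambda>d. indicator D d *\<^sub>R g d \<alpha>) \<in> borel_measurable borel"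
    by (rule borel_measurable_continuous_on_indicator[OF D_borel g_continuous_on])
  from measurable_compose[OF past_measurable[of i] this] show ?thesis
    by (rule measurable_cong[THEN iffD1, rotated]) (simp add: g0_def)
qed

lemma word_prob_measurable [measurable]: "(\<lambda>x. word_prob D g i x a) \<in> borel_measurable borel"
  unfolding word_prob_def
  by (intro borel_measurable_prod measurable_compose[OF cat_measurable g0_measurable])

lemma word_prob_tendsto:
  assumes x: "\<And>a. word_prob D g i x a \<noteq> 0 \<Longrightarrow> past (i + int (length a)) (cat i x a) \<in> D"
    and z: "\<forall>\<^sub>F t in F. z t \<in> E_set X D g" "\<And>j. j \<le> i \<Longrightarrow> \<forall>\<^sub>F t in F. z t j = x j"
  shows "((\<lambda>t. word_prob D g i (z t) a) \<longlongrightarrow> word_prob D g i x a) F"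
proof (induction a rule: rev_induct)
  case (snoc \<alpha> b)
  let ?k = "i + int (length b)"
  show ?case
  proof (cases "word_prob D g i x b = 0")
    case True
    have "((\<lambda>t. word_prob D g i (z t) (b @ [\<alpha>])) \<longlongrightarrow> 0) F"
    proof (rule tendsto_sandwich[where f = "\<lambda>_. 0" and h = "\<lambda>t. word_prob D g i (z t) b"])
      show "\<forall>\<^sub>F t in F. word_prob D g i (z t) (b @ [\<alpha>]) \<le> word_prob D g i (z t) b"
        by (intro always_eventually allI)
          (auto simp: word_prob_snoc intro!: mult_left_le g0_range word_prob_range)
      show "((\<lambda>t. word_prob D g i (z t) b) \<longlongrightarrow> 0) F" using snoc.IH True by simp
    qed (auto simp: word_prob_range)
    then show ?thesis using True by (simp add: word_prob_snoc)
  next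
    case False
    then have "word_prob D g i x b > 0" using word_prob_range(1)[of i x b] by simp
    then have "\<forall>\<^sub>F t in F. word_prob D g i (z t) b > 0"
      using snoc.IH by (rule order_tendstoD(1)[rotated])
    \<comment> \<open>Positive probability makes \<open>b\<close> follow the past of
      \<open>z t\<close>, and \<open>z t\<close> is in \<open>E(g)\<close>, so the approximating
      pasts lie in \<open>D\<close>, as \<open>g0_tendsto\<close> demands.\<close>
    with z(1) have D: "\<forall>\<^sub>F t in F. past ?k (cat i (z t) b) \<in> D"
    proof eventually_elim
      case (elim t)
      then show ?case using E_cat_D[OF elim(1) word_prob_pos_ex] E_X[OF elim(1)] by simp
    qed
    have "((\<lambda>t. g0 D g ?k (cat i (z t) b) \<alpha>) \<longlongrightarrow> g0 D g ?k (cat i x b) \<alpha>) F"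
    proof (rule g0_tendsto[OF _ x[OF False] D])
      fix j
      show "\<forall>\<^sub>F t in F. cat i (z t) b j = cat i x b j"
        using z(2)[of j] by (cases "j \<le> i") (auto simp: cat_def elim: eventually_mono)
    qed
    then show ?thesis unfolding word_prob_snoc by (intro tendsto_mult snoc.IH)
  qed
qed simp

section \<open>The defining equation of a g-measure in integral form\<close>

text \<open>The integrands are bounded and nonnegative, so the real equation is equivalent to one
  between nonnegative integrals. The restriction to \<open>D\<close> is absorbed by
  \<open>g0\<close> on the right and by the almost sure hypothesis on the left.\<close>

lemma g_measure_formula_iff:
  assumes sets: "sets \<mu> = sets (restrict_space borel X)" and prob: "prob_space \<mu>"
    and ae: "AE x in \<mu>. past 0 x \<in> D"
  shows "measure \<mu> {x\<in>X. restrict x {..0} \<in> D \<and> map x [- int k..1] = w @ [\<alpha>]} =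
      (LINT x:{x\<in>X. restrict x {..0} \<in> D \<and> map x [- int k..0] = w}|\<mu>. g (restrict x {..0}) \<alpha>)
    \<longleftrightarrow> (\<integral>\<^sup>+x. indicator {x. map x [- int k..0] = w} x * indicator {x. x 1 = \<alpha>} x \<partial>\<mu>) =
      (\<integral>\<^sup>+x. indicator {x. map x [- int k..0] = w} x * ennreal (g0 D g 0 x \<alpha>) \<partial>\<mu>)"
    (is "?m = ?l \<longleftrightarrow> ?n1 = ?n2")
proof -
  interpret prob_space \<mu> by (rule prob)
  have Xb: "X \<in> sets borel" using closed_X by (rule borel_closed)
  have sp: "space \<mu> = X" using sets_eq_imp_space_eq[OF sets] Xb by (simp add: space_restrict_space)
  have setsI: "A \<in> sets \<mu> \<longleftrightarrow> A \<subseteq> X \<and> A \<in> sets borel" for A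
    using Xb by (auto simp: sets sets_restrict_space_iff)
  have meas: "f \<in> borel_measurable \<mu>" if "f \<in> borel_measurable borel" for f :: "(int \<Rightarrow> 'a) \<Rightarrow> real"
    using measurable_restrict_space1[OF that] measurable_cong_sets[OF sets refl] by blast
  have up: "map x [- int k..1] = map x [- int k..0] @ [x 1]" for x :: "int \<Rightarrow> 'a"
    by (simp add: upto_rec2)
  let ?S = "{x\<in>X. restrict x {..0} \<in> D \<and> map x [- int k..1] = w @ [\<alpha>]}"
  have pastD: "{x. past 0 x \<in> D} \<in> sets borel"
    using measurable_sets[OF past_measurable D_borel, of 0] by (simp add: vimage_def)
  have "?S = X \<inter> ({x. past 0 x \<in> D} \<inter> {x. map x [- int k..1] = w @ [\<alpha>]})"
    by (auto simp: past_0)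
  then have S: "?S \<in> sets \<mu>"
    unfolding setsI using Xb pastD map_eq_borel[of "- int k" 1 "w @ [\<alpha>]"] by (auto intro!: sets.Int)
  have "ennreal ?m = (\<integral>\<^sup>+x. indicator ?S x \<partial>\<mu>)"
    using S by (simp add: emeasure_eq_measure)
  also have "\<dots> = ?n1"
    using ae AE_space by (intro nn_integral_cong_AE, eventually_elim)
      (auto simp: up past_0 sp indicator_def split: if_splits)
  finally have m: "ennreal ?m = ?n1" .
  let ?h = "\<lambda>x. indicator {x. map x [- int k..0] = w} x * g0 D g 0 x \<alpha>"
  have h: "?h \<in> borel_measurable \<mu>"
    by (intro meas borel_measurable_times borel_measurable_indicator map_eq_borel g0_measurable)
  have "?l = (\<integral>x. ?h x \<partial>\<mu>)"
    unfolding set_lebesgue_integral_def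
    by (intro Bochner_Integration.integral_cong refl)
      (auto simp: sp g0_def past_0 indicator_def)
  moreover have "integrable \<mu> ?h"
    by (rule integrable_const_bound[of _ 1])
      (use h g0_range in \<open>auto simp: indicator_def\<close>)
  then have "ennreal (\<integral>x. ?h x \<partial>\<mu>) = (\<integral>\<^sup>+x. ennreal (?h x) \<partial>\<mu>)"
    by (intro nn_integral_eq_integral[symmetric]) (auto simp: g0_range)
  moreover have "(\<integral>\<^sup>+x. ennreal (?h x) \<partial>\<mu>) = ?n2"
    by (intro nn_integral_cong) (auto simp: indicator_def)
  moreover have "0 \<le> (\<integral>x. ?h x \<partial>\<mu>)" by (rule integral_nonneg_AE) (auto simp: g0_range)
  ultimately have l: "ennreal ?l = ?n2" "0 \<le> ?l" by simp_all
  show ?thesis unfolding m[symmetric] l(1)[symmetric] using l(2) by (simp add: ennreal_inj)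
qed

text \<open>The equation extends to all words and letters: if \<open>w\<close> followed by \<alpha>
  is not admissible, both integrands vanish on \<open>X\<close>, since a nonzero value of
  \<open>g0\<close> would produce a point carrying that word.\<close>

lemma g_measure_iff:
  "g_measure X D g \<mu> \<longleftrightarrow> sets \<mu> = sets (restrict_space borel X) \<and> prob_space \<mu> \<and>
     distr \<mu> \<mu> shift = \<mu> \<and> (AE x in \<mu>. past 0 x \<in> D) \<and>
     (\<forall>k::nat. \<forall>w \<alpha>. (\<integral>\<^sup>+x. indicator {x. map x [- int k..0] = w} x * indicator {x. x 1 = \<alpha>} x \<partial>\<mu>) =
      (\<integral>\<^sup>+x. indicator {x. map x [- int k..0] = w} x * ennreal (g0 D g 0 x \<alpha>) \<partial>\<mu>))"
proof -
  have Xb: "X \<in> sets borel" using closed_X by (rule borel_closed)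
  have pastD: "{x. past 0 x \<in> D} \<in> sets borel"
    using measurable_sets[OF past_measurable D_borel, of 0] by (simp add: vimage_def)
  have ae: "measure \<mu> {x\<in>X. restrict x {..0} \<in> D} = 1 \<longleftrightarrow> (AE x in \<mu>. past 0 x \<in> D)"
    if sets: "sets \<mu> = sets (restrict_space borel X)" and prob: "prob_space \<mu>"
  proof -
    have sp: "space \<mu> = X" using sets_eq_imp_space_eq[OF sets] Xb by (simp add: space_restrict_space)
    have "{x\<in>X. restrict x {..0} \<in> D} = X \<inter> {x. past 0 x \<in> D}" by (auto simp: past_0)
    then have "{x\<in>X. restrict x {..0} \<in> D} \<in> sets \<mu>"
      using Xb pastD by (auto simp: sets sets_restrict_space_iff intro!: sets.Int)
    then have "measure \<mu> {x\<in>X. restrict x {..0} \<in> D} = 1 \<longleftrightarrow> (AE x in \<mu>. x \<in> {x\<in>X. restrict x {..0} \<in> D})"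
      by (rule prob_space.prob_eq_1[OF prob])
    also have "\<dots> \<longleftrightarrow> (AE x in \<mu>. past 0 x \<in> D)"
      by (intro AE_cong) (auto simp: sp past_0)
    finally show ?thesis .
  qed
  have trivial: "(\<integral>\<^sup>+x. indicator {x. map x [- int k..0] = w} x * indicator {x. x 1 = \<alpha>} x \<partial>\<mu>) =
      (\<integral>\<^sup>+x. indicator {x. map x [- int k..0] = w} x * ennreal (g0 D g 0 x \<alpha>) \<partial>\<mu>)"
    if sets: "sets \<mu> = sets (restrict_space borel X)" and
      no: "\<not> (w \<in> (\<lambda>x. map x [- int k..0]) ` X \<and> [\<alpha>] \<in> word_followers X 1 w)" for k w \<alpha>
  proof -
    have sp: "space \<mu> = X" using sets_eq_imp_space_eq[OF sets] Xb by (simp add: space_restrict_space)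
    have none: False if z: "z \<in> X" "map z [- int k..0] = w" "z 1 = \<alpha>" for z
    proof -
      have "map z [- int k - 1 + 1..- int k - 1 + int (length (w @ [\<alpha>]))] = w @ [\<alpha>]"
        using z(2,3) by (auto simp: upto_rec2)
      then have "admissible X (w @ [\<alpha>])" unfolding admissible_def using z(1) by blast
      then show False using no z by (auto simp: word_followers_def)
    qed
    have 1: "indicator {x. map x [- int k..0] = w} x * indicator {x. x 1 = \<alpha>} x = (0::ennreal)" if "x \<in> X" for x
      using none[OF that] by (auto simp: indicator_def)
    have 2: "indicator {x. map x [- int k..0] = w} x * ennreal (g0 D g 0 x \<alpha>) = 0" if x: "x \<in> X" for x
    proof (cases "map x [- int k..0] = w \<and> g0 D g 0 x \<alpha> \<noteq> 0")
      case True
      then obtain z where z: "z \<in> X" "agree {..0} x z" "z (0 + 1) = \<alpha>" using g0_pos_ex by metis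
      have "agree {- int k..0} z x" using z(2) by (auto simp: agree_def)
      then have "map z [- int k..0] = w" using True map_eq_iff_agree by metis
      then show ?thesis using none[OF z(1)] z(3) by simp
    qed auto
    show ?thesis using 1 2 by (intro nn_integral_cong) (metis sp)
  qed
  show ?thesis
    unfolding g_measure_def
    using ae[of] g_measure_formula_iff[of \<mu>] trivial by meson
qed

end

locale g_measure_system = g_system X D g
  for X :: "(int \<Rightarrow> 'a::{finite,discrete_topology}) set" and D g +
  fixes \<mu> :: "(int \<Rightarrow> 'a) measure"
  assumes g_meas: "g_measure X D g \<mu>"
begin

lemma sets_mu: "sets \<mu> = sets (restrict_space borel X)"
  using g_meas by (simp add: g_measure_def)

sublocale prob_space \<mu>
  using g_meas by (simp add: g_measure_def)

lemma X_borel: "X \<in> sets borel" using closed_X by (rule borel_closed)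

lemma space_mu: "space \<mu> = X"
  using sets_eq_imp_space_eq[OF sets_mu] X_borel by (simp add: space_restrict_space)

lemma measurable_muI: "f \<in> measurable borel N \<Longrightarrow> f \<in> measurable \<mu> N"
  using measurable_restrict_space1[of f borel N X] measurable_cong_sets[OF sets_mu refl] by blast

lemma shift_invariant:
  assumes u: "u \<in> borel_measurable borel"
  shows "(\<integral>\<^sup>+x. u (shiftby k x) \<partial>\<mu>) = (\<integral>\<^sup>+x. u x \<partial>\<mu>)"
proof -
  have one: "(\<integral>\<^sup>+x. u (shift x) \<partial>\<mu>) = (\<integral>\<^sup>+x. u x \<partial>\<mu>)" if u: "u \<in> borel_measurable borel" for u
  proof -
    have "shift \<in> measurable \<mu> (restrict_space borel X)"
      unfolding shift_def
      by (rule measurable_restrict_space2[OF _ measurable_muI[OF shiftby_measurable]]) (simp add: space_mu)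
    then have sh: "shift \<in> measurable \<mu> \<mu>" using measurable_cong_sets[OF refl sets_mu] by blast
    have "(\<integral>\<^sup>+x. u x \<partial>\<mu>) = (\<integral>\<^sup>+x. u x \<partial>distr \<mu> \<mu> shift)"
      using g_meas by (simp add: g_measure_def)
    also have "\<dots> = (\<integral>\<^sup>+x. u (shift x) \<partial>\<mu>)"
      by (rule nn_integral_distr[OF sh]) (simp add: measurable_muI[OF u])
    finally show ?thesis ..
  qed
  have pos: "(\<integral>\<^sup>+x. u (shiftby (int n) x) \<partial>\<mu>) = (\<integral>\<^sup>+x. u x \<partial>\<mu>)" if u: "u \<in> borel_measurable borel" for u n
    using u
  proof (induction n arbitrary: u)
    case (Suc n)
    have "(\<lambda>x. u (shiftby (int n) x)) \<in> borel_measurable borel"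
      using measurable_compose[OF shiftby_measurable Suc.prems] .
    from one[OF this] Suc.IH[OF Suc.prems] show ?case by (simp add: shift_def add.commute)
  qed simp
  show ?thesis
  proof (cases "k \<ge> 0")
    case True
    then show ?thesis using pos[OF u, of "nat k"] by simp
  next
    case False
    have "(\<lambda>x. u (shiftby k x)) \<in> borel_measurable borel"
      using measurable_compose[OF shiftby_measurable u] .
    from pos[OF this, of "nat (- k)"] False show ?thesis by simp
  qed
qed

lemma AE_past_D: "AE x in \<mu>. past i x \<in> D"
proof -
  have pastD: "{x. past i x \<notin> D} \<in> sets borel" for i
    using measurable_sets[OF past_measurable, of "- D" i] by (simp add: vimage_def)
  have m: "(\<lambda>x. indicator {x. past i x \<notin> D} x :: ennreal) \<in> borel_measurable borel" for i
    using pastD by (rule borel_measurable_indicator)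
  have "AE x in \<mu>. past 0 x \<in> D" using g_meas by (simp add: g_measure_iff)
  then have "(\<integral>\<^sup>+x. indicator {x. past 0 x \<notin> D} x \<partial>\<mu>) = 0"
    by (subst nn_integral_0_iff_AE[OF measurable_muI[OF m]]) (auto simp: indicator_def)
  moreover have "(\<integral>\<^sup>+x. indicator {x. past i x \<notin> D} x \<partial>\<mu>) = (\<integral>\<^sup>+x. indicator {x. past 0 x \<notin> D} (shiftby i x) \<partial>\<mu>)"
    by (simp add: indicator_def)
  ultimately have "(\<integral>\<^sup>+x. indicator {x. past i x \<notin> D} x \<partial>\<mu>) = 0"
    unfolding shift_invariant[OF m] by simp
  then show ?thesis
    by (subst (asm) nn_integral_0_iff_AE[OF measurable_muI[OF m]]) (auto simp: indicator_def elim: eventually_mono split: if_splits)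
qed

text \<open>The definition tests the letter at 1 against words on \<open>[-k,0]\<close>. Both sides,
  read as finite measures on pasts, agree on cylinders and hence everywhere, which admits all
  functions of the past as tests.\<close>

lemma one_step_0:
  assumes u: "past_fun 0 u"
  shows "(\<integral>\<^sup>+x. u x * indicator {x. x 1 = \<alpha>} x \<partial>\<mu>) = (\<integral>\<^sup>+x. u x * ennreal (g0 D g 0 x \<alpha>) \<partial>\<mu>)"
proof -
  define K where "K h = distr (density \<mu> h) borel (past 0)" for h :: "(int \<Rightarrow> 'a) \<Rightarrow> ennreal"
  have p: "past 0 \<in> borel_measurable (density \<mu> h)" for h
    using measurable_muI[OF past_measurable] by simp
  have nn: "(\<integral>\<^sup>+d. f d \<partial>K h) = (\<integral>\<^sup>+x. f (past 0 x) * h x \<partial>\<mu>)"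
    if h: "h \<in> borel_measurable borel" and f: "f \<in> borel_measurable borel" for h f
  proof -
    have "(\<integral>\<^sup>+d. f d \<partial>K h) = (\<integral>\<^sup>+x. f (past 0 x) \<partial>density \<mu> h)"
      unfolding K_def by (rule nn_integral_distr[OF p]) (use f in simp)
    also have "\<dots> = (\<integral>\<^sup>+x. h x * f (past 0 x) \<partial>\<mu>)"
      by (rule nn_integral_density) (auto intro!: measurable_muI h measurable_compose[OF past_measurable f])
    finally show ?thesis by (simp add: mult.commute)
  qed
  let ?h1 = "\<lambda>x::int \<Rightarrow> 'a. indicator {x. x 1 = \<alpha>} x :: ennreal" and ?h2 = "\<lambda>x. ennreal (g0 D g 0 x \<alpha>)"
  have h1: "?h1 \<in> borel_measurable borel" by (rule borel_measurable_indicator[OF eval_eq_borel])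
  have h2: "?h2 \<in> borel_measurable borel" by measurable
  have "K ?h1 = K ?h2"
  proof (rule measure_eq_if_cylinders[where k = 0])
    have "emeasure (K ?h1) (space (K ?h1)) = (\<integral>\<^sup>+x. ?h1 x \<partial>\<mu>)"
      using nn[OF h1, of "\<lambda>_. 1"] by simp
    also have "\<dots> \<le> (\<integral>\<^sup>+x. 1 \<partial>\<mu>)" by (intro nn_integral_mono) (auto simp: indicator_def)
    also have "\<dots> = 1" by (simp add: emeasure_space_1)
    finally show "finite_measure (K ?h1)" by (intro finite_measureI) (auto simp: top_unique)
    fix n and v :: "int \<Rightarrow> 'a"
    let ?C = "{y. agree {- int n..int n} v y}"
    have C: "?C \<in> sets borel" by (intro borel_closed closed_agree)
    have em: "emeasure (K h) ?C = (\<integral>\<^sup>+x. indicator ?C (past 0 x) * h x \<partial>\<mu>)"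
      if h: "h \<in> borel_measurable borel" for h
      using nn[OF h borel_measurable_indicator[OF C]] C by (simp add: K_def)
    \<comment> \<open>\<open>past 0 x\<close> is \<open>undefined\<close> beyond 0, so a cylinder
      with window \<open>[-n,n]\<close> either misses all pasts or is a condition on
      \<open>[-n,0]\<close> alone.\<close>
    have ind: "indicator ?C (past 0 x) = (if \<forall>j\<in>{1..int n}. v j = undefined
        then indicator {x. map x [- int n..0] = map v [- int n..0]} x else (0::ennreal))" for x
    proof -
      have "agree {- int n..int n} v (past 0 x) \<longleftrightarrow>
          (\<forall>j\<in>{1..int n}. v j = undefined) \<and> agree {- int n..0} x v"
        unfolding agree_def past_0 restrict_def
        by (rule iffI; (intro conjI ballI)?; force)
      then show ?thesis unfolding map_eq_iff_agree by (auto simp: indicator_def)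
    qed
    have "(\<integral>\<^sup>+x. indicator ?C (past 0 x) * ?h1 x \<partial>\<mu>) = (\<integral>\<^sup>+x. indicator ?C (past 0 x) * ?h2 x \<partial>\<mu>)"
    proof (cases "\<forall>j\<in>{1..int n}. v j = undefined")
      case True
      show ?thesis
        using g_meas unfolding ind if_P[OF True] g_measure_iff by blast
    qed (simp only: ind if_False mult_zero_left)
    then show "emeasure (K ?h1) ?C = emeasure (K ?h2) ?C" by (simp only: em[OF h1] em[OF h2])
  qed (simp_all add: K_def)
  moreover have um: "u \<in> borel_measurable borel" using u by (simp add: past_fun_def)
  ultimately have "(\<integral>\<^sup>+x. u (past 0 x) * ?h1 x \<partial>\<mu>) = (\<integral>\<^sup>+x. u (past 0 x) * ?h2 x \<partial>\<mu>)"
    using nn[OF h1 um] nn[OF h2 um] by simp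
  moreover have "u (past 0 x) = u x" for x
  proof -
    have "agree {..0} (past 0 x) x" unfolding past_0 by simp
    then show ?thesis using u by (simp add: past_fun_def)
  qed
  ultimately show ?thesis by simp
qed

lemma one_step:
  assumes u: "past_fun i u"
  shows "(\<integral>\<^sup>+x. u x * indicator {x. x (i + 1) = \<alpha>} x \<partial>\<mu>) = (\<integral>\<^sup>+x. u x * ennreal (g0 D g i x \<alpha>) \<partial>\<mu>)"
proof -
  have um: "u \<in> borel_measurable borel" using u by (simp add: past_fun_def)
  let ?u = "\<lambda>x. u (shiftby (- i) x)"
  have "past_fun 0 ?u"
  proof (rule past_funI)
    show "?u \<in> borel_measurable borel" by (rule measurable_compose[OF shiftby_measurable um])
    fix x y :: "int \<Rightarrow> 'a" assume "agree {..0} x y"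
    then have "agree {..i} (shiftby (- i) x) (shiftby (- i) y)" by (simp add: agree_shiftby_atMost)
    then show "?u x = ?u y" using u by (simp add: past_fun_def)
  qed
  have g0_shift: "g0 D g i (shiftby (- i) x) \<alpha> = g0 D g 0 x \<alpha>" for x
    unfolding g0_def past_shiftby by simp
  from one_step_0[OF \<open>past_fun 0 ?u\<close>, of \<alpha>]
  have "(\<integral>\<^sup>+x. u (shiftby (- i) x) * indicator {x. x (i + 1) = \<alpha>} (shiftby (- i) x) \<partial>\<mu>) =
     (\<integral>\<^sup>+x. u (shiftby (- i) x) * ennreal (g0 D g i (shiftby (- i) x) \<alpha>) \<partial>\<mu>)"
    by (simp add: shiftby_apply indicator_def g0_shift)
  moreover have "(\<lambda>x. u x * indicator {x. x (i + 1) = \<alpha>} x) \<in> borel_measurable borel"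
    by (intro borel_measurable_times_ennreal um borel_measurable_indicator eval_eq_borel)
  moreover have "(\<lambda>x. u x * ennreal (g0 D g i x \<alpha>)) \<in> borel_measurable borel"
    using um by measurable
  ultimately show ?thesis
    using shift_invariant[of "\<lambda>x. u x * indicator {x. x (i + 1) = \<alpha>} x" "- i"]
      shift_invariant[of "\<lambda>x. u x * ennreal (g0 D g i x \<alpha>)" "- i"] by simp
qed

text \<open>Integrating out the last letter leaves a value of \<open>g\<close> at time
  \<open>i + length b\<close>. On the cylinder of \<open>b\<close> it equals the value at
  \<open>cat i x b\<close>, which depends on coordinates up to \<open>i\<close> only and can be
  absorbed into \<open>u\<close> for the induction.\<close>

lemma word_formula:
  assumes u: "past_fun i u"
  shows "(\<integral>\<^sup>+x. u x * indicator {x. map x [i + 1..i + int (length a)] = a} x \<partial>\<mu>) =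
    (\<integral>\<^sup>+x. u x * ennreal (word_prob D g i x a) \<partial>\<mu>)"
  using u
proof (induction a arbitrary: u rule: rev_induct)
  case (snoc \<alpha> b)
  let ?k = "i + int (length b)"
  let ?I = "\<lambda>x. indicator {x. map x [i + 1..?k] = b} x :: ennreal"
  have "past_fun ?k (\<lambda>x. u x * ?I x)"
  proof (rule past_funI)
    show "(\<lambda>x. u x * ?I x) \<in> borel_measurable borel"
      using snoc.prems unfolding past_fun_def
      by (intro borel_measurable_times_ennreal borel_measurable_indicator map_eq_borel) simp
    fix x y :: "int \<Rightarrow> 'a" assume *: "agree {..?k} x y"
    then have "agree {..i} x y" "agree {i + 1..?k} x y" by (auto elim!: agree_mono)
    then have eq: "u x = u y" "map x [i + 1..?k] = map y [i + 1..?k]"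
      using snoc.prems by (simp_all only: map_eq_iff_agree past_fun_def)
    then show "u x * ?I x = u y * ?I y" by (simp only: indicator_def mem_Collect_eq eq)
  qed
  note one = one_step[OF this, of \<alpha>]
  let ?g = "\<lambda>x. ennreal (g0 D g ?k (cat i x b) \<alpha>)"
  have ug: "past_fun i (\<lambda>x. u x * ?g x)"
  proof (rule past_fun_mult[OF snoc.prems past_funI])
    show "?g \<in> borel_measurable borel" by (intro measurable_compose[OF cat_measurable] measurable_compose[OF g0_measurable]) simp
    show "\<And>x y. agree {..i} x y \<Longrightarrow> ?g x = ?g y" using cat_agree by metis
  qed
  have "map x [i + 1..i + int (length (b @ [\<alpha>]))] = b @ [\<alpha>] \<longleftrightarrow> map x [i + 1..?k] = b \<and> x (?k + 1) = \<alpha>" for x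
    using upto_rec2[of "i + 1" "?k + 1"] by (simp add: algebra_simps)
  then have "(\<integral>\<^sup>+x. u x * indicator {x. map x [i + 1..i + int (length (b @ [\<alpha>]))] = b @ [\<alpha>]} x \<partial>\<mu>) =
      (\<integral>\<^sup>+x. u x * ?I x * indicator {x. x (?k + 1) = \<alpha>} x \<partial>\<mu>)"
    by (intro nn_integral_cong) (simp add: indicator_def)
  also have "\<dots> = (\<integral>\<^sup>+x. u x * ?I x * ennreal (g0 D g ?k x \<alpha>) \<partial>\<mu>)" by (rule one)
  also have "\<dots> = (\<integral>\<^sup>+x. u x * ?g x * ?I x \<partial>\<mu>)"
  proof (rule nn_integral_cong)
    fix x
    have "g0 D g ?k (cat i x b) \<alpha> = g0 D g ?k x \<alpha>" if "map x [i + 1..?k] = b"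
      using that by (intro g0_agree) (simp add: agree_cat_iff)
    then show "u x * ?I x * ennreal (g0 D g ?k x \<alpha>) = u x * ?g x * ?I x"
      by (auto simp: indicator_def)
  qed
  also have "\<dots> = (\<integral>\<^sup>+x. u x * ?g x * ennreal (word_prob D g i x b) \<partial>\<mu>)"
    by (rule snoc.IH[OF ug])
  also have "\<dots> = (\<integral>\<^sup>+x. u x * ennreal (word_prob D g i x (b @ [\<alpha>])) \<partial>\<mu>)"
    by (intro nn_integral_cong) (simp add: word_prob_snoc ennreal_mult word_prob_range g0_range mult_ac)
  finally show ?case .
qed simp

text \<open>A \<open>g\<close>-measure is not assumed to be carried by \<open>E(g)\<close>: the words extending a typical past outside \<open>D\<close>
  are only seen to have probability zero.\<close>
lemma AE_word_prob_D:
  "AE x in \<mu>. \<forall>a. word_prob D g i x a \<noteq> 0 \<longrightarrow> past (i + int (length a)) (cat i x a) \<in> D"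
  unfolding AE_all_countable
proof
  fix a :: "'a list"
  let ?k = "i + int (length a)"
  \<comment> \<open>The bad event itself is the test function. On the cylinder of \<open>a\<close>
    the past of \<open>cat i x a\<close> is that of \<open>x\<close>, which lies in \<open>D\<close>
    almost surely.\<close>
  let ?u = "\<lambda>x::int \<Rightarrow> 'a. indicator {x. past ?k (cat i x a) \<notin> D} x :: ennreal"
  have "(\<lambda>x. cat i x a) -` (past ?k -` (- D) \<inter> space borel) \<inter> space borel \<in> sets (borel :: (int \<Rightarrow> 'a) measure)"
    by (intro measurable_sets[OF cat_measurable] measurable_sets[OF past_measurable]) simp
  then have "{x. past ?k (cat i x a) \<notin> D} \<in> sets borel" by (simp add: vimage_def)
  then have um: "?u \<in> borel_measurable borel" by (rule borel_measurable_indicator)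
  have u: "past_fun i ?u"
    by (rule past_funI[OF um]) (simp add: indicator_def cat_agree)
  have "(\<integral>\<^sup>+x. ?u x * ennreal (word_prob D g i x a) \<partial>\<mu>) =
      (\<integral>\<^sup>+x. ?u x * indicator {x. map x [i + 1..?k] = a} x \<partial>\<mu>)"
    by (rule word_formula[OF u, symmetric])
  also have "\<dots> = (\<integral>\<^sup>+x. 0 \<partial>\<mu>)"
  proof (rule nn_integral_cong_AE)
    show "AE x in \<mu>. ?u x * indicator {x. map x [i + 1..?k] = a} x = 0"
      using AE_past_D[of ?k]
    proof eventually_elim
      case (elim x)
      have "past ?k (cat i x a) = past ?k x" if "map x [i + 1..?k] = a"
        using that by (simp add: past_eq_iff agree_cat_iff)
      then show ?case using elim by (auto simp: indicator_def)
    qed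
  qed
  finally have "(\<integral>\<^sup>+x. ?u x * ennreal (word_prob D g i x a) \<partial>\<mu>) = 0" by simp
  moreover have "(\<lambda>x. ?u x * ennreal (word_prob D g i x a)) \<in> borel_measurable \<mu>"
    by (intro measurable_muI borel_measurable_times_ennreal um) measurable
  ultimately have "AE x in \<mu>. ?u x * ennreal (word_prob D g i x a) = 0"
    by (simp add: nn_integral_0_iff_AE)
  then show "AE x in \<mu>. word_prob D g i x a \<noteq> 0 \<longrightarrow> past ?k (cat i x a) \<in> D"
  proof eventually_elim
    case (elim x)
    then show ?case using word_prob_range(1)[of i x a]
      by (auto simp: indicator_def ennreal_eq_0_iff split: if_splits)
  qed
qed

end

section \<open>The image under a conjugacy\<close>

text \<open>One window \<open>m\<close> serves both maps, so the assumptions are symmetric and each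
  later result can be used for the inverse as well.\<close>

locale conjugacy =
  fixes X :: "(int \<Rightarrow> 'a::{finite,discrete_topology}) set"
    and Y :: "(int \<Rightarrow> 'b::{finite,discrete_topology}) set"
    and \<phi> :: "(int \<Rightarrow> 'a) \<Rightarrow> (int \<Rightarrow> 'b)" and \<psi> :: "(int \<Rightarrow> 'b) \<Rightarrow> (int \<Rightarrow> 'a)" and m :: nat
  assumes subshift_X: "subshift X" and subshift_Y: "subshift Y"
    and phi_Y: "x \<in> X \<Longrightarrow> \<phi> x \<in> Y" and psi_X: "y \<in> Y \<Longrightarrow> \<psi> y \<in> X"
    and psi_phi: "x \<in> X \<Longrightarrow> \<psi> (\<phi> x) = x" and phi_psi: "y \<in> Y \<Longrightarrow> \<phi> (\<psi> y) = y"
    and phi_shift: "x \<in> X \<Longrightarrow> \<phi> (shift x) = shift (\<phi> x)"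
    and phi_window: "x \<in> X \<Longrightarrow> x' \<in> X \<Longrightarrow> agree {j - int m..j + int m} x x' \<Longrightarrow> \<phi> x j = \<phi> x' j"
    and psi_window: "y \<in> Y \<Longrightarrow> y' \<in> Y \<Longrightarrow> agree {j - int m..j + int m} y y' \<Longrightarrow> \<psi> y j = \<psi> y' j"
begin

text \<open>An extension of \<open>\<phi>\<close> to all sequences by a block map, again with window \<open>[-m,m]\<close>.\<close>
definition ext :: "(int \<Rightarrow> 'a) \<Rightarrow> (int \<Rightarrow> 'b)" where
  "ext x j = (SOME b. \<exists>x'\<in>X. agree {j - int m..j + int m} x x' \<and> \<phi> x' j = b)"

lemma ext_eq: assumes "x \<in> X" shows "ext x = \<phi> x"
proof
  fix j
  have "\<exists>b. \<exists>x'\<in>X. agree {j - int m..j + int m} x x' \<and> \<phi> x' j = b"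
    using assms by (intro exI[of _ "\<phi> x j"] bexI[of _ x]) simp_all
  then have "\<exists>x'\<in>X. agree {j - int m..j + int m} x x' \<and> \<phi> x' j = ext x j"
    unfolding ext_def by (rule someI_ex)
  then obtain x' where x': "x' \<in> X" "agree {j - int m..j + int m} x x'" "\<phi> x' j = ext x j" by blast
  then show "ext x j = \<phi> x j" using phi_window[OF assms x'(1,2)] by simp
qed

lemma ext_window: "agree {j - int m..j + int m} x x' \<Longrightarrow> ext x j = ext x' j"
proof -
  assume "agree {j - int m..j + int m} x x'"
  then have "agree {j - int m..j + int m} x z \<longleftrightarrow> agree {j - int m..j + int m} x' z" for z
    by (auto simp: agree_def)
  then show ?thesis unfolding ext_def by simp
qed

lemma ext_agree:
  assumes "agree I x x'" "\<And>j. j \<in> J \<Longrightarrow> {j - int m..j + int m} \<subseteq> I"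
  shows "agree J (ext x) (ext x')"
  unfolding agree_def using ext_window agree_mono[OF assms(1) assms(2)] by blast

lemma ext_measurable_eval [measurable]: "(\<lambda>x. ext x j) \<in> measurable borel (count_space UNIV)"
proof -
  have "open {x. ext x j = b}" for b
  proof (subst open_subopen, safe)
    fix x assume "b = ext x j"
    then show "\<exists>T. open T \<and> x \<in> T \<and> T \<subseteq> {y. ext y j = ext x j}"
      using ext_window[of j x] by (intro exI[of _ "{y. agree {j - int m..j + int m} x y}"])
        (auto intro!: open_agree)
  qed
  then have "(\<lambda>x. ext x j) -` {b} \<inter> space borel \<in> sets borel" for b
    by (simp add: vimage_def borel_open)
  then show ?thesis by (simp add: measurable_count_space_eq2_countable)
qed

lemma ext_measurable [measurable]: "ext \<in> borel_measurable borel"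
  by (rule measurable_seqI) (rule ext_measurable_eval)

lemma psi_agree:
  assumes "y \<in> Y" "y' \<in> Y" "agree {..i} y y'"
  shows "agree {..i - int m} (\<psi> y) (\<psi> y')"
  unfolding agree_def
proof
  fix j assume "j \<in> {..i - int m}"
  then have "agree {j - int m..j + int m} y y'" by (intro agree_mono[OF assms(3)]) auto
  then show "\<psi> y j = \<psi> y' j" by (rule psi_window[OF assms(1,2)])
qed

text \<open>The image under one map is a preimage under its inverse, which is the measurable block
  map \<open>ext\<close> on \<open>X\<close>.\<close>

lemma psi_image_borel:
  assumes "A' \<subseteq> Y" "A' \<in> sets borel" shows "\<psi> ` A' \<in> sets borel"
proof -
  have "\<psi> ` A' = X \<inter> (ext -` A' \<inter> space borel)"
    using assms(1) psi_X phi_psi psi_phi ext_eq by (force simp: image_iff)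
  moreover have "X \<in> sets borel" using subshift_X by (simp add: subshift_def borel_closed)
  ultimately show ?thesis using measurable_sets[OF ext_measurable assms(2)] by auto
qed

text \<open>Coding loses \<open>m\<close> coordinates of the common past; the union over all fibers
  absorbs the loss.\<close>

lemma psi_fiber_union:
  assumes "x \<in> X" "A' \<subseteq> fiber_union Y (\<phi> x)" shows "\<psi> ` A' \<subseteq> fiber_union X x"
proof
  fix z assume "z \<in> \<psi> ` A'"
  then obtain y where "z = \<psi> y" "y \<in> fiber_union Y (\<phi> x)" using assms(2) by blast
  then obtain k where y: "z = \<psi> y" "y \<in> Y" "agree {..- int k} (\<phi> x) y"
    by (auto simp: fiber_union_def fiber_iff)
  have "agree {..- int k - int m} (\<psi> (\<phi> x)) (\<psi> y)"
    by (rule psi_agree[OF phi_Y[OF assms(1)] y(2,3)])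
  then have "z \<in> fiber X (- int (k + m)) x"
    using y psi_X psi_phi[OF assms(1)] by (simp add: fiber_iff)
  then show "z \<in> fiber_union X x" unfolding fiber_union_def by blast
qed

lemma psi_shift: assumes "y \<in> Y" shows "\<psi> (shift y) = shift (\<psi> y)"
proof -
  have "shift y = \<phi> (shift (\<psi> y))" using phi_shift[OF psi_X[OF assms]] phi_psi[OF assms] by simp
  moreover have "shift (\<psi> y) \<in> X" using psi_X[OF assms] subshift_X by (auto simp: subshift_def)
  ultimately show ?thesis using psi_phi by metis
qed

lemma inverse: "conjugacy Y X \<psi> \<phi> m"
  by unfold_locales
    (fact subshift_X subshift_Y phi_Y psi_X psi_phi phi_psi phi_window psi_window psi_shift)+

end

section \<open>From proportional measures to a formula for the image g-function\<close>

text \<open>Proportionality is stated for some representatives and for direct images of sets, a form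
  that passes to the inverse map with constant 1/c.\<close>

locale g_conjugacy = A: g_system X D g + B: g_system Y D' g' + conjugacy X Y \<phi> \<psi> m
  for X :: "(int \<Rightarrow> 'a::{finite,discrete_topology}) set" and D g
    and Y :: "(int \<Rightarrow> 'b::{finite,discrete_topology}) set" and D' g' \<phi> \<psi> m +
  assumes phi_E: "x \<in> E_set X D g \<Longrightarrow> \<phi> x \<in> E_set Y D' g'"
    and psi_E: "y \<in> E_set Y D' g' \<Longrightarrow> \<psi> y \<in> E_set X D g"
    and lambda_image: "x \<in> E_set X D g \<Longrightarrow> \<exists>L L' c. is_lambda X g x L \<and> is_lambda Y g' (\<phi> x) L' \<and>
      0 < c \<and> c < \<infinity> \<and> (\<forall>A\<in>sets L. emeasure L' (\<phi> ` A) = c * emeasure L A)"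
begin

lemma inverse_g_conjugacy: "g_conjugacy Y D' g' X D g \<psi> \<phi> m"
proof (intro g_conjugacy.intro g_conjugacy_axioms.intro)
  fix y assume y: "y \<in> E_set Y D' g'"
  then have yY: "y \<in> Y" by (rule B.E_X)
  have x: "\<psi> y \<in> E_set X D g" "\<psi> y \<in> X" using psi_E[OF y] psi_X[OF yY] by auto
  obtain L L' c where L: "is_lambda X g (\<psi> y) L" "is_lambda Y g' y L'" "0 < c" "c < \<infinity>"
    "\<And>A. A \<in> sets L \<Longrightarrow> emeasure L' (\<phi> ` A) = c * emeasure L A"
    using lambda_image[OF x(1)] phi_psi[OF yY] by auto
  have "emeasure L (\<psi> ` A') = 1 / c * emeasure L' A'" if A': "A' \<in> sets L'" for A'
  proof -
    have A'Y: "A' \<subseteq> fiber_union Y y" "A' \<in> sets borel" using A' by (auto simp: B.is_lambda_sets(1)[OF L(2)])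
    then have sub: "A' \<subseteq> Y" by (auto simp: fiber_union_def fiber_iff)
    have "\<psi> ` A' \<in> sets L"
      using psi_image_borel[OF sub A'Y(2)] psi_fiber_union[OF x(2), of A'] A'Y phi_psi[OF yY]
      by (simp add: A.is_lambda_sets(1)[OF L(1)])
    moreover have "\<phi> ` \<psi> ` A' = A'" using sub phi_psi by (force simp: image_iff)
    ultimately have "emeasure L' A' = c * emeasure L (\<psi> ` A')" using L(5) by metis
    moreover have "1 / c * c = 1"
      using L(3,4) by (simp add: ennreal_divide_times ennreal_divide_self)
    ultimately show ?thesis by (metis mult.assoc mult_1)
  qed
  moreover have "0 < 1 / c" "1 / c < \<infinity>"
  proof -
    obtain r where r: "c = ennreal r" "r > 0" using L(3,4) by (cases c) auto
    then have "1 / c = ennreal (1 / r)" using divide_ennreal[of 1 r] by simp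
    then show "0 < 1 / c" "1 / c < \<infinity>" using r by simp_all
  qed
  ultimately show "\<exists>L L' c. is_lambda Y g' y L \<and> is_lambda X g (\<psi> y) L' \<and>
      0 < c \<and> c < \<infinity> \<and> (\<forall>A\<in>sets L. emeasure L' (\<psi> ` A) = c * emeasure L A)"
    using L(1,2) by blast
qed (fact inverse psi_E phi_E A.g_system_axioms B.g_system_axioms)+

text \<open>For \<open>z\<close> with \<open>z\<^bsub>(-\<infinity>,-m]\<^esub> = x\<^bsub>(-\<infinity>,-m]\<^esub>\<close> and \<open>z\<^bsub>(-m,m+1]\<^esub> = a\<close>, this says that \<open>\<phi>(z)\<close>
  agrees with \<open>v\<close> on \<open>(-2m,0]\<close> and has the letter \<open>\<beta>\<close> at \<open>1\<close>.\<close>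
definition word_ok :: "(int \<Rightarrow> 'b) \<Rightarrow> 'b \<Rightarrow> (int \<Rightarrow> 'a) \<Rightarrow> 'a list \<Rightarrow> bool" where
  "word_ok v \<beta> x a \<longleftrightarrow> agree {1 - 2 * int m..0} v (ext (cat (- int m) x a)) \<and> ext (cat (- int m) x a) 1 = \<beta>"

text \<open>The letters of \<open>x\<close> from \<open>1 - m\<close> to \<open>1 + m\<close>: the
  past of the image up to 0 fixes \<open>x\<close> up to \<open>-m\<close>, and the image letter at
  1 reads \<open>x\<close> up to \<open>1 + m\<close>.\<close>

definition words :: "'a list set" where
  "words = {a. length a = 2 * m + 1}"

lemma finite_words: "finite words"
  using finite_lists_length_eq[of "UNIV :: 'a set" "2 * m + 1"] by (simp add: words_def)

text \<open>The probability, given the past \<open>x\<^bsub>(-\<infinity>,-m]\<^esub>\<close>, that the image agrees with \<open>v\<close> on \<open>(-2m,0]\<close>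
  and has the letter \<open>\<beta>\<close> at \<open>1\<close>.\<close>
definition num :: "(int \<Rightarrow> 'b) \<Rightarrow> 'b \<Rightarrow> (int \<Rightarrow> 'a) \<Rightarrow> real" where
  "num v \<beta> x = (\<Sum>a | a \<in> words \<and> word_ok v \<beta> x a. word_prob D g (- int m) x a)"

definition den :: "(int \<Rightarrow> 'b) \<Rightarrow> (int \<Rightarrow> 'a) \<Rightarrow> real" where
  "den v x = (\<Sum>\<beta>\<in>UNIV. num v \<beta> x)"

lemma num_nonneg: "0 \<le> num v \<beta> x"
  unfolding num_def by (intro sum_nonneg A.word_prob_range)

lemma num_le_den: "num v \<beta> x \<le> den v x"
  unfolding den_def by (intro member_le_sum) (auto simp: num_nonneg)

lemma den_nonneg: "0 \<le> den v x"
  unfolding den_def by (intro sum_nonneg num_nonneg)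

text \<open>The image from \<open>1 - 2 * m\<close> on reads its source from
  \<open>1 - 3 * m\<close> on. Dependence on finitely many coordinates of the past is used when
  passing to the limit.\<close>

lemma word_ok_past:
  assumes "agree {1 - 3 * int m..- int m} x x'"
  shows "word_ok v \<beta> x a \<longleftrightarrow> word_ok v \<beta> x' a"
proof -
  have "agree {1 - 3 * int m..} (cat (- int m) x a) (cat (- int m) x' a)"
    using assms by (auto simp: agree_def cat_def)
  then have "agree {1 - 2 * int m..} (ext (cat (- int m) x a)) (ext (cat (- int m) x' a))"
    by (rule ext_agree) auto
  then show ?thesis unfolding word_ok_def agree_def by auto
qed

lemma num_past:
  assumes "agree {..- int m} x x'" shows "num v \<beta> x = num v \<beta> x'"
proof -
  have "agree {1 - 3 * int m..- int m} x x'" using assms by (rule agree_mono) auto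
  then show ?thesis unfolding num_def using word_ok_past word_prob_agree[OF assms] by simp
qed

lemma den_past: "agree {..- int m} x x' \<Longrightarrow> den v x = den v x'"
  unfolding den_def using num_past by simp

lemma num_cong: "agree {1 - 2 * int m..0} v v' \<Longrightarrow> num v \<beta> x = num v' \<beta> x"
proof -
  assume "agree {1 - 2 * int m..0} v v'"
  then have "agree {1 - 2 * int m..0} v w \<longleftrightarrow> agree {1 - 2 * int m..0} v' w" for w
    by (auto simp: agree_def)
  then show ?thesis unfolding num_def word_ok_def by simp
qed

lemma den_cong: "agree {1 - 2 * int m..0} v v' \<Longrightarrow> den v x = den v' x"
  unfolding den_def using num_cong by simp

lemma word_ok_measurable: "{x. word_ok v \<beta> x a} \<in> sets borel"
proof -
  have "{x. word_ok v \<beta> x a} = (\<lambda>x. ext (cat (- int m) x a)) -`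
      ({y. agree {1 - 2 * int m..0} v y} \<inter> {y. y 1 = \<beta>}) \<inter> space borel"
    by (auto simp: word_ok_def)
  also have "\<dots> \<in> sets borel"
    by (intro measurable_sets[OF measurable_compose[OF cat_measurable ext_measurable]] sets.Int
        borel_closed closed_agree eval_eq_borel)
  finally show ?thesis .
qed

lemma num_alt: "num v \<beta> x = (\<Sum>a\<in>words. indicator {x. word_ok v \<beta> x a} x * word_prob D g (- int m) x a)"
  unfolding num_def using finite_words
  by (intro sum.mono_neutral_cong_left) (auto simp: indicator_def)

lemma num_measurable [measurable]: "num v \<beta> \<in> borel_measurable borel"
  unfolding num_alt[abs_def]
  by (intro borel_measurable_sum borel_measurable_times borel_measurable_indicator word_ok_measurable
      A.word_prob_measurable)

lemma den_measurable [measurable]: "den v \<in> borel_measurable borel"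
  unfolding den_def[abs_def] by (intro borel_measurable_sum num_measurable)

lemma word_ok_iff:
  assumes z: "z \<in> X" "agree {..- int m} x z" "map z [1 - int m..1 + int m] = a"
  shows "word_ok v \<beta> x a \<longleftrightarrow> agree {1 - 2 * int m..0} v (\<phi> z) \<and> \<phi> z 1 = \<beta>"
proof -
  have len: "length a = 2 * m + 1" using z(3) by auto
  have "agree {..- int m + int (length a)} (cat (- int m) x a) z"
    unfolding agree_cat_iff using z by (simp add: len algebra_simps)
  then have "agree {..1 + int m} (cat (- int m) x a) z" by (simp add: len add.commute)
  then have "agree {..1} (ext (cat (- int m) x a)) (ext z)" by (rule ext_agree) auto
  then have *: "agree {..1} (ext (cat (- int m) x a)) (\<phi> z)" using ext_eq[OF z(1)] by simp
  then have **: "agree {1 - 2 * int m..0} (ext (cat (- int m) x a)) (\<phi> z)" by (rule agree_mono) auto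
  have "ext (cat (- int m) x a) 1 = \<phi> z 1" using * by (simp add: agree_def)
  moreover from ** have "agree {1 - 2 * int m..0} v (ext (cat (- int m) x a)) \<longleftrightarrow> agree {1 - 2 * int m..0} v (\<phi> z)"
    by (auto simp: agree_def)
  ultimately show ?thesis unfolding word_ok_def by simp
qed

text \<open>A point of \<open>Y\<close> agreeing with \<phi>(x) up to 0 has a preimage agreeing with
  \<open>x\<close> up to \<open>-m\<close>. Conversely, agreement up to \<open>-m\<close> forces the
  images to agree only up to \<open>-2m\<close>; \<open>word_ok\<close> supplies the coordinates
  from \<open>1 - 2 * m\<close> to 0 and the letter at 1.\<close>

lemma fiber_cyl_image:
  assumes x: "x \<in> X"
  shows "fiber_cyl Y 0 (\<phi> x) [\<beta>] = \<phi> ` (\<Union>a\<in>{a. a \<in> words \<and> word_ok (\<phi> x) \<beta> x a}. fiber_cyl X (- int m) x a)"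
proof -
  have cyl: "z \<in> fiber_cyl X (- int m) x a \<longleftrightarrow> z \<in> X \<and> agree {..- int m} x z \<and> map z [1 - int m..1 + int m] = a"
    if "a \<in> words" for a z
    using that by (simp add: fiber_cyl_iff words_def algebra_simps)
  show ?thesis
  proof (intro set_eqI iffI)
    fix y assume "y \<in> fiber_cyl Y 0 (\<phi> x) [\<beta>]"
    then have y: "y \<in> Y" "agree {..0} (\<phi> x) y" "y 1 = \<beta>" by (auto simp: fiber_cyl_iff)
    define a where "a = map (\<psi> y) [1 - int m..1 + int m]"
    have z: "\<psi> y \<in> X" "agree {..- int m} x (\<psi> y)" "map (\<psi> y) [1 - int m..1 + int m] = a"
      using psi_X[OF y(1)] psi_agree[OF phi_Y[OF x] y(1,2)] psi_phi[OF x] by (simp_all add: a_def)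
    have a: "a \<in> words" by (simp add: a_def words_def)
    have "agree {1 - 2 * int m..0} (\<phi> x) y" using y(2) by (rule agree_mono) auto
    then have "word_ok (\<phi> x) \<beta> x a"
      unfolding word_ok_iff[OF z] phi_psi[OF y(1)] using y(3) by simp
    moreover have "\<psi> y \<in> fiber_cyl X (- int m) x a" unfolding cyl[OF a] using z by simp
    ultimately show "y \<in> \<phi> ` (\<Union>a\<in>{a. a \<in> words \<and> word_ok (\<phi> x) \<beta> x a}. fiber_cyl X (- int m) x a)"
      using a phi_psi[OF y(1)] by (intro image_eqI[of _ _ "\<psi> y"]) auto
  next
    fix y assume "y \<in> \<phi> ` (\<Union>a\<in>{a. a \<in> words \<and> word_ok (\<phi> x) \<beta> x a}. fiber_cyl X (- int m) x a)"
    then obtain z a where za: "y = \<phi> z" "a \<in> words" "word_ok (\<phi> x) \<beta> x a" "z \<in> fiber_cyl X (- int m) x a"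
      by blast
    from za(4) have z: "z \<in> X" "agree {..- int m} x z" "map z [1 - int m..1 + int m] = a"
      unfolding cyl[OF za(2)] by auto
    have ok: "agree {1 - 2 * int m..0} (\<phi> x) (\<phi> z)" "\<phi> z 1 = \<beta>"
      using za(3) unfolding word_ok_iff[OF z] by auto
    have "agree {..- 2 * int m} (ext x) (ext z)" by (rule ext_agree[OF z(2)]) auto
    then have "agree {..- 2 * int m} (\<phi> x) (\<phi> z)" using ext_eq x z(1) by simp
    then have "agree {..0} (\<phi> x) (\<phi> z)"
      using ok(1) by (auto simp: agree_def)
    then show "y \<in> fiber_cyl Y 0 (\<phi> x) [\<beta>]"
      using za(1) phi_Y[OF z(1)] ok(2) by (simp add: fiber_cyl_iff)
  qed
qed

text \<open>Both measures are evaluated on the points over the past of \<phi>(x) with next letter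
  \<beta>: one evaluation gives \<open>g'\<close>, the other a disjoint union of fiber cylinders of
  total weight \<open>num\<close>.\<close>

lemma g'_on_E:
  assumes x: "x \<in> E_set X D g"
  shows "den (\<phi> x) x > 0" "g' (past 0 (\<phi> x)) \<beta> * den (\<phi> x) x = num (\<phi> x) \<beta> x"
proof -
  let ?F = "fiber X (- int m) x" and ?F' = "fiber Y 0 (\<phi> x)"
  have xX: "x \<in> X" and y: "\<phi> x \<in> E_set Y D' g'" using A.E_X[OF x] phi_E[OF x] by auto
  obtain L L' c where L: "is_lambda X g x L" "is_lambda Y g' (\<phi> x) L'" "0 < c" "c < \<infinity>"
    "\<And>A. A \<in> sets L \<Longrightarrow> emeasure L' (\<phi> ` A) = c * emeasure L A"
    using lambda_image[OF x] by blast
  have fin: "0 < emeasure L ?F" "emeasure L ?F < \<infinity>" "0 < emeasure L' ?F'" "emeasure L' ?F' < \<infinity>"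
    using L(1,2) by (auto simp: is_lambda_def)
  obtain l where l: "emeasure L ?F = ennreal l" "l > 0" using fin(1,2) by (cases "emeasure L ?F") auto
  obtain l' where l': "emeasure L' ?F' = ennreal l'" "l' > 0" using fin(3,4) by (cases "emeasure L' ?F'") auto
  obtain r where r: "c = ennreal r" "r > 0" using L(3,4) by (cases c) auto
  have main: "l' * g' (past 0 (\<phi> x)) \<beta> = r * l * num (\<phi> x) \<beta> x" for \<beta>
  proof -
    let ?W = "{a. a \<in> words \<and> word_ok (\<phi> x) \<beta> x a}"
    have finW: "finite ?W" using finite_words by simp
    have cylL: "fiber_cyl X (- int m) x a \<in> sets L" for a
      unfolding A.is_lambda_sets(1)[OF L(1)]
    proof
      have "fiber_cyl X (- int m) x a \<subseteq> fiber X (- int m) x" by (auto simp: fiber_cyl_def)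
      then show "fiber_cyl X (- int m) x a \<subseteq> fiber_union X x" using fiber_subset_union by blast
    qed (rule A.fiber_cyl_borel)
    have disj: "disjoint_family_on (fiber_cyl X (- int m) x) ?W"
      by (auto simp: disjoint_family_on_def fiber_cyl_iff words_def)
    have "emeasure L' (fiber_cyl Y 0 (\<phi> x) [\<beta>]) = c * emeasure L (\<Union>a\<in>?W. fiber_cyl X (- int m) x a)"
      unfolding fiber_cyl_image[OF xX] by (rule L(5)) (use finW cylL in blast)
    also have "emeasure L (\<Union>a\<in>?W. fiber_cyl X (- int m) x a) = (\<Sum>a\<in>?W. emeasure L (fiber_cyl X (- int m) x a))"
      by (rule sum_emeasure[symmetric]) (use finW cylL disj in auto)
    also have "\<dots> = (\<Sum>a\<in>?W. ennreal (l * word_prob D g (- int m) x a))"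
      by (intro sum.cong refl) (use l in \<open>simp add: A.is_lambda_cyl[OF x L(1)] ennreal_mult A.word_prob_range\<close>)
    also have "\<dots> = ennreal (l * num (\<phi> x) \<beta> x)"
      unfolding num_def sum_distrib_left using l(2) A.word_prob_range by (intro sum_ennreal) simp
    finally have "emeasure L' (fiber_cyl Y 0 (\<phi> x) [\<beta>]) = ennreal (r * (l * num (\<phi> x) \<beta> x))"
      using r l(2) num_nonneg by (simp add: ennreal_mult)
    moreover have "emeasure L' (fiber_cyl Y 0 (\<phi> x) [\<beta>]) = ennreal (l' * g' (past 0 (\<phi> x)) \<beta>)"
    proof -
      have "word_prob D' g' 0 (\<phi> x) [\<beta>] = g' (past 0 (\<phi> x)) \<beta>"
        using word_prob_snoc[of D' g' 0 "\<phi> x" "[]" \<beta>] B.E_D[OF y, of 0]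
          g0_agree[of 0 "cat 0 (\<phi> x) []" "\<phi> x" D' g' \<beta>] by (simp add: g0_def)
      then show ?thesis
        using B.is_lambda_cyl[OF y L(2), of 0 "[\<beta>]"] l' B.g_range(1)[OF B.E_D[OF y, of 0]]
        by (simp add: ennreal_mult)
    qed
    ultimately show ?thesis
      using r(2) l(2) l'(2) num_nonneg[of "\<phi> x" \<beta> x] B.g_range(1)[OF B.E_D[OF y, of 0]] by (simp add: mult.assoc)
  qed
  \<comment> \<open>Since \<open>g'\<close> sums to 1, summing over \<beta> expresses the unknown
    constants through \<open>den\<close>; they then cancel.\<close>
  have "l' = (\<Sum>\<beta>\<in>UNIV. l' * g' (past 0 (\<phi> x)) \<beta>)"
    unfolding sum_distrib_left[symmetric] using B.g_sum[OF B.E_D[OF y, of 0]] by simp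
  also have "\<dots> = r * l * den (\<phi> x) x" unfolding main den_def sum_distrib_left ..
  finally have l'_eq: "l' = r * l * den (\<phi> x) x" .
  then show "den (\<phi> x) x > 0" using l'(2) r(2) l(2) by (metis zero_less_mult_pos mult_pos_pos)
  show "g' (past 0 (\<phi> x)) \<beta> * den (\<phi> x) x = num (\<phi> x) \<beta> x"
    using main[of \<beta>] r(2) l(2) unfolding l'_eq by (simp add: algebra_simps)
qed

lemma typical_image:
  assumes x: "x \<in> X"
    and good: "\<And>a. word_prob D g (- int m) x a \<noteq> 0 \<Longrightarrow> past (- int m + int (length a)) (cat (- int m) x a) \<in> D"
    and pos: "den (\<phi> x) x > 0"
  shows "past 0 (\<phi> x) \<in> D' \<and> g' (past 0 (\<phi> x)) \<beta> = num (\<phi> x) \<beta> x / den (\<phi> x) x"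
proof (rule B.E_limit_in_D[where L = "\<lambda>\<beta>. num (\<phi> x) \<beta> x / den (\<phi> x) x", OF phi_Y[OF x]])
  fix \<alpha> and \<epsilon> :: real assume \<epsilon>: "\<epsilon> > 0"
  let ?S = "\<lambda>n. {z \<in> E_set Y D' g'. agree {- int n..0} (\<phi> x) z}"
  \<comment> \<open>The filter of points of \<open>E(g')\<close> whose pasts converge to that of
    \<phi>(x). It controls coordinates up to 0, which makes the coordinates of \<psi>(z) up to
    \<open>-m\<close> converge.\<close>
  define F where "F = (INF n. principal (?S n))"
  have F: "eventually P F \<longleftrightarrow> (\<exists>n. \<forall>z\<in>?S n. P z)" for P
    unfolding F_def
  proof -
    have "\<exists>k\<in>UNIV. principal (?S k) \<le> inf (principal (?S a)) (principal (?S b))" for a b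
      by (rule bexI[of _ "a + b"]) (auto elim!: agree_mono)
    then have "eventually P (INF n. principal (?S n)) \<longleftrightarrow> (\<exists>n\<in>UNIV. eventually P (principal (?S n)))"
      by (intro eventually_INF_base) auto
    then show "eventually P (INF n. principal (?S n)) \<longleftrightarrow> (\<exists>n. \<forall>z\<in>?S n. P z)"
      by (simp add: eventually_principal)
  qed
  have FE: "\<forall>\<^sub>F z in F. \<psi> z \<in> E_set X D g" unfolding F using psi_E by blast
  have Fx: "\<forall>\<^sub>F z in F. \<psi> z j = x j" if "j \<le> - int m" for j
    unfolding F
  proof (intro exI ballI)
    fix z assume "z \<in> ?S (nat (int m - j))"
    then have z: "z \<in> Y" "agree {j - int m..0} (\<phi> x) z" using that B.E_X by auto
    have "agree {j - int m..j + int m} (\<phi> x) z" using z(2) by (rule agree_mono) (use that in auto)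
    then have "\<psi> (\<phi> x) j = \<psi> z j" by (rule psi_window[OF phi_Y[OF x] z(1)])
    then show "\<psi> z j = x j" using psi_phi[OF x] by simp
  qed
  have "\<forall>\<^sub>F z in F. \<forall>j\<in>{1 - 3 * int m..- int m}. \<psi> z j = x j"
    by (rule eventually_ball_finite) (auto intro: Fx)
  \<comment> \<open>These are the coordinates of the past read by \<open>word_ok\<close>, so
    eventually the sums defining \<open>num\<close> run over the same words.\<close>
  then have Fok: "\<forall>\<^sub>F z in F. agree {1 - 3 * int m..- int m} (\<psi> z) x"
    by (simp add: agree_def)
  have lim_num: "((\<lambda>z. num (\<phi> x) \<beta> (\<psi> z)) \<longlongrightarrow> num (\<phi> x) \<beta> x) F" for \<beta>
  proof -
    have "((\<lambda>z. \<Sum>a | a \<in> words \<and> word_ok (\<phi> x) \<beta> x a. word_prob D g (- int m) (\<psi> z) a) \<longlongrightarrow> num (\<phi> x) \<beta> x) F"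
      unfolding num_def by (intro tendsto_sum A.word_prob_tendsto[OF good FE Fx])
    moreover have "\<forall>\<^sub>F z in F. (\<Sum>a | a \<in> words \<and> word_ok (\<phi> x) \<beta> x a. word_prob D g (- int m) (\<psi> z) a)
        = num (\<phi> x) \<beta> (\<psi> z)"
      using Fok by eventually_elim (simp add: num_def word_ok_past)
    ultimately show ?thesis by (simp add: tendsto_cong)
  qed
  have "((\<lambda>z. num (\<phi> x) \<alpha> (\<psi> z) / den (\<phi> x) (\<psi> z)) \<longlongrightarrow> num (\<phi> x) \<alpha> x / den (\<phi> x) x) F"
    unfolding den_def using pos by (intro tendsto_divide tendsto_sum lim_num) (simp add: den_def)
  from tendstoD[OF this \<epsilon>] have "\<forall>\<^sub>F z in F. \<bar>num (\<phi> x) \<alpha> (\<psi> z) / den (\<phi> x) (\<psi> z) - num (\<phi> x) \<alpha> x / den (\<phi> x) x\<bar> < \<epsilon>"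
    by (simp add: dist_real_def)
  moreover have "\<forall>\<^sub>F z in F. g' (past 0 z) \<alpha> = num (\<phi> x) \<alpha> (\<psi> z) / den (\<phi> x) (\<psi> z)"
    unfolding F
  proof (intro exI ballI)
    \<comment> \<open>Points this close have the same block as \<phi>(x) on (-2m,0], so the quotient
      formed with that fixed block is the one giving \<open>g'\<close> at \<open>z\<close>.\<close>
    fix z assume "z \<in> ?S (2 * m)"
    then have z: "z \<in> E_set Y D' g'" "agree {- 2 * int m..0} (\<phi> x) z" by auto
    have "agree {1 - 2 * int m..0} (\<phi> x) z" using z(2) by (rule agree_mono) auto
    then have eq: "num (\<phi> x) \<beta> (\<psi> z) = num z \<beta> (\<psi> z)" "den (\<phi> x) (\<psi> z) = den z (\<psi> z)" for \<beta>
      using num_cong den_cong by blast+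
    have "\<phi> (\<psi> z) = z" using phi_psi B.E_X[OF z(1)] by simp
    then show "g' (past 0 z) \<alpha> = num (\<phi> x) \<alpha> (\<psi> z) / den (\<phi> x) (\<psi> z)"
      using g'_on_E[OF psi_E[OF z(1)]] unfolding eq by (metis less_numeral_extra(3) nonzero_eq_divide_eq)
  qed
  ultimately have "\<forall>\<^sub>F z in F. \<bar>g' (past 0 z) \<alpha> - num (\<phi> x) \<alpha> x / den (\<phi> x) x\<bar> < \<epsilon>"
    by eventually_elim simp
  then show "\<exists>n::nat. \<forall>z\<in>E_set Y D' g'. agree {- int n..0} (\<phi> x) z \<longrightarrow>
      \<bar>g' (past 0 z) \<alpha> - num (\<phi> x) \<alpha> x / den (\<phi> x) x\<bar> < \<epsilon>"
    unfolding F by blast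
qed

end

section \<open>Push-forward of g-measures\<close>

context g_conjugacy
begin

abbreviation window :: "int set" where
  "window \<equiv> {1 - 2 * int m..0}"

text \<open>\<open>num_formula\<close> and \<open>den_formula\<close> hold for a fixed block, while
  the block of the image varies with \<open>x\<close>. These functions, \<open>undefined\<close> off
  the window, represent each block exactly once, so a sum over them selects the right one.\<close>

definition blocks :: "(int \<Rightarrow> 'b) set" where
  "blocks = Pi\<^sub>E window (\<lambda>_. UNIV)"

lemma finite_blocks: "finite blocks"
  unfolding blocks_def by (intro finite_PiE) auto

lemma restrict_blocks: "restrict y window \<in> blocks"
  by (auto simp: blocks_def)

lemma agree_blocks_iff: "v \<in> blocks \<Longrightarrow> agree window v y \<longleftrightarrow> v = restrict y window"
  by (auto simp: blocks_def agree_def PiE_iff extensional_def fun_eq_iff)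

lemma sum_blocks:
  fixes f :: "(int \<Rightarrow> 'b) \<Rightarrow> ennreal"
  shows "(\<Sum>v\<in>blocks. f v * indicator {x. agree window v (ext x)} x) = f (restrict (ext x) window)"
proof -
  have "(\<Sum>v\<in>blocks. f v * indicator {x. agree window v (ext x)} x) =
      (\<Sum>v\<in>blocks. if v = restrict (ext x) window then f v else 0)"
    by (intro sum.cong refl) (auto simp: agree_blocks_iff indicator_def)
  then show ?thesis using finite_blocks restrict_blocks by simp
qed

lemma block_borel [measurable]: "{x. agree window v (ext x)} \<in> sets borel"
proof -
  have "ext -` {y. agree window v y} \<inter> space borel \<in> sets borel"
    by (intro measurable_sets[OF ext_measurable] borel_closed closed_agree)
  then show ?thesis by (simp add: vimage_def)
qed

lemma block_letter_borel: "{x. agree window v (ext x) \<and> ext x 1 = \<beta>} \<in> sets borel"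
proof -
  have "ext -` ({y. agree window v y} \<inter> {y. y 1 = \<beta>}) \<inter> space borel \<in> sets borel"
    by (intro measurable_sets[OF ext_measurable] sets.Int borel_closed closed_agree eval_eq_borel)
  then show ?thesis by (simp add: vimage_def Int_def)
qed

context
  fixes \<mu> :: "(int \<Rightarrow> 'a) measure"
  assumes g_meas: "g_measure X D g \<mu>"
begin

interpretation M: g_measure_system X D g \<mu>
  by unfold_locales (rule g_meas)

text \<open>The letters of \<open>x\<close> on \<open>[1 - m, 1 + m]\<close> form exactly one word,
  so the event is split by words. For a fixed word, \<open>word_ok\<close> depends on the past up to
  \<open>-m\<close> and joins \<open>u\<close> in \<open>word_formula\<close>.\<close>

lemma num_formula:
  assumes u: "past_fun (- int m) u"
  shows "(\<integral>\<^sup>+x. u x * indicator {x. agree window v (ext x) \<and> ext x 1 = \<beta>} x \<partial>\<mu>) =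
    (\<integral>\<^sup>+x. u x * ennreal (num v \<beta> x) \<partial>\<mu>)"
proof -
  let ?i = "- int m"
  let ?I = "\<lambda>a. {x. map x [?i + 1..?i + int (length a)] = a}" and ?O = "\<lambda>a. {x. word_ok v \<beta> x a}"
  have um: "u \<in> borel_measurable borel" using u by (simp add: past_fun_def)
  have uO: "past_fun ?i (\<lambda>x. u x * indicator (?O a) x)" for a
  proof (rule past_fun_mult[OF u past_funI])
    fix x y :: "int \<Rightarrow> 'a" assume "agree {..?i} x y"
    then have "word_ok v \<beta> x a \<longleftrightarrow> word_ok v \<beta> y a"
      by (intro word_ok_past) (auto elim!: agree_mono)
    then show "indicator (?O a) x = (indicator (?O a) y :: ennreal)" by (simp add: indicator_def)
  qed (intro borel_measurable_indicator word_ok_measurable)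
  have point: "(\<Sum>a\<in>words. u x * indicator (?O a) x * indicator (?I a) x) =
      u x * indicator {x. agree window v (ext x) \<and> ext x 1 = \<beta>} x" if x: "x \<in> X" for x
  proof -
    define b where "b = map x [1 - int m..1 + int m]"
    have b: "b \<in> words" by (simp add: b_def words_def)
    have I: "x \<in> ?I a \<longleftrightarrow> a = b" if "a \<in> words" for a
      using that by (auto simp: b_def words_def algebra_simps)
    have "(\<Sum>a\<in>words. u x * indicator (?O a) x * indicator (?I a) x) =
        (\<Sum>a\<in>words. if a = b then u x * indicator (?O a) x else 0)"
      by (intro sum.cong refl) (simp only: indicator_simps I indicator_def, simp)
    also have "\<dots> = u x * indicator (?O b) x" using finite_words b by simp
    also have "x \<in> ?O b \<longleftrightarrow> agree window v (ext x) \<and> ext x 1 = \<beta>"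
      using word_ok_iff[OF x agree_refl, of b v \<beta>] ext_eq[OF x] by (simp add: b_def)
    then have "indicator (?O b) x = (indicator {x. agree window v (ext x) \<and> ext x 1 = \<beta>} x :: ennreal)"
      by (simp add: indicator_def)
    finally show ?thesis .
  qed
  have "(\<integral>\<^sup>+x. u x * indicator {x. agree window v (ext x) \<and> ext x 1 = \<beta>} x \<partial>\<mu>) =
      (\<integral>\<^sup>+x. (\<Sum>a\<in>words. u x * indicator (?O a) x * indicator (?I a) x) \<partial>\<mu>)"
    by (rule nn_integral_cong) (simp only: point M.space_mu)
  also have "\<dots> = (\<Sum>a\<in>words. \<integral>\<^sup>+x. u x * indicator (?O a) x * indicator (?I a) x \<partial>\<mu>)"
    by (intro nn_integral_sum M.measurable_muI borel_measurable_times_ennreal um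
        borel_measurable_indicator word_ok_measurable map_eq_borel)
  also have "\<dots> = (\<Sum>a\<in>words. \<integral>\<^sup>+x. u x * indicator (?O a) x * ennreal (word_prob D g ?i x a) \<partial>\<mu>)"
    by (intro sum.cong refl M.word_formula uO)
  also have "\<dots> = (\<integral>\<^sup>+x. (\<Sum>a\<in>words. u x * indicator (?O a) x * ennreal (word_prob D g ?i x a)) \<partial>\<mu>)"
    by (intro nn_integral_sum[symmetric] M.measurable_muI borel_measurable_times_ennreal um
        borel_measurable_indicator word_ok_measurable) measurable
  also have "\<dots> = (\<integral>\<^sup>+x. u x * ennreal (num v \<beta> x) \<partial>\<mu>)"
  proof (rule nn_integral_cong)
    fix x
    have "ennreal (num v \<beta> x) = (\<Sum>a\<in>words. ennreal (indicator (?O a) x * word_prob D g ?i x a))"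
      unfolding num_alt by (rule sum_ennreal[symmetric]) (simp add: A.word_prob_range)
    also have "\<dots> = (\<Sum>a\<in>words. indicator (?O a) x * ennreal (word_prob D g ?i x a))"
      by (intro sum.cong refl) (simp add: indicator_def)
    finally show "(\<Sum>a\<in>words. u x * indicator (?O a) x * ennreal (word_prob D g ?i x a)) = u x * ennreal (num v \<beta> x)"
      by (simp add: sum_distrib_left mult.assoc)
  qed
  finally show ?thesis .
qed

lemma den_formula:
  assumes u: "past_fun (- int m) u"
  shows "(\<integral>\<^sup>+x. u x * indicator {x. agree window v (ext x)} x \<partial>\<mu>) = (\<integral>\<^sup>+x. u x * ennreal (den v x) \<partial>\<mu>)"
proof -
  have um: "u \<in> borel_measurable borel" using u by (simp add: past_fun_def)
  let ?I = "\<lambda>\<beta>. {x. agree window v (ext x) \<and> ext x 1 = \<beta>}"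
  have "(\<Sum>\<beta>\<in>UNIV. indicator (?I \<beta>) x) = (indicator {x. agree window v (ext x)} x :: ennreal)" for x
  proof -
    have "(\<Sum>\<beta>\<in>UNIV. indicator (?I \<beta>) x :: ennreal) =
        (\<Sum>\<beta>\<in>UNIV. if \<beta> = ext x 1 then indicator {x. agree window v (ext x)} x else 0)"
      by (intro sum.cong refl) (auto simp: indicator_def)
    then show ?thesis by simp
  qed
  then have "(\<integral>\<^sup>+x. u x * indicator {x. agree window v (ext x)} x \<partial>\<mu>) =
      (\<integral>\<^sup>+x. (\<Sum>\<beta>\<in>UNIV. u x * indicator (?I \<beta>) x) \<partial>\<mu>)"
    by (simp flip: sum_distrib_left)
  also have "\<dots> = (\<Sum>\<beta>\<in>UNIV. \<integral>\<^sup>+x. u x * indicator (?I \<beta>) x \<partial>\<mu>)"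
    by (intro nn_integral_sum M.measurable_muI borel_measurable_times_ennreal um
        borel_measurable_indicator block_letter_borel)
  also have "\<dots> = (\<Sum>\<beta>\<in>UNIV. \<integral>\<^sup>+x. u x * ennreal (num v \<beta> x) \<partial>\<mu>)"
    by (intro sum.cong refl num_formula u)
  also have "\<dots> = (\<integral>\<^sup>+x. (\<Sum>\<beta>\<in>UNIV. u x * ennreal (num v \<beta> x)) \<partial>\<mu>)"
    by (intro nn_integral_sum[symmetric] M.measurable_muI borel_measurable_times_ennreal um) measurable
  also have "\<dots> = (\<integral>\<^sup>+x. u x * ennreal (den v x) \<partial>\<mu>)"
    unfolding den_def by (simp add: sum_ennreal num_nonneg flip: sum_distrib_left)
  finally show ?thesis .
qed

text \<open>The event \<open>den v = 0\<close> depends on the past up to \<open>-m\<close>, so its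
  indicator may be used in \<open>den_formula\<close>: the part of it with image block
  \<open>v\<close> has measure equal to the integral of \<open>den v\<close> over it, which is 0.
  Finitely many blocks cover all cases.\<close>

lemma AE_den_pos: "AE x in \<mu>. den (\<phi> x) x > 0"
proof -
  have "AE x in \<mu>. agree window v (ext x) \<longrightarrow> den v x \<noteq> 0" for v
  proof -
    let ?u = "\<lambda>x. indicator {x. den v x = 0} x :: ennreal"
    have "den v -` {0} \<inter> space borel \<in> sets borel" by (rule measurable_sets[OF den_measurable]) simp
    then have "{x. den v x = 0} \<in> sets borel" by (simp add: vimage_def)
    then have um: "?u \<in> borel_measurable borel" by (rule borel_measurable_indicator)
    have u: "past_fun (- int m) ?u"
      by (rule past_funI[OF um]) (simp add: indicator_def den_past)
    have "(\<integral>\<^sup>+x. ?u x * indicator {x. agree window v (ext x)} x \<partial>\<mu>) = (\<integral>\<^sup>+x. ?u x * ennreal (den v x) \<partial>\<mu>)"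
      by (rule den_formula[OF u])
    also have "\<dots> = (\<integral>\<^sup>+x. 0 \<partial>\<mu>)" by (rule nn_integral_cong) (simp add: indicator_def)
    finally have "(\<integral>\<^sup>+x. ?u x * indicator {x. agree window v (ext x)} x \<partial>\<mu>) = 0" by simp
    moreover have "(\<lambda>x. ?u x * indicator {x. agree window v (ext x)} x) \<in> borel_measurable \<mu>"
      by (intro M.measurable_muI borel_measurable_times_ennreal um borel_measurable_indicator block_borel)
    ultimately have "AE x in \<mu>. ?u x * indicator {x. agree window v (ext x)} x = 0"
      by (simp add: nn_integral_0_iff_AE)
    then show ?thesis by eventually_elim (auto simp: indicator_def)
  qed
  then have "AE x in \<mu>. \<forall>v\<in>blocks. agree window v (ext x) \<longrightarrow> den v x \<noteq> 0"
    using finite_blocks by (simp add: AE_ball_countable countable_finite)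
  then show ?thesis using AE_space
  proof eventually_elim
    case (elim x)
    then have x: "ext x = \<phi> x" by (simp add: M.space_mu ext_eq)
    let ?v = "restrict (\<phi> x) window"
    have ag: "agree window ?v (\<phi> x)" by simp
    then have "den ?v x \<noteq> 0" using elim(1) restrict_blocks x by simp
    then show ?case using den_cong[OF ag] den_nonneg[of "\<phi> x" x] by simp
  qed
qed

lemma AE_image:
  "AE x in \<mu>. past 0 (\<phi> x) \<in> D' \<and> (\<forall>\<beta>. g0 D' g' 0 (\<phi> x) \<beta> = num (\<phi> x) \<beta> x / den (\<phi> x) x)"
  using M.AE_word_prob_D[of "- int m"] AE_den_pos AE_space
proof eventually_elim
  case (elim x)
  from typical_image[OF _ _ elim(2)] elim(1,3) show ?case by (simp add: M.space_mu g0_def)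
qed

lemma phi_measurable: "\<phi> \<in> measurable \<mu> (restrict_space borel Y)"
proof -
  have "ext \<in> measurable \<mu> (restrict_space borel Y)"
    by (rule measurable_restrict_space2[OF _ M.measurable_muI[OF ext_measurable]])
      (simp add: M.space_mu ext_eq phi_Y)
  then show ?thesis by (rule measurable_cong[THEN iffD1, rotated]) (simp add: M.space_mu ext_eq)
qed

text \<open>Conditioning is on \<open>x\<close> up to \<open>-m\<close>, but the cylinder on
  \<open>[-k,0]\<close> reads the image up to 0. Splitting by the image block \<open>v\<close> makes
  the missing part constant; \<open>den_formula\<close> then exchanges the indicator of the block
  for \<open>den\<close>, which cancels the denominator, and \<open>num_formula\<close> brings in
  the next letter.\<close>

lemma image_formula:
  "(\<integral>\<^sup>+x. indicator {y. map y [- int k..0] = w} (ext x) * ennreal (num (ext x) \<beta> x / den (ext x) x) \<partial>\<mu>) =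
    (\<integral>\<^sup>+x. indicator {y. map y [- int k..0] = w} (ext x) * indicator {y. y 1 = \<beta>} (ext x) \<partial>\<mu>)"
proof -
  \<comment> \<open>Image coordinates up to \<open>-2m\<close> are determined by \<open>x\<close> up
    to \<open>-m\<close>; the others are taken from \<open>v\<close>, so that \<open>U v\<close> is
    a \<open>past_fun\<close>.\<close>
  define glue where "glue v x = (\<lambda>j. if j \<le> - 2 * int m then ext x j else v j)" for v x
  define U where "U v x = (indicator {y. map y [- int k..0] = w} (glue v x) :: ennreal)" for v x
  have glue: "agree window v (ext x) \<Longrightarrow> agree {..0} (glue v x) (ext x)" for v x
    by (auto simp: glue_def agree_def)
  have glueU: "U v x = indicator {y. map y [- int k..0] = w} (ext x)" if "agree window v (ext x)" for v x
  proof -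
    have "agree {- int k..0} (glue v x) (ext x)" using glue[OF that] by (rule agree_mono) auto
    then have "map (glue v x) [- int k..0] = map (ext x) [- int k..0]" by (simp only: map_eq_iff_agree)
    then show ?thesis by (simp only: U_def indicator_def mem_Collect_eq)
  qed
  have U: "past_fun (- int m) (U v)" for v
  proof (rule past_funI)
    have "glue v \<in> borel_measurable borel"
    proof (rule measurable_seqI)
      fix j show "(\<lambda>x. glue v x j) \<in> measurable borel (count_space UNIV)"
        unfolding glue_def by (cases "j \<le> - 2 * int m") simp_all
    qed
    from measurable_compose[OF this borel_measurable_indicator[OF map_eq_borel]]
    show "U v \<in> borel_measurable borel" by (simp add: U_def[abs_def])
    fix x y :: "int \<Rightarrow> 'a" assume "agree {..- int m} x y"
    then have "agree {..- 2 * int m} (ext x) (ext y)" by (rule ext_agree) auto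
    then have "glue v x = glue v y" by (auto simp: glue_def agree_def fun_eq_iff)
    then show "U v x = U v y" by (simp add: U_def)
  qed
  have Um: "U v \<in> borel_measurable borel" for v using U by (simp add: past_fun_def)
  define q where "q v x = ennreal (num v \<beta> x / den v x)" for v x
  have q_meas: "q v \<in> borel_measurable borel" for v unfolding q_def[abs_def] by measurable
  have q: "past_fun (- int m) (q v)" for v
    by (rule past_funI[OF q_meas]) (simp add: q_def num_past den_past)
  \<comment> \<open>Where \<open>den\<close> vanishes so does \<open>num\<close>, lying between 0
    and \<open>den\<close>; division by zero gives 0, and the identity holds there too.\<close>
  have q_den: "q v x * ennreal (den v x) = ennreal (num v \<beta> x)" for v x
    using num_nonneg[of v \<beta> x] num_le_den[of v \<beta> x] den_nonneg[of v x]
    by (cases "den v x = 0") (simp_all add: q_def flip: ennreal_mult)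
  have point1: "indicator {y. map y [- int k..0] = w} (ext x) * ennreal (num (ext x) \<beta> x / den (ext x) x) =
      (\<Sum>v\<in>blocks. U v x * q v x * indicator {x. agree window v (ext x)} x)" for x
  proof -
    have ag: "agree window (restrict (ext x) window) (ext x)" by simp
    show ?thesis
      unfolding sum_blocks glueU[OF ag] q_def num_cong[OF ag] den_cong[OF ag] ..
  qed
  have point2: "indicator {y. map y [- int k..0] = w} (ext x) * indicator {y. y 1 = \<beta>} (ext x) =
      (\<Sum>v\<in>blocks. U v x * indicator {x. agree window v (ext x) \<and> ext x 1 = \<beta>} x)" for x
  proof -
    have ag: "agree window (restrict (ext x) window) (ext x)" by simp
    have "indicator {x. agree window v (ext x) \<and> ext x 1 = \<beta>} x =
        (indicator {y. y 1 = \<beta>} (ext x) * indicator {x. agree window v (ext x)} x :: ennreal)" for v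
      by (auto simp: indicator_def)
    then have "(\<Sum>v\<in>blocks. U v x * indicator {x. agree window v (ext x) \<and> ext x 1 = \<beta>} x) =
        (\<Sum>v\<in>blocks. (U v x * indicator {y. y 1 = \<beta>} (ext x)) * indicator {x. agree window v (ext x)} x)"
      by (simp add: mult.assoc)
    also have "\<dots> = indicator {y. map y [- int k..0] = w} (ext x) * indicator {y. y 1 = \<beta>} (ext x)"
      unfolding sum_blocks glueU[OF ag] ..
    finally show ?thesis ..
  qed
  have "(\<integral>\<^sup>+x. indicator {y. map y [- int k..0] = w} (ext x) * ennreal (num (ext x) \<beta> x / den (ext x) x) \<partial>\<mu>) =
      (\<Sum>v\<in>blocks. \<integral>\<^sup>+x. U v x * q v x * indicator {x. agree window v (ext x)} x \<partial>\<mu>)"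
    unfolding point1
    by (intro nn_integral_sum M.measurable_muI borel_measurable_times_ennreal Um q_meas
        borel_measurable_indicator block_borel)
  also have "\<dots> = (\<Sum>v\<in>blocks. \<integral>\<^sup>+x. U v x * q v x * ennreal (den v x) \<partial>\<mu>)"
    by (intro sum.cong refl den_formula past_fun_mult U q)
  also have "\<dots> = (\<Sum>v\<in>blocks. \<integral>\<^sup>+x. U v x * ennreal (num v \<beta> x) \<partial>\<mu>)"
    by (simp only: mult.assoc q_den)
  also have "\<dots> = (\<Sum>v\<in>blocks. \<integral>\<^sup>+x. U v x * indicator {x. agree window v (ext x) \<and> ext x 1 = \<beta>} x \<partial>\<mu>)"
    by (intro sum.cong refl num_formula[symmetric] U)
  also have "\<dots> = (\<integral>\<^sup>+x. indicator {y. map y [- int k..0] = w} (ext x) * indicator {y. y 1 = \<beta>} (ext x) \<partial>\<mu>)"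
    unfolding point2
    by (intro nn_integral_sum[symmetric] M.measurable_muI borel_measurable_times_ennreal Um
        borel_measurable_indicator block_letter_borel)
  finally show ?thesis .
qed

lemma image_g_measure: "g_measure Y D' g' (distr \<mu> (restrict_space borel Y) \<phi>)"
  unfolding B.g_measure_iff
proof (intro conjI allI)
  let ?\<nu> = "distr \<mu> (restrict_space borel Y) \<phi>"
  have Yb: "Y \<in> sets borel" using B.closed_X by (rule borel_closed)
  show "sets ?\<nu> = sets (restrict_space borel Y)" by simp
  show "prob_space ?\<nu>" by (rule M.prob_space_distr[OF phi_measurable])
  have shX: "shift \<in> measurable \<mu> \<mu>"
    unfolding measurable_cong_sets[OF refl M.sets_mu]
    by (rule measurable_restrict_space2[OF _ M.measurable_muI]) (auto simp: M.space_mu shift_def)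
  have shY: "shift \<in> measurable (restrict_space borel Y) (restrict_space borel Y)"
    by (rule measurable_restrict_space2[OF _ measurable_restrict_space1])
      (auto simp: space_restrict_space shift_def)
  have "distr ?\<nu> ?\<nu> shift = distr ?\<nu> (restrict_space borel Y) shift" by (rule distr_cong) simp_all
  also have "\<dots> = distr \<mu> (restrict_space borel Y) (shift \<circ> \<phi>)"
    by (rule distr_distr[OF shY phi_measurable])
  also have "\<dots> = distr \<mu> (restrict_space borel Y) (\<phi> \<circ> shift)"
    by (rule distr_cong) (simp_all add: M.space_mu phi_shift)
  also have "\<dots> = distr (distr \<mu> \<mu> shift) (restrict_space borel Y) \<phi>"
    by (rule distr_distr[OF phi_measurable shX, symmetric])
  also have "distr \<mu> \<mu> shift = \<mu>" using g_meas by (simp add: g_measure_def)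
  finally show "distr ?\<nu> ?\<nu> shift = ?\<nu>" .
  have pastD: "{y \<in> space (restrict_space borel Y). past 0 y \<in> D'} \<in> sets (restrict_space borel Y)"
  proof -
    have "past 0 -` D' \<inter> space borel \<in> sets borel" by (rule measurable_sets[OF past_measurable B.D_borel])
    then have "Y \<inter> {y. past 0 y \<in> D'} \<in> sets borel" using Yb by (simp add: vimage_def sets.Int)
    then show ?thesis
      using Yb by (simp add: sets_restrict_space_iff space_restrict_space Int_def)
  qed
  show "AE y in ?\<nu>. past 0 y \<in> D'"
    unfolding AE_distr_iff[OF phi_measurable pastD] using AE_image by eventually_elim simp
  fix k w \<beta>
  let ?I = "\<lambda>y::int \<Rightarrow> 'b. indicator {y. map y [- int k..0] = w} y :: ennreal"
  have nn: "(\<integral>\<^sup>+y. f y \<partial>?\<nu>) = (\<integral>\<^sup>+x. f (\<phi> x) \<partial>\<mu>)" if "f \<in> borel_measurable borel" for f :: "(int \<Rightarrow> 'b) \<Rightarrow> ennreal"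
    by (rule nn_integral_distr[OF phi_measurable]) (simp add: measurable_restrict_space1 that)
  have "(\<integral>\<^sup>+y. ?I y * indicator {y. y 1 = \<beta>} y \<partial>?\<nu>) = (\<integral>\<^sup>+x. ?I (\<phi> x) * indicator {y. y 1 = \<beta>} (\<phi> x) \<partial>\<mu>)"
    by (intro nn borel_measurable_times_ennreal borel_measurable_indicator map_eq_borel eval_eq_borel)
  also have "\<dots> = (\<integral>\<^sup>+x. ?I (ext x) * indicator {y. y 1 = \<beta>} (ext x) \<partial>\<mu>)"
    by (rule nn_integral_cong) (simp add: M.space_mu ext_eq)
  also have "\<dots> = (\<integral>\<^sup>+x. ?I (ext x) * ennreal (num (ext x) \<beta> x / den (ext x) x) \<partial>\<mu>)"
    by (rule image_formula[symmetric])
  also have "\<dots> = (\<integral>\<^sup>+x. ?I (\<phi> x) * ennreal (g0 D' g' 0 (\<phi> x) \<beta>) \<partial>\<mu>)"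
    using AE_image AE_space
    by (intro nn_integral_cong_AE, eventually_elim) (simp add: M.space_mu ext_eq)
  also have "\<dots> = (\<integral>\<^sup>+y. ?I y * ennreal (g0 D' g' 0 y \<beta>) \<partial>?\<nu>)"
    by (intro nn[symmetric] borel_measurable_times_ennreal borel_measurable_indicator map_eq_borel) measurable
  finally show "(\<integral>\<^sup>+y. ?I y * indicator {y. y 1 = \<beta>} y \<partial>?\<nu>) = (\<integral>\<^sup>+y. ?I y * ennreal (g0 D' g' 0 y \<beta>) \<partial>?\<nu>)" .
qed

lemma distr_inverse: "distr (distr \<mu> (restrict_space borel Y) \<phi>) (restrict_space borel X) \<psi> = \<mu>"
proof -
  interpret inv: g_conjugacy Y D' g' X D g \<psi> \<phi> m by (rule inverse_g_conjugacy)
  have "\<psi> \<in> measurable (restrict_space borel Y) (restrict_space borel X)"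
    using inv.phi_measurable[OF image_g_measure] by simp
  then have "distr (distr \<mu> (restrict_space borel Y) \<phi>) (restrict_space borel X) \<psi> =
      distr \<mu> (restrict_space borel X) (\<psi> \<circ> \<phi>)"
    by (rule distr_distr[OF _ phi_measurable])
  also have "\<dots> = distr \<mu> \<mu> (\<lambda>x. x)"
    by (rule distr_cong) (simp_all add: M.sets_mu M.space_mu psi_phi)
  finally show ?thesis by simp
qed

end

end

section \<open>Windows of a conjugacy, and the conclusion\<close>

text \<open>Compactness makes the coordinate at 0 depend on one finite window, and commutation with
  the shift carries this window to all coordinates. It is stated for all larger windows as well, so
  that one window can serve a map and its inverse.\<close>

lemma window_exists:
  fixes \<phi> :: "(int \<Rightarrow> 'a::{finite,discrete_topology}) \<Rightarrow> (int \<Rightarrow> 'b::{finite,discrete_topology})"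
  assumes X: "subshift X" and cont: "continuous_on X \<phi>"
    and shift: "\<And>x. x \<in> X \<Longrightarrow> \<phi> (shift x) = shift (\<phi> x)"
  shows "\<exists>m. \<forall>n\<ge>m. \<forall>j. \<forall>x\<in>X. \<forall>x'\<in>X. agree {j - int n..j + int n} x x' \<longrightarrow> \<phi> x j = \<phi> x' j"
proof -
  have closed: "closed X" using X by (simp add: subshift_def)
  have "\<exists>n::nat. \<forall>x'\<in>X. agree {- int n..int n} x x' \<longrightarrow> \<phi> x' 0 = \<phi> x 0" if x: "x \<in> X" for x
  proof -
    have "openin (top_of_set X) (X \<inter> \<phi> -` {y. y 0 = \<phi> x 0})"
      by (rule continuous_openin_preimage_gen[OF cont open_eval])
    then obtain T where T: "open T" "X \<inter> \<phi> -` {y. y 0 = \<phi> x 0} = X \<inter> T" by (auto simp: openin_open)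
    then have "x \<in> T" using x by blast
    from open_contains_agree[OF T(1) this] obtain n :: nat
      where n: "\<And>x'. agree {- int n..int n} x x' \<Longrightarrow> x' \<in> T" by blast
    then show ?thesis using T(2) by blast
  qed
  then obtain n :: "(int \<Rightarrow> 'a) \<Rightarrow> nat" where
    n: "\<And>x x'. x \<in> X \<Longrightarrow> x' \<in> X \<Longrightarrow> agree {- int (n x)..int (n x)} x x' \<Longrightarrow> \<phi> x' 0 = \<phi> x 0" by metis
  have "X \<subseteq> (\<Union>x\<in>X. {x'. agree {- int (n x)..int (n x)} x x'})" using agree_refl by blast
  then obtain C where C: "C \<subseteq> X" "finite C" "X \<subseteq> (\<Union>x\<in>C. {x'. agree {- int (n x)..int (n x)} x x'})"
    by (rule compactE_image[OF compact_closed_seq[OF closed], rotated]) (auto intro!: open_agree)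
  \<comment> \<open>The sum serves as an upper bound for the windows of the finite subcover.\<close>
  define m where "m = (\<Sum>x\<in>C. n x)"
  have m: "n c \<le> m" if "c \<in> C" for c unfolding m_def using C(2) that by (intro member_le_sum) auto
  have zero: "\<phi> x 0 = \<phi> x' 0" if "x \<in> X" "x' \<in> X" "agree {- int m..int m} x x'" for x x'
  proof -
    obtain c where c: "c \<in> C" "agree {- int (n c)..int (n c)} c x" using C(3) \<open>x \<in> X\<close> by blast
    have "agree {- int (n c)..int (n c)} x x'" by (rule agree_mono[OF that(3)]) (use m[OF c(1)] in auto)
    then have "agree {- int (n c)..int (n c)} c x'" using c(2) agree_trans by blast
    then show ?thesis using n[of c x] n[of c x'] c C(1) that by auto
  qed
  have shiftX: "shiftby k x \<in> X \<longleftrightarrow> x \<in> X" for k x by (rule subshift_shiftby[OF X])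
  have up: "\<phi> (shiftby (int k) x) = shiftby (int k) (\<phi> x)" if "x \<in> X" for k x
  proof (induction k)
    case (Suc k)
    have "\<phi> (shift (shiftby (int k) x)) = shift (\<phi> (shiftby (int k) x))"
      by (rule shift) (simp add: shiftX that)
    then show ?case using Suc.IH by (simp add: shift_def)
  qed simp
  have eq: "\<phi> (shiftby k x) = shiftby k (\<phi> x)" if "x \<in> X" for k x
  proof (cases "k \<ge> 0")
    case True
    then show ?thesis using up[OF that, of "nat k"] by simp
  next
    case False
    have "shiftby (- k) (\<phi> (shiftby k x)) = \<phi> x"
      using up[of "shiftby k x" "nat (- k)"] False that by (simp add: shiftX)
    then have "shiftby k (shiftby (- k) (\<phi> (shiftby k x))) = shiftby k (\<phi> x)" by simp
    then show ?thesis by simp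
  qed
  have "\<phi> x j = \<phi> x' j" if "n \<ge> m" "x \<in> X" "x' \<in> X" "agree {j - int n..j + int n} x x'" for n j x x'
  proof -
    have "agree {- int m..int m} (shiftby j x) (shiftby j x')"
      unfolding agree_shiftby by (rule agree_mono[OF that(4)]) (use that(1) in auto)
    then have "\<phi> (shiftby j x) 0 = \<phi> (shiftby j x') 0" using that by (intro zero) (simp_all add: shiftX)
    then show ?thesis using that by (simp add: eq shiftby_apply)
  qed
  then show ?thesis by blast
qed

lemma conjugacy_exists:
  assumes X: "subshift X" and Y: "subshift Y" and "topological_conjugacy X Y \<phi>"
  shows "\<exists>m. conjugacy X Y \<phi> (inv_into X \<phi>) m"
proof -
  obtain \<psi> where h: "homeomorphism X Y \<phi> \<psi>" and sh: "\<And>x. x \<in> X \<Longrightarrow> \<phi> (shift x) = shift (\<phi> x)"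
    using assms(3) by (auto simp: topological_conjugacy_def)
  have \<phi>Y: "\<phi> x \<in> Y" if "x \<in> X" for x using h that by (auto simp: homeomorphism_def)
  have \<psi>X: "\<psi> y \<in> X" if "y \<in> Y" for y using h that by (auto simp: homeomorphism_def)
  have \<psi>\<phi>: "\<psi> (\<phi> x) = x" if "x \<in> X" for x using h that by (simp add: homeomorphism_def)
  have \<phi>\<psi>: "\<phi> (\<psi> y) = y" if "y \<in> Y" for y using h that by (simp add: homeomorphism_def)
  have inv: "inv_into X \<phi> y = \<psi> y" if "y \<in> Y" for y
    by (rule inv_into_f_eq) (use that \<psi>X \<phi>\<psi> \<psi>\<phi> in \<open>auto intro: inj_on_inverseI\<close>)
  have shX: "shift x \<in> X" if "x \<in> X" for x using X that by (auto simp: subshift_def)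
  have sh\<psi>: "\<psi> (shift y) = shift (\<psi> y)" if "y \<in> Y" for y
    using sh[OF \<psi>X[OF that]] \<phi>\<psi>[OF that] \<psi>\<phi>[OF shX[OF \<psi>X[OF that]]] by metis
  have cont: "continuous_on X \<phi>" "continuous_on Y \<psi>" using h by (simp_all add: homeomorphism_def)
  obtain m1 where m1: "\<forall>n\<ge>m1. \<forall>j. \<forall>x\<in>X. \<forall>x'\<in>X. agree {j - int n..j + int n} x x' \<longrightarrow> \<phi> x j = \<phi> x' j"
    using window_exists[of X \<phi>, OF X cont(1) sh] by (rule exE)
  obtain m2 where m2: "\<forall>n\<ge>m2. \<forall>j. \<forall>y\<in>Y. \<forall>y'\<in>Y. agree {j - int n..j + int n} y y' \<longrightarrow> \<psi> y j = \<psi> y' j"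
    using window_exists[of Y \<psi>, OF Y cont(2) sh\<psi>] by (rule exE)
  have "conjugacy X Y \<phi> (inv_into X \<phi>) (m1 + m2)"
  proof
    fix x x' j assume "x \<in> X" "x' \<in> X" "agree {j - int (m1 + m2)..j + int (m1 + m2)} x x'"
    then show "\<phi> x j = \<phi> x' j" using m1[rule_format, of "m1 + m2" x x' j] by simp
  next
    fix y y' j assume "y \<in> Y" "y' \<in> Y" "agree {j - int (m1 + m2)..j + int (m1 + m2)} y y'"
    then have "\<psi> y j = \<psi> y' j" using m2[rule_format, of "m1 + m2" y y' j] by simp
    then show "inv_into X \<phi> y j = inv_into X \<phi> y' j" using \<open>y \<in> Y\<close> \<open>y' \<in> Y\<close> by (simp add: inv)
  qed (simp_all add: X Y \<phi>Y \<psi>X inv \<psi>\<phi> \<phi>\<psi> sh)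
  then show ?thesis by blast
qed

lemma inverse_maps_ex_iff:
  assumes "\<And>x. P x \<Longrightarrow> Q (f x) \<and> h (f x) = x" and "\<And>y. Q y \<Longrightarrow> P (h y) \<and> f (h y) = y"
  shows "((\<exists>x. P x) \<longleftrightarrow> (\<exists>y. Q y)) \<and> ((\<exists>!x. P x) \<longleftrightarrow> (\<exists>!y. Q y))"
  using assms by metis

theorem proposition3p7:
  fixes X :: "(int \<Rightarrow> 'a::{finite,discrete_topology}) set"
    and D :: "(int \<Rightarrow> 'a) set" and g :: "(int \<Rightarrow> 'a) \<Rightarrow> 'a \<Rightarrow> real"
    and Y :: "(int \<Rightarrow> 'b::{finite,discrete_topology}) set"
    and D' :: "(int \<Rightarrow> 'b) set" and g' :: "(int \<Rightarrow> 'b) \<Rightarrow> 'b \<Rightarrow> real"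
    and \<phi> :: "(int \<Rightarrow> 'a) \<Rightarrow> (int \<Rightarrow> 'b)"
  assumes "subshift X" and "property_D X"
    and "subshift Y" and "property_D Y"
    and "residual_g_function X D g"
    and "residual_g_function Y D' g'"
    and "topological_conjugacy X Y \<phi>"
    and "g_image X D g Y D' g' \<phi>"
  shows "((\<exists>\<mu>. g_measure X D g \<mu>) \<longleftrightarrow> (\<exists>\<mu>. g_measure Y D' g' \<mu>)) \<and>
         ((\<exists>!\<mu>. g_measure X D g \<mu>) \<longleftrightarrow> (\<exists>!\<mu>. g_measure Y D' g' \<mu>))"
proof -
  let ?\<psi> = "inv_into X \<phi>"
  interpret A: g_system X D g by unfold_locales (fact assms)+
  interpret B: g_system Y D' g' by unfold_locales (fact assms)+
  obtain m where m: "conjugacy X Y \<phi> ?\<psi> m"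
    using conjugacy_exists[OF assms(1,3,7)] by blast
  interpret C: conjugacy X Y \<phi> ?\<psi> m by (rule m)
  interpret C': conjugacy Y X ?\<psi> \<phi> m by (rule C.inverse)
  have E: "\<phi> ` E_set X D g = E_set Y D' g'" using assms(8) by (simp add: g_image_def)
  interpret G: g_conjugacy X D g Y D' g' \<phi> ?\<psi> m
  proof
    show "\<And>x. x \<in> E_set X D g \<Longrightarrow> \<phi> x \<in> E_set Y D' g'" using E by blast
    fix y assume "y \<in> E_set Y D' g'"
    then obtain x where "x \<in> E_set X D g" "y = \<phi> x" using E by blast
    then show "?\<psi> y \<in> E_set X D g" using C.psi_phi[OF A.E_X] by simp
  next
    fix x assume x: "x \<in> E_set X D g"
    let ?U = "fiber_union X x" and ?U' = "fiber_union Y (\<phi> x)"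
    \<comment> \<open>The chosen representatives are genuine by \<open>lambda_measure\<close>, since
      the points lie in \<open>E(g)\<close> and \<open>E(g')\<close>.\<close>
    define L where "L = lambda_measure X g x"
    define L' where "L' = lambda_measure Y g' (\<phi> x)"
    have xX: "x \<in> X" by (rule A.E_X[OF x])
    have L: "is_lambda X g x L" unfolding L_def by (rule A.lambda_measure[OF x])
    have L': "is_lambda Y g' (\<phi> x) L'" unfolding L'_def by (rule B.lambda_measure) (use x E in blast)
    obtain c :: real where c: "c > 0" "distr L' (restrict_space borel ?U) ?\<psi> = scale_measure (ennreal c) L"
      using assms(8) x unfolding g_image_def L_def L'_def by blast
    have U'Y: "?U' \<subseteq> Y" and UX: "?U \<subseteq> X" by (auto simp: fiber_union_def fiber_iff)
    have \<psi>U: "?\<psi> y \<in> ?U" if "y \<in> ?U'" for y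
      using C.psi_fiber_union[OF xX subset_refl] that by blast
    have \<phi>U: "\<phi> z \<in> ?U'" if "z \<in> ?U" for z
    proof -
      have "\<phi> ` ?U \<subseteq> ?U'"
        by (rule C'.psi_fiber_union[OF C.phi_Y[OF xX]]) (simp add: C.psi_phi[OF xX])
      then show ?thesis using that by blast
    qed
    \<comment> \<open>On the union of fibers the inverse coincides with its block map
      \<open>C'.ext\<close>, which is Borel on all sequences.\<close>
    have \<psi>: "?\<psi> \<in> measurable L' (restrict_space borel ?U)"
      unfolding measurable_cong_sets[OF B.is_lambda_sets(3)[OF L'] refl]
    proof (rule measurable_cong[THEN iffD1])
      have sp: "space (restrict_space borel ?U') = ?U'" by (simp add: space_restrict_space)
      show "C'.ext y = ?\<psi> y" if "y \<in> space (restrict_space borel ?U')" for y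
        using that U'Y by (intro C'.ext_eq) (auto simp: sp)
      then show "C'.ext \<in> measurable (restrict_space borel ?U') (restrict_space borel ?U)"
        using \<psi>U by (intro measurable_restrict_space2 measurable_restrict_space1 C'.ext_measurable) (auto simp: sp)
    qed
    have "emeasure L' (\<phi> ` A) = ennreal c * emeasure L A" if A: "A \<in> sets L" for A
    proof -
      have AU: "A \<subseteq> ?U" using A by (simp add: A.is_lambda_sets(1)[OF L])
      \<comment> \<open>Direct images under \<phi> are preimages under the inverse, the form in
        which \<open>distr\<close> measures them.\<close>
      have "\<phi> ` A = ?\<psi> -` A \<inter> space L'"
      proof -
        have "z \<in> A \<Longrightarrow> ?\<psi> (\<phi> z) = z" for z using AU UX C.psi_phi by blast
        moreover have "y \<in> ?U' \<Longrightarrow> \<phi> (?\<psi> y) = y" for y using U'Y C.phi_psi by blast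
        ultimately show ?thesis
          using AU \<phi>U unfolding B.is_lambda_sets(2)[OF L'] by (force simp: image_iff)
      qed
      then have "emeasure L' (\<phi> ` A) = emeasure (distr L' (restrict_space borel ?U) ?\<psi>) A"
        using A by (simp add: emeasure_distr[OF \<psi>] A.is_lambda_sets(3)[OF L])
      then show ?thesis by (simp add: c(2))
    qed
    then show "\<exists>L L' c. is_lambda X g x L \<and> is_lambda Y g' (\<phi> x) L' \<and>
        0 < c \<and> c < \<infinity> \<and> (\<forall>A\<in>sets L. emeasure L' (\<phi> ` A) = c * emeasure L A)"
      using L L' c(1) by (intro exI[of _ L] exI[of _ L'] exI[of _ "ennreal c"]) simp
  qed
  interpret G': g_conjugacy Y D' g' X D g ?\<psi> \<phi> m by (rule G.inverse_g_conjugacy)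
  show ?thesis
  proof (rule inverse_maps_ex_iff)
    fix \<mu> assume "g_measure X D g \<mu>"
    then show "g_measure Y D' g' (distr \<mu> (restrict_space borel Y) \<phi>) \<and>
        distr (distr \<mu> (restrict_space borel Y) \<phi>) (restrict_space borel X) ?\<psi> = \<mu>"
      using G.image_g_measure G.distr_inverse by blast
  next
    fix \<nu> assume "g_measure Y D' g' \<nu>"
    then show "g_measure X D g (distr \<nu> (restrict_space borel X) ?\<psi>) \<and>
        distr (distr \<nu> (restrict_space borel X) ?\<psi>) (restrict_space borel Y) \<phi> = \<nu>"
      using G'.image_g_measure G'.distr_inverse by blast
  qed
qed

end
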